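(* Let $\epsilon>0$. Let $\alpha$ be a real number and let $a$ and $q\ge 1$ be integers with $(a,q)=1$ and $|\alpha-a/q|<1/q^2$. Then for every $N\ge 2$, $$\frac{S(\alpha;N)}{N/\sqrt{\log N}}\ll_\epsilon N^{\epsilon}\bigl(q^{-1/4}+N^{-1/2}q^{1/4}+N^{-1/8}\bigr),$$ where $S(\alpha;N)=\sum_{n\le N}b(n)e(n^2\alpha)$ and the implied constant depends only on $\epsilon$.
   Context: $e(x)=e^{2\pi i x}$. $\mathfrak{B}$ denotes the set of odd positive integers that can be written as a sum of two coprime squares, $n=u^2+v^2$ with $u,v\in\mathbb{Z}$, $\gcd(u,v)=1$ ("odd primitive Gaussian integers"); $b(n)$ is the characteristic function of $\mathfrak{B}$, i.e. $b(n)=1$ if $n\in\mathfrak{B}$ and $b(n)=0$ otherwise. Sums over $n\le N$ run over positive integers. *)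

theory Defs
  imports "HOL-Analysis.Analysis"
begin

definition add_char :: "real \<Rightarrow> complex" where
  "add_char x = exp (2 * complex_of_real pi * \<i> * complex_of_real x)"

(* Positivity of n need not be demanded separately, since it follows from oddness. *)
definition odd_prim_gauss :: "nat set" where
  "odd_prim_gauss =
     {n. odd n \<and> (\<exists>u v :: int. gcd u v = 1 \<and> int n = u\<^sup>2 + v\<^sup>2)}"

definition b :: "nat \<Rightarrow> complex" where
  "b n = indicator odd_prim_gauss n"

(* The cutoff N is real, so the index set is given by inequalities rather than as an interval. *)
definition S :: "real \<Rightarrow> real \<Rightarrow> complex" where
  "S \<alpha> N = (\<Sum>n | 1 \<le> n \<and> real n \<le> N. b n * add_char ((real n)\<^sup>2 * \<alpha>))"

end

theory Submission
  imports Defs "HOL-Number_Theory.Number_Theory" "HOL-Computational_Algebra.Squarefree"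
begin

text \<open>A positive integer lies in \<open>odd_prim_gauss\<close> exactly if all its prime factors are \<open>1\<close> modulo \<open>4\<close>,
  so \<open>b\<close> is completely multiplicative. Put \<open>z = N\<^sup>1\<^sup>/\<^sup>4\<close>. Cutting the increasing list of prime factors of \<open>n\<close> where the product
  first reaches \<open>z\<close> gives a bilinear form whose first variable lies in \<open>[z, z\<^sup>2]\<close>, unless \<open>n = s p\<close> with
  \<open>s < z\<close> and \<open>p\<close> a prime. For the latter, \<open>b(p)\<close> is the mean of the two
  characters \<open>\<psi>\<close> modulo \<open>4\<close>, and the primes are detected by Legendre's sieve at level \<open>z\<close>, truncated by Buchstab's
  identity; this leaves sums over \<open>s d l\<close> with \<open>s, d < z\<close> and \<open>l\<close> weighted only by \<open>\<psi>\<close>, and more bilinear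
  forms. The relation between the prime factors of the two variables of a bilinear form is removed by
  finite Fourier analysis. Bilinear forms are estimated by two applications of Cauchy-Schwarz and Weyl
  differencing. The logarithms and divisor functions that arise are absorbed by \<open>N\<^sup>\<epsilon>\<close>.\<close>

section \<open>Sums of two coprime squares\<close>

text \<open>Up to logarithms and divisor functions, a bilinear form whose first variable has size M
  is at most N times M^(-1/2) + q^(-1/4) + (M/N)^(1/4) + N^(-1/2) q^(1/4). The diagonal term
  M^(-1/2) is at most N^(-1/8) once M reaches N^(1/4), and (M/N)^(1/4) is at most N^(-1/8) as long
  as M stays below N^(1/2). This fixes \<open>z\<close> and the interval from z to z^2. A product
  below z that gains a prime below z and thereby reaches z lands in this interval; only a prime of
  size at least z can jump over it. If further prime factors follow, they are no smaller, so this
  prime is at most N^(1/2) after all. If none follows, there is no factor of useful size, and it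
  matters that \<open>b\<close> sees a prime only through its class modulo 4: after sieving, the
  long variable carries a periodic weight, and Weyl differencing applies to it directly. The
  complementary variable sd stays below z^2; where it is too long for the direct method, its length
  already makes the diagonal term of the bilinear bound acceptable.\<close>

text \<open>Pigeonhole: with s the integer part of the square root of n, the box has (s+1)^2 > n
  points, so two of them share the residue of x - r y, and their difference is the required
  pair.\<close>

lemma thue:
  fixes r n :: int
  assumes n: "n > 0"
  obtains x y :: int where "x \<noteq> 0 \<or> y \<noteq> 0" "x\<^sup>2 \<le> n" "y\<^sup>2 \<le> n" "n dvd x - r * y"
proof -
  define s where "s = floor_sqrt (nat n)"
  have s1: "int (s^2) \<le> n" using n floor_sqrt_power2_le[of "nat n"] unfolding s_def by linarith
  have s2: "nat n < (Suc s)^2" unfolding s_def by (rule Suc_floor_sqrt_power2_gt)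
  let ?A = "{0..int s} \<times> {0..int s}"
  let ?f = "\<lambda>(x,y). (x - r * y) mod n"
  have "?f ` ?A \<subseteq> {0..<n}" using n by auto
  hence "card (?f ` ?A) \<le> card {0..<n}" by (rule card_mono[rotated]) simp
  also have "\<dots> = nat n" by simp
  also have "\<dots> < card ?A" using s2 by (simp add: power2_eq_square nat_add_distrib)
  finally have "\<not> inj_on ?f ?A" by (rule pigeonhole)
  then obtain p q where pq: "p \<in> ?A" "q \<in> ?A" "p \<noteq> q" "?f p = ?f q" by (auto simp: inj_on_def)
  obtain x1 y1 x2 y2 where e: "p = (x1,y1)" "q = (x2,y2)" by fastforce
  have "(x1 - r * y1) mod n = (x2 - r*y2) mod n" using pq e by simp
  hence "n dvd (x1 - r*y1) - (x2 - r*y2)" by (simp add: mod_eq_dvd_iff)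
  hence d: "n dvd (x1 - x2) - r * (y1 - y2)" by (simp add: algebra_simps)
  have sq: "t\<^sup>2 \<le> n" if "\<bar>t\<bar> \<le> int s" for t
  proof -
    have "t\<^sup>2 \<le> (int s)\<^sup>2" using that by (metis abs_le_square_iff abs_of_nat)
    thus ?thesis using s1 by simp
  qed
  show ?thesis
  proof (rule that[of "x1 - x2" "y1 - y2"])
    show "x1 - x2 \<noteq> 0 \<or> y1 - y2 \<noteq> 0" using pq e by auto
    show "(x1 - x2)\<^sup>2 \<le> n" by (rule sq) (use pq e in auto)
    show "(y1 - y2)\<^sup>2 \<le> n" by (rule sq) (use pq e in auto)
  qed (use d in auto)
qed

text \<open>Thue's pair satisfies x^2 + y^2 = n w with 0 < w <= 2, and gcd x y divides w. For w = 1
  the pair is the representation. For w = 2 both squares equal n, so |x| divides 2 and n is 1 or 4;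
  the value 4 is impossible because r^2 + 1 is never divisible by 4.\<close>

lemma coprime_squares_if_root_minus_one:
  fixes r n :: int
  assumes n: "n > 0" and r: "n dvd r\<^sup>2 + 1"
  shows "\<exists>u v. gcd u v = 1 \<and> n = u\<^sup>2 + v\<^sup>2"
proof -
  obtain x y where xy: "x \<noteq> 0 \<or> y \<noteq> 0" "x\<^sup>2 \<le> n" "y\<^sup>2 \<le> n" "n dvd x - r * y"
    using thue[OF n] by metis
  obtain j where j: "x - r * y = n * j" using xy(4) by auto
  obtain c where c: "r\<^sup>2 + 1 = n * c" using r by auto
  have x: "x = r * y + n * j" using j by simp
  have "x\<^sup>2 + y\<^sup>2 = y\<^sup>2 * (r\<^sup>2 + 1) + n * (2*r*y*j + n * j\<^sup>2)"
    unfolding x by (simp add: power2_eq_square algebra_simps)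
  also have "\<dots> = n * (y\<^sup>2 * c + 2*r*y*j + n * j\<^sup>2)" unfolding c by (simp add: algebra_simps)
  finally have e: "x\<^sup>2 + y\<^sup>2 = n * (y\<^sup>2 * c + 2*r*y*j + n * j\<^sup>2)" (is "_ = n * ?w") .
  have pos: "x\<^sup>2 + y\<^sup>2 > 0" using xy(1) by (simp add: sum_power2_gt_zero_iff)
  have w0: "?w > 0" using pos n e by (metis zero_less_mult_pos)
  have "n * ?w \<le> n * 2" using e xy(2,3) by linarith
  hence w2: "?w \<le> 2" using n by simp
  \<comment> \<open>The gcd divides n j = x - r y as well as y, hence each of the three summands of
    w.\<close>
  have g: "gcd x y dvd ?w"
  proof -
    have "gcd x y dvd n * j" using j by (metis dvd_diff dvd_mult gcd_dvd1 gcd_dvd2)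
    hence "gcd x y dvd (n * j) * j" by simp
    hence "gcd x y dvd n * j\<^sup>2" by (simp add: power2_eq_square mult.assoc)
    moreover have "gcd x y dvd y\<^sup>2 * c" "gcd x y dvd 2*r*y*j" by (simp_all add: power2_eq_square)
    ultimately show ?thesis by (intro dvd_add)
  qed
  show ?thesis
  proof (cases "?w = 1")
    case True
    hence "gcd x y = 1" using g by simp
    moreover have "n = x\<^sup>2 + y\<^sup>2" using e True by simp
    ultimately show ?thesis by (intro exI[of _ x] exI[of _ y]) auto
  next
    case False
    hence w: "?w = 2" using w0 w2 by linarith
    hence "x\<^sup>2 = n" "y\<^sup>2 = n" using e xy(2,3) by simp_all
    hence "\<bar>x\<bar> = \<bar>y\<bar>" by (metis power2_eq_iff abs_eq_iff)
    hence "gcd x y = \<bar>x\<bar>" by (metis abs_gcd_int gcd_idem_int gcd_abs1_int gcd_abs2_int)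
    hence "\<bar>x\<bar> dvd 2" using g w by simp
    hence "\<bar>x\<bar> \<le> 2" by (meson zdvd_imp_le zero_less_numeral)
    moreover have "x \<noteq> 0" using \<open>x\<^sup>2 = n\<close> n by auto
    ultimately have "\<bar>x\<bar> = 1 \<or> \<bar>x\<bar> = 2" by linarith
    hence "x\<^sup>2 = 1 \<or> x\<^sup>2 = 4" by (metis power2_abs one_power2 numeral_power_eq_of_int_cancel_iff power2_eq_square mult_2 numeral_Bit0)
    hence "n = 1 \<or> n = 4" using \<open>x\<^sup>2 = n\<close> by simp
    moreover have "n \<noteq> 4"
    proof
      assume "n = 4"
      hence "4 dvd r\<^sup>2 + 1" using r by simp
      hence m: "(r * r + 1) mod 4 = 0" by (simp add: power2_eq_square)
      have "r mod 4 = 0 \<or> r mod 4 = 1 \<or> r mod 4 = 2 \<or> r mod 4 = 3" by presburger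
      moreover have "(r*r+1) mod 4 = ((r mod 4) * (r mod 4) + 1) mod 4" by (metis mod_add_left_eq mod_mult_eq)
      ultimately show False using m by auto
    qed
    ultimately have "n = 1" by simp
    thus ?thesis by (intro exI[of _ 1] exI[of _ 0]) auto
  qed
qed

text \<open>One prime p is removed at a time, n = p m. If p still divides m, a root modulo m is
  lifted to r + m t as in Hensel's lemma; otherwise Euler's criterion gives a root modulo p, and the
  Chinese remainder theorem combines the two.\<close>

lemma root_minus_one_if_primes_1_mod_4:
  fixes n :: nat
  assumes "n > 0" "\<And>p. prime p \<Longrightarrow> p dvd n \<Longrightarrow> p mod 4 = 1"
  shows "\<exists>r. int n dvd r\<^sup>2 + 1"
  using assms
proof (induction n rule: less_induct)
  case (less n)
  show ?case
  proof (cases "n = 1")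
    case True thus ?thesis by auto
  next
    case False
    then obtain p where p: "prime p" "p dvd n" using prime_factor_nat by blast
    then obtain m where m: "n = p * m" by auto
    have p4: "p mod 4 = 1" using less p by auto
    have mpos: "m > 0" using less m by auto
    have "m < n" using m mpos prime_gt_1_nat[OF p(1)] by simp
    then obtain r where r: "int m dvd r\<^sup>2 + 1"
      using less.IH[of m] mpos less.prems m by auto
    then obtain c where c: "r\<^sup>2 + 1 = int m * c" by auto
    have p2: "2 < p" using p4 p(1) by (metis One_nat_def le_neq_implies_less mod_less_divisor mod_less numeral_eq_one_iff prime_ge_2_nat semiring_norm(85) numeral_less_iff semiring_norm(76) semiring_norm(78))
    have pint: "prime (int p)" using p by simp
    show ?thesis
    proof (cases "p dvd m")
      case True
      then obtain m' where m': "m = p * m'" by auto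
      have "coprime (2 * r) (int p)"
      proof -
        have "\<not> int p dvd 2 * r"
        proof
          assume "int p dvd 2 * r"
          hence "int p dvd 2 \<or> int p dvd r" using pint prime_dvd_mult_iff by blast
          moreover have "\<not> int p dvd 2" using p2 by (auto dest: zdvd_imp_le)
          ultimately have "int p dvd r\<^sup>2" by (simp add: power2_eq_square)
          moreover have "int p dvd r\<^sup>2 + 1" using c m' by simp
          ultimately have "int p dvd 1" by (metis dvd_add_right_iff)
          thus False using p2 by simp
        qed
        thus ?thesis using pint by (metis coprime_commute prime_imp_coprime)
      qed
      \<comment> \<open>\<open>t0\<close> inverts 2 r modulo p, so t = -c t0 solves the linear
        congruence 2 r t + c = 0 that the lift requires.\<close>
      then obtain t0 where "[2 * r * t0 = 1] (mod int p)" using cong_solve_coprime_int by blast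
      hence "[2 * r * t0 * (-c) = 1 * (-c)] (mod int p)" by (rule cong_mult) simp
      hence "int p dvd 2 * r * t0 * (-c) - (-c)" by (simp add: cong_iff_dvd_diff)
      then obtain t where t: "int p dvd 2 * r * t + c" by (metis (no_types, opaque_lifting) diff_minus_eq_add mult.assoc)
      have "(r + int m * t)\<^sup>2 + 1 = int m * (c + 2 * r * t + int m * t\<^sup>2)"
        using c by (simp add: power2_eq_square algebra_simps)
      moreover have "int p dvd c + 2 * r * t + int m * t\<^sup>2" using t m' by (simp add: add.commute)
      ultimately have "int n dvd (r + int m * t)\<^sup>2 + 1" unfolding m by (simp add: mult.commute mult_dvd_mono)
      thus ?thesis by blast
    next
      case False
      have "even ((p - 1) div 2)" using p4 p2 by presburger
      moreover have "[Legendre (-1) (int p) = (-1) ^ ((p - 1) div 2)] (mod int p)"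
        using euler_criterion[OF p(1) p2, of "-1"] by simp
      ultimately have L: "[Legendre (-1) (int p) = 1] (mod int p)" by simp
      have "QuadRes (int p) (-1)"
      proof (rule ccontr)
        assume "\<not> QuadRes (int p) (-1)"
        hence "Legendre (-1) (int p) = 0 \<or> Legendre (-1) (int p) = -1" unfolding Legendre_def by auto
        hence "int p dvd 1 \<or> int p dvd 2" using L by (auto simp: cong_iff_dvd_diff)
        thus False using p2 by (auto dest: zdvd_imp_le)
      qed
      then obtain s where s: "[s\<^sup>2 = -1] (mod int p)" unfolding QuadRes_def by auto
      have cop: "coprime (int m) (int p)" using False pint
        by (metis coprime_commute int_dvd_int_iff prime_imp_coprime)
      obtain x where x: "[x = r] (mod int m)" "[x = s] (mod int p)"
        using binary_chinese_remainder_int[OF cop] by blast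
      have "[x\<^sup>2 + 1 = r\<^sup>2 + 1] (mod int m)" using x by (intro cong_add cong_pow) auto
      hence 1: "int m dvd x\<^sup>2 + 1" using r by (metis cong_dvd_iff)
      have "[x\<^sup>2 + 1 = -1 + 1] (mod int p)" using x s by (intro cong_add) (auto intro: cong_trans cong_pow)
      hence 2: "int p dvd x\<^sup>2 + 1" by (simp add: cong_0_iff)
      have "int m * int p dvd x\<^sup>2 + 1" using divides_mult[OF 1 2 cop] .
      thus ?thesis unfolding m by (auto simp: mult.commute)
    qed
  qed
qed

text \<open>For one direction, coprimality makes v invertible modulo every prime factor p, so -1 is
  a square modulo p and Euler's criterion gives p = 1 modulo 4. The other direction combines the two
  preceding lemmas.\<close>

lemma odd_prim_gauss_iff:
  "n \<in> odd_prim_gauss \<longleftrightarrow> n > 0 \<and> (\<forall>p. prime p \<longrightarrow> p dvd n \<longrightarrow> p mod 4 = 1)"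
proof
  assume n: "n \<in> odd_prim_gauss"
  then obtain u v :: int where uv: "odd n" "coprime u v" "int n = u\<^sup>2 + v\<^sup>2"
    unfolding odd_prim_gauss_def by (auto simp: coprime_iff_gcd_eq_1)
  show "n > 0 \<and> (\<forall>p. prime p \<longrightarrow> p dvd n \<longrightarrow> p mod 4 = 1)"
  proof (intro conjI allI impI)
    show "n > 0" using uv(1) by (auto elim: oddE)
    fix p :: nat assume p: "prime p" "p dvd n"
    have pint: "prime (int p)" using p by simp
    have pd: "int p dvd u\<^sup>2 + v\<^sup>2" using p uv by (metis int_dvd_int_iff)
    have pv: "\<not> int p dvd v"
    proof
      assume a: "int p dvd v"
      hence "int p dvd u\<^sup>2" using pd by (metis dvd_add_left_iff dvd_power_same dvd_trans dvd_triv_left power2_eq_square dvd_mult2)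
      hence "int p dvd u" using pint prime_dvd_power by blast
      hence "is_unit (int p)" using a uv(2) coprime_common_divisor by blast
      thus False using pint by auto
    qed
    have odd: "odd p" using p uv(1) by (meson dvd_trans)
    have p2: "2 < p" using odd p(1) prime_ge_2_nat[OF p(1)] by (cases "p = 2") auto
    have "coprime v (int p)" using pv pint by (metis coprime_commute prime_imp_coprime)
    then obtain w where w: "[v * w = 1] (mod int p)" using cong_solve_coprime_int by blast
    have "[(u\<^sup>2 + v\<^sup>2) * w\<^sup>2 = 0 * w\<^sup>2] (mod int p)" using pd by (intro cong_mult) (auto simp: cong_0_iff)
    hence "[(u * w)\<^sup>2 + (v * w)\<^sup>2 = 0] (mod int p)" by (simp add: power_mult_distrib algebra_simps)
    moreover have "[(u * w)\<^sup>2 + (v * w)\<^sup>2 = (u * w)\<^sup>2 + 1\<^sup>2] (mod int p)" using w by (intro cong_add cong_pow) auto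
    ultimately have "[(u * w)\<^sup>2 + 1 = 0] (mod int p)" by (metis cong_sym cong_trans one_power2)
    hence "[(u * w)\<^sup>2 = -1] (mod int p)" by (simp add: cong_iff_dvd_diff)
    hence Q: "QuadRes (int p) (-1)" unfolding QuadRes_def by blast
    have "\<not> [-1 = 0::int] (mod int p)" using p2 by (simp add: cong_iff_dvd_diff)
    hence "Legendre (-1) (int p) = 1" using Q unfolding Legendre_def by simp
    hence "[1 = (-1::int) ^ ((p - 1) div 2)] (mod int p)"
      using euler_criterion[OF p(1) p2, of "-1"] by simp
    hence "even ((p - 1) div 2)"
    proof (rule_tac ccontr)
      assume a: "[1 = (-1::int) ^ ((p - 1) div 2)] (mod int p)" "odd ((p - 1) div 2)"
      hence "int p dvd 2" by (simp add: cong_iff_dvd_diff)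
      thus False using p2 by (auto dest: zdvd_imp_le)
    qed
    thus "p mod 4 = 1" using odd p2 by presburger
  qed
next
  assume a: "n > 0 \<and> (\<forall>p. prime p \<longrightarrow> p dvd n \<longrightarrow> p mod 4 = 1)"
  have "odd n"
  proof
    assume "even n"
    hence "2 mod 4 = (1::nat)" using a two_is_prime_nat by blast
    thus False by simp
  qed
  moreover obtain r where "int n dvd r\<^sup>2 + 1" using root_minus_one_if_primes_1_mod_4[of n] a by auto
  ultimately show "n \<in> odd_prim_gauss"
    using coprime_squares_if_root_minus_one[of "int n" r] a unfolding odd_prim_gauss_def by auto
qed

lemma b_mult: "b (m * n) = b m * b n"
proof -
  have "m * n \<in> odd_prim_gauss \<longleftrightarrow> m \<in> odd_prim_gauss \<and> n \<in> odd_prim_gauss"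
    unfolding odd_prim_gauss_iff by (auto simp: prime_dvd_mult_iff)
  thus ?thesis unfolding b_def by (auto simp: indicator_def)
qed

lemma b_1: "b 1 = 1" "b (Suc 0) = 1"
  by (auto simp: b_def indicator_def odd_prim_gauss_iff)

lemma norm_b_le: "norm (b n) \<le> 1"
  by (auto simp: b_def indicator_def)

lemma b_prime: "prime p \<Longrightarrow> b p = (if p mod 4 = 1 then 1 else 0)"
  by (auto simp: b_def indicator_def odd_prim_gauss_iff prime_nat_iff prime_gt_0_nat)

section \<open>Truncated sieve identities\<close>

text \<open>The inequality is not strict, so that copies of a repeated prime may fall on both sides
  of a cut. The number 1 is rough for every \<open>w\<close>.\<close>

definition rough :: "nat \<Rightarrow> nat \<Rightarrow> bool" where
  "rough w n \<longleftrightarrow> (\<forall>p. prime p \<longrightarrow> p dvd n \<longrightarrow> w \<le> p)"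

text \<open>At 1, \<open>lpf\<close> and \<open>gpf\<close> are extrema of the empty set, which is
  why 1 is treated separately wherever they occur.\<close>

definition lpf :: "nat \<Rightarrow> nat" where "lpf n = Min (prime_factors n)"
definition gpf :: "nat \<Rightarrow> nat" where "gpf n = Max (prime_factors n)"

lemma lpf:
  assumes "n > 1"
  shows "prime (lpf n)" "lpf n dvd n" "rough (lpf n) n"
proof -
  obtain p where "prime p" "p dvd n" using assms prime_factor_nat[of n] by auto
  hence ne: "prime_factors n \<noteq> {}" using assms by (auto simp: prime_factors_dvd)
  have "lpf n \<in> prime_factors n" unfolding lpf_def using ne by (intro Min_in) auto
  thus "prime (lpf n)" "lpf n dvd n" using assms by (auto simp: prime_factors_dvd)
  show "rough (lpf n) n" unfolding rough_def lpf_def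
    using assms by (auto intro!: Min_le simp: prime_factors_dvd)
qed

lemma lpf_eqI: "prime p \<Longrightarrow> p dvd n \<Longrightarrow> rough p n \<Longrightarrow> n > 0 \<Longrightarrow> lpf n = p"
  unfolding lpf_def by (rule Min_eqI) (auto simp: rough_def prime_factors_dvd)

lemma gpf:
  assumes "n > 1"
  shows "prime (gpf n)" "gpf n dvd n" "\<And>p. prime p \<Longrightarrow> p dvd n \<Longrightarrow> p \<le> gpf n"
proof -
  obtain p where "prime p" "p dvd n" using assms prime_factor_nat[of n] by auto
  hence ne: "prime_factors n \<noteq> {}" using assms by (auto simp: prime_factors_dvd)
  have "gpf n \<in> prime_factors n" unfolding gpf_def using ne by (intro Max_in) auto
  thus "prime (gpf n)" "gpf n dvd n" using assms by (auto simp: prime_factors_dvd)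
  show "p \<le> gpf n" if "prime p" "p dvd n" for p unfolding gpf_def
    using assms that by (auto intro!: Max_ge simp: prime_factors_dvd)
qed

lemma gpf_eqI: "prime p \<Longrightarrow> p dvd n \<Longrightarrow> (\<And>r. prime r \<Longrightarrow> r dvd n \<Longrightarrow> r \<le> p) \<Longrightarrow> n > 0 \<Longrightarrow> gpf n = p"
  unfolding gpf_def by (rule Max_eqI) (auto simp: prime_factors_dvd)

lemma rough_dvd: "rough w n \<Longrightarrow> k dvd n \<Longrightarrow> rough w k"
  unfolding rough_def using dvd_trans by blast

text \<open>The prefixes of the increasing list of prime factors of \<open>n\<close>: exactly one of them is the first
  to reach \<open>z\<close>, provided that \<open>n \<ge> z\<close>. The count telescopes along the chain of prefixes.\<close>

lemma card_first_prefix: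
  fixes z :: real
  assumes n: "n \<ge> 1" and z: "z > 1"
  shows "card {e. e dvd n \<and> z \<le> real e \<and> real (e div gpf e) < z \<and> rough (gpf e) (n div e)}
           = (if real n < z then 0 else 1)"
proof -
  \<comment> \<open>\<open>E\<close> is the chain of prefixes of the increasing list of prime
    factors of n, \<open>U\<close> the prefixes still below z, and \<open>V\<close> the prefixes to
    be counted.\<close>
  define E where "E = {e. e dvd n \<and> (e = 1 \<or> rough (gpf e) (n div e))}"
  define U where "U = {u \<in> E. real u < z}"
  define V where "V = {e. e dvd n \<and> z \<le> real e \<and> real (e div gpf e) < z \<and> rough (gpf e) (n div e)}"
  have finE: "finite E" unfolding E_def using n by (intro finite_subset[OF _ finite_divisors_nat[of n]]) auto
  have nE: "n \<in> E" using n gpf(1)[of n] by (auto simp: E_def rough_def)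
  have oneU: "1 \<in> U" using z by (simp add: U_def E_def)
  have pos: "e > 0" if "e \<in> E" for e using that n by (auto simp: E_def dvd_def intro: Nat.gr0I)
  \<comment> \<open>Each prefix other than n has a successor, obtained by adjoining the least prime
    of the cofactor; dropping the greatest prime undoes this. So the prefixes below z, without n,
    correspond to the prefixes above 1 whose predecessor is below z.\<close>
  have "bij_betw (\<lambda>u. u * lpf (n div u)) (U - {n}) {e \<in> E. e > 1 \<and> real (e div gpf e) < z}"
  proof (rule bij_betw_byWitness[where f'="\<lambda>e. e div gpf e"], goal_cases)
    have fwd: "gpf (u * lpf (n div u)) = lpf (n div u) \<and> u * lpf (n div u) \<in> E \<and> lpf (n div u) > 1"
      if u: "u \<in> U - {n}" for u
    proof -
      obtain k where k: "n = u * k" using u by (auto simp: U_def E_def)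
      have u0: "u > 0" using u pos by (auto simp: U_def)
      have nk: "n div u = k" using k u0 by simp
      have k1: "k > 1" using u k n by (cases k) (auto simp: U_def)
      define p where "p = lpf k"
      have p: "prime p" "p dvd k" "rough p k" using lpf[OF k1] by (auto simp: p_def)
      have le: "r \<le> p" if r: "prime r" "r dvd u" for r
      proof -
        have u1: "u > 1" using r u0 by (metis One_nat_def Suc_lessI nat_dvd_1_iff_1 not_prime_1)
        hence "rough (gpf u) k" using u nk by (auto simp: U_def E_def)
        hence "gpf u \<le> p" using p by (auto simp: rough_def)
        thus ?thesis using gpf(3)[OF u1 r] by simp
      qed
      have g: "gpf (u * p) = p"
      proof (rule gpf_eqI)
        fix r assume "prime r" "r dvd u * p"
        thus "r \<le> p" using le p by (metis prime_dvd_mult_iff primes_dvd_imp_eq order_refl)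
      qed (use p u0 prime_gt_0_nat in auto)
      obtain j where j: "k = p * j" using p by auto
      have "n div (u * p) = j" using k j u0 prime_gt_0_nat[OF p(1)] by simp
      moreover have "rough p j" using p(3) j rough_dvd by (metis dvd_triv_right)
      ultimately have "u * p \<in> E" using g k j by (simp add: E_def)
      thus ?thesis using g nk p(1) prime_gt_1_nat by (simp add: p_def)
    qed
    have bwd: "e div gpf e \<in> U - {n} \<and> e div gpf e * lpf (n div (e div gpf e)) = e"
      if e: "e \<in> {e \<in> E. e > 1 \<and> real (e div gpf e) < z}" for e
    proof -
      have e1: "e > 1" using e by simp
      define g where "g = gpf e"
      have g: "prime g" "g dvd e" using gpf[OF e1] by (auto simp: g_def)
      obtain u where u: "e = g * u" using g by auto
      have eu: "e div g = u" using u g prime_gt_0_nat by simp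
      obtain k where k: "n = e * k" using e by (auto simp: E_def)
      have rk: "rough g k" using e k e1 by (auto simp: E_def g_def)
      have u0: "u > 0" using u e1 by (cases u) auto
      have nu: "n div u = k * g" using k u u0 by (simp add: mult_ac)
      have k0: "k > 0" using k n by (cases k) auto
      have rkg: "rough g (k * g)" using rk g by (auto simp: rough_def prime_dvd_mult_iff dest: primes_dvd_imp_eq)
      have l: "lpf (k * g) = g" by (rule lpf_eqI) (use g rkg k0 prime_gt_0_nat in auto)
      have "u = 1 \<or> rough (gpf u) (k * g)"
      proof (cases "u = 1")
        case False
        hence u1: "u > 1" using u0 by simp
        have "gpf u dvd e" unfolding u using gpf(2)[OF u1] by simp
        hence "gpf u \<le> g" unfolding g_def using gpf(1)[OF u1] gpf(3)[OF e1] by blast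
        thus ?thesis using rkg unfolding rough_def by (meson order_trans)
      qed simp
      moreover have "u dvd n" using k u by simp
      ultimately have "u \<in> E" using nu by (simp add: E_def)
      moreover have "u \<noteq> n" using k u u0 k0 prime_gt_1_nat[OF g(1)] by auto
      moreover have A: "e div gpf e = u" using eu by (simp only: g_def)
      moreover have "real u < z" using e A by simp
      ultimately show ?thesis unfolding A nu l U_def using u by (simp add: mult.commute)
    qed
    { case 1
      show ?case
      proof
        fix u assume "u \<in> U - {n}"
        from fwd[OF this] show "u * lpf (n div u) div gpf (u * lpf (n div u)) = u" by auto
      qed }
    { case 2 thus ?case using bwd by auto }
    { case 3
      show ?case
      proof
        fix e assume "e \<in> (\<lambda>u. u * lpf (n div u)) ` (U - {n})"
        then obtain u where u: "u \<in> U - {n}" "e = u * lpf (n div u)" by auto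
        have "e div gpf e = u" using fwd[OF u(1)] unfolding u(2) by auto
        moreover have "e > 1"
        proof -
          have "u > 0" "lpf (n div u) > 1" using fwd[OF u(1)] u(1) pos[of u] by (auto simp: U_def)
          hence "1 * 1 < u * lpf (n div u)" by (intro mult_le_less_imp_less) auto
          thus ?thesis unfolding u(2) by simp
        qed
        ultimately show "e \<in> {e \<in> E. e > 1 \<and> real (e div gpf e) < z}" using fwd[OF u(1)] u by (auto simp: U_def)
      qed }
    { case 4 thus ?case using bwd by auto }
  qed
  hence "card (U - {n}) = card {e \<in> E. e > 1 \<and> real (e div gpf e) < z}" by (rule bij_betw_same_card)
  \<comment> \<open>The successors are the members of \<open>U\<close> other than 1 together with
    \<open>V\<close>. Comparing cardinalities leaves one element in \<open>V\<close>, or none if n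
    itself lies in \<open>U\<close>.\<close>
  also have "{e \<in> E. e > 1 \<and> real (e div gpf e) < z} = (U - {1}) \<union> V"
  proof (intro Set.set_eqI iffI)
    fix e assume "e \<in> {e \<in> E. e > 1 \<and> real (e div gpf e) < z}"
    thus "e \<in> (U - {1}) \<union> V" by (auto simp: U_def V_def E_def)
  next
    fix e assume e: "e \<in> (U - {1}) \<union> V"
    have e1: "e > 1" using e z pos[of e] by (auto simp: U_def V_def)
    have "real e < z \<Longrightarrow> real (e div gpf e) < z"
      by (rule le_less_trans[of _ "real e"]) simp
    thus "e \<in> {e \<in> E. e > 1 \<and> real (e div gpf e) < z}" using e e1 by (auto simp: U_def V_def E_def)
  qed
  also have "card ((U - {1}) \<union> V) = card (U - {1}) + card V"
    using finE by (intro card_Un_disjoint) (auto simp: U_def V_def E_def intro: finite_subset[OF _ finE])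
  finally have c: "card (U - {n}) = card U - 1 + card V" using oneU by simp
  have finU: "finite U" using finE by (simp add: U_def)
  have cU: "card U \<ge> 1" using oneU finU by (metis One_nat_def Suc_leI card_gt_0_iff empty_iff)
  show ?thesis
  proof (cases "real n < z")
    case True
    hence "n \<in> U" using nE by (simp add: U_def)
    thus ?thesis using c cU True finU by (simp add: V_def)
  next
    case False
    hence "n \<notin> U" by (simp add: U_def)
    thus ?thesis using c cU False finU by (simp add: V_def)
  qed
qed

lemma card_least_prime_factor:
  assumes "t \<ge> 1"
  shows "{p. p dvd t \<and> prime p \<and> rough p (t div p)} = (if t = 1 then {} else {lpf t})"
proof (cases "t = 1")
  case False
  hence t: "t > 1" using assms by simp
  have "p = lpf t" if p: "p dvd t" "prime p" "rough p (t div p)" for p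
  proof -
    have "rough p t" unfolding rough_def
    proof (intro allI impI)
      fix r assume r: "prime r" "r dvd t"
      have "t = p * (t div p)" using p by simp
      hence "r dvd p \<or> r dvd t div p" using r by (metis prime_dvd_mult_iff)
      thus "p \<le> r" using p r by (auto simp: rough_def dest: primes_dvd_imp_eq)
    qed
    thus ?thesis using p t lpf_eqI by auto
  qed
  moreover have "rough (lpf t) (t div lpf t)" 
  proof (rule rough_dvd[OF lpf(3)[OF t]])
    have "t = lpf t * (t div lpf t)" using lpf(2)[OF t] by simp
    thus "t div lpf t dvd t" by (metis dvd_triv_right)
  qed
  ultimately have "{p. p dvd t \<and> prime p \<and> rough p (t div p)} = {lpf t}" using lpf(1,2)[OF t] by blast
  thus ?thesis using False by simp
qed auto

section \<open>The Moebius function and the truncated Legendre sieve\<close>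

definition mu :: "nat \<Rightarrow> int" where
  "mu d = (if squarefree d then (-1) ^ card (prime_factors d) else 0)"

lemma abs_mu_le: "\<bar>mu d\<bar> \<le> 1"
  by (auto simp: mu_def)

lemma mu_times_prime:
  assumes "prime p" "\<not> p dvd d" "squarefree d" 
  shows "squarefree (p * d)" "mu (p * d) = - mu d"
proof -
  have d0: "d > 0" using assms by (intro Nat.gr0I) auto
  have cop: "coprime p d" using assms prime_imp_coprime by blast
  show sq: "squarefree (p * d)" using assms cop by (simp add: squarefree_mult_coprime squarefree_prime)
  have "prime_factors (p * d) = insert p (prime_factors d)"
    using assms d0 prime_gt_0_nat[OF assms(1)] by (simp add: prime_factors_product prime_prime_factors)
  moreover have "p \<notin> prime_factors d" using assms by (auto simp: prime_factors_dvd)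
  ultimately show "mu (p * d) = - mu d" using sq assms by (simp add: mu_def)
qed

definition smooth :: "real \<Rightarrow> nat \<Rightarrow> bool" where
  "smooth z d \<longleftrightarrow> (\<forall>p. prime p \<longrightarrow> p dvd d \<longrightarrow> real p < z)"

text \<open>Legendre's sieve, with the terms \<open>d \<ge> z\<close> resummed by Buchstab's identity.\<close>

lemma truncated_legendre_sieve:
  fixes z :: real
  assumes t: "t \<ge> 1" and z: "z > 1"
  shows "(\<Sum>d | d dvd t \<and> squarefree d \<and> smooth z d \<and> real d < z. mu d)
       + (\<Sum>e | e dvd t \<and> squarefree e \<and> smooth z e \<and> z \<le> real e \<and> real (e div lpf e) < z
             \<and> rough (lpf e) (t div e). mu e)
       = (if \<forall>p. prime p \<longrightarrow> p dvd t \<longrightarrow> z \<le> real p then 1 else 0)"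
proof -
  define D where "D = {d. d dvd t \<and> squarefree d \<and> smooth z d}"
  \<comment> \<open>\<open>A d\<close> says that d cannot be extended: t / d has no prime below the
    least prime of d (below z if d = 1). Otherwise the least prime of t / d is below all primes of
    d, and adjoining it keeps d squarefree and smooth and flips the sign of
    \<open>mu\<close>.\<close>
  define A where "A = (\<lambda>d. if d = 1 then \<forall>p. prime p \<longrightarrow> p dvd t \<longrightarrow> z \<le> real p else rough (lpf d) (t div d))"
  have finD: "finite D" unfolding D_def using t by (intro finite_subset[OF _ finite_divisors_nat[of t]]) auto
  have pos: "d > 0" if "d \<in> D" for d using that by (auto simp: D_def intro: Nat.gr0I)
  have fwd: "lpf (d * lpf (t div d)) = lpf (t div d) \<and> d * lpf (t div d) \<in> D \<and> lpf (t div d) > 1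
      \<and> rough (lpf (t div d)) (t div (d * lpf (t div d))) \<and> mu (d * lpf (t div d)) = - mu d"
    if d: "d \<in> D" "\<not> A d" for d
  proof -
    have d0: "d > 0" using pos d by simp
    obtain k where k: "t = d * k" using d by (auto simp: D_def)
    have tk: "t div d = k" using k d0 by simp
    have k0: "k > 0" using k t by (cases k) auto
    obtain r where r: "prime r" "r dvd k" "if d = 1 then real r < z else r < lpf d"
    proof (cases "d = 1")
      case True
      thus ?thesis using d(2) k that by (auto simp: A_def not_le)
    next
      case False
      thus ?thesis using d(2) tk that by (auto simp: A_def not_le rough_def)
    qed
    have k1: "k > 1" using r k0 by (metis One_nat_def Suc_lessI nat_dvd_1_iff_1 not_prime_1)
    define p where "p = lpf k"
    have p: "prime p" "p dvd k" "rough p k" using lpf[OF k1] by (auto simp: p_def)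
    have pr: "p \<le> r" using p(3) r by (auto simp: rough_def)
    have pz: "real p < z"
    proof (cases "d = 1")
      case True thus ?thesis using pr r by simp
    next
      case False
      hence "d > 1" using d0 by simp
      hence "real (lpf d) < z" using lpf[of d] d by (auto simp: D_def smooth_def)
      thus ?thesis using pr r False by simp
    qed
    have rd: "p < s" if s: "prime s" "s dvd d" for s
    proof -
      have "d > 1" using s d0 by (metis One_nat_def Suc_lessI nat_dvd_1_iff_1 not_prime_1)
      hence "lpf d \<le> s" using lpf(3)[of d] s by (auto simp: rough_def)
      thus ?thesis using pr r \<open>d > 1\<close> by simp
    qed
    hence pd: "\<not> p dvd d" using p by blast
    have mu: "squarefree (d * p)" "mu (d * p) = - mu d"
      using mu_times_prime[OF p(1) pd] d by (auto simp: D_def mult.commute)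
    have rdp: "p \<le> s" if s: "prime s" "s dvd d * p" for s
    proof -
      have "s dvd d \<or> s dvd p" using s prime_dvd_mult_iff by blast
      thus ?thesis using rd[of s] s p by (auto dest: primes_dvd_imp_eq)
    qed
    have l: "lpf (d * p) = p"
      by (rule lpf_eqI) (use p rdp d0 prime_gt_0_nat in \<open>auto simp: rough_def\<close>)
    have sm: "smooth z (d * p)" unfolding smooth_def
    proof (intro allI impI)
      fix s assume s: "prime s" "s dvd d * p"
      hence "s dvd d \<or> s dvd p" using prime_dvd_mult_iff by blast
      thus "real s < z" using s d pz p by (auto simp: D_def smooth_def dest: primes_dvd_imp_eq)
    qed
    obtain j where j: "k = p * j" using p by auto
    have "t div (d * p) = j" using k j d0 prime_gt_0_nat[OF p(1)] by simp
    moreover have "rough p j" using p(3) j rough_dvd by (metis dvd_triv_right)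
    moreover have "d * p dvd t" using k j by simp
    ultimately show ?thesis using l mu sm tk prime_gt_1_nat[OF p(1)] by (simp add: p_def D_def)
  qed
  have bwd: "e div lpf e \<in> D \<and> \<not> A (e div lpf e) \<and> e div lpf e * lpf (t div (e div lpf e)) = e"
    if e: "e \<in> D" "e > 1" "rough (lpf e) (t div e)" for e
  proof -
    define p where "p = lpf e"
    have p: "prime p" "p dvd e" "rough p e" using lpf[OF e(2)] by (auto simp: p_def)
    obtain d where d: "e = p * d" using p by auto
    have p0: "p > 0" using p prime_gt_0_nat by blast
    have ed: "e div p = d" using d p0 by simp
    have d0: "d > 0" using d e by (cases d) auto
    obtain k where k: "t = e * k" using e by (auto simp: D_def)
    have k0: "k > 0" using k t by (cases k) auto
    have te: "t div e = k" using k e by simp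
    have td: "t div d = k * p" using k d d0 by (simp add: mult_ac)
    have rkp: "rough p (k * p)" using e(3) te p by (auto simp: rough_def prime_dvd_mult_iff p_def dest: primes_dvd_imp_eq)
    have l: "lpf (k * p) = p" by (rule lpf_eqI) (use p rkp k0 p0 in auto)
    have sqe: "squarefree (p * d)" using e d by (simp add: D_def)
    have pd: "\<not> p dvd d"
    proof
      assume "p dvd d"
      hence "p\<^sup>2 dvd p * d" by (simp add: power2_eq_square mult_dvd_mono)
      hence "is_unit p" using sqe squarefreeD by blast
      thus False using p by auto
    qed
    have dD: "d \<in> D" using e d k sqe by (auto simp: D_def smooth_def intro: squarefree_multD(2))
    have pz: "real p < z" using e p by (auto simp: D_def smooth_def)
    have "\<not> A d"
    proof (cases "d = 1")
      case True
      have "p dvd t" using k d by simp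
      thus ?thesis using pz p(1) True unfolding A_def by (auto simp: not_le)
    next
      case False
      hence d1: "d > 1" using d0 by simp
      have "p \<le> lpf d" using p(3) d lpf[OF d1] by (auto simp: rough_def)
      moreover have "p \<noteq> lpf d" using pd lpf[OF d1] by auto
      ultimately have "p < lpf d" by simp
      hence "\<not> rough (lpf d) (k * p)" using p(1) by (auto simp: rough_def)
      thus ?thesis using False td by (simp add: A_def)
    qed
    have B: "e div lpf e = d" using ed by (simp only: p_def)
    show ?thesis unfolding B td l using dD d \<open>\<not> A d\<close> by (simp add: mult.commute)
  qed
  define V where "V = {e \<in> D. z \<le> real e \<and> real (e div lpf e) < z \<and> rough (lpf e) (t div e)}"
  \<comment> \<open>Extendable d < z are matched with their extensions e, of opposite sign. The
    extensions below z cancel the non-extendable d other than 1, those from z on form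
    \<open>V\<close>, and what survives is the term d = 1 if \<open>A 1\<close> holds, that is, if t
    has no prime below z.\<close>
  have "(\<Sum>d\<in>{d \<in> D. real d < z \<and> \<not> A d}. mu d) = (\<Sum>e\<in>{e \<in> D. e > 1 \<and> real (e div lpf e) < z \<and> rough (lpf e) (t div e)}. - mu e)"
  proof (rule sum.reindex_bij_witness[where i="\<lambda>e. e div lpf e" and j="\<lambda>d. d * lpf (t div d)"], goal_cases)
    case (1 d) thus ?case using fwd[of d] by auto
  next
    case (2 d)
    hence f: "lpf (d * lpf (t div d)) = lpf (t div d)" "d * lpf (t div d) \<in> D" "lpf (t div d) > 1"
      "rough (lpf (t div d)) (t div (d * lpf (t div d)))" using fwd[of d] by auto
    moreover have "d * lpf (t div d) > 1"
    proof -
      have "1 * 1 < d * lpf (t div d)" using f(3) pos[of d] 2 by (intro mult_le_less_imp_less) auto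
      thus ?thesis by simp
    qed
    ultimately show ?case using 2 by simp
  next
    case (3 e) thus ?case using bwd[of e] by auto
  next
    case (4 e) thus ?case using bwd[of e] by auto
  next
    case (5 d) thus ?case using fwd[of d] by auto
  qed
  also have "{e \<in> D. e > 1 \<and> real (e div lpf e) < z \<and> rough (lpf e) (t div e)} = {e \<in> D. real e < z \<and> A e \<and> e \<noteq> 1} \<union> V"
  proof (intro Set.set_eqI iffI)
    fix e assume "e \<in> {e \<in> D. e > 1 \<and> real (e div lpf e) < z \<and> rough (lpf e) (t div e)}"
    thus "e \<in> {e \<in> D. real e < z \<and> A e \<and> e \<noteq> 1} \<union> V" by (auto simp: V_def A_def)
  next
    fix e assume e: "e \<in> {e \<in> D. real e < z \<and> A e \<and> e \<noteq> 1} \<union> V"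
    have e1: "e > 1" using e z pos[of e] by (auto simp: V_def)
    have "real e < z \<Longrightarrow> real (e div lpf e) < z"
      by (rule le_less_trans[of _ "real e"]) simp
    thus "e \<in> {e \<in> D. e > 1 \<and> real (e div lpf e) < z \<and> rough (lpf e) (t div e)}"
      using e e1 by (auto simp: V_def A_def)
  qed
  also have "(\<Sum>e\<in>{e \<in> D. real e < z \<and> A e \<and> e \<noteq> 1} \<union> V. - mu e) = - (\<Sum>e\<in>{e \<in> D. real e < z \<and> A e \<and> e \<noteq> 1}. mu e) - (\<Sum>e\<in>V. mu e)"
    by (subst sum.union_disjoint) (use finD in \<open>auto simp: V_def sum_negf\<close>)
  finally have 1: "(\<Sum>d\<in>{d \<in> D. real d < z \<and> \<not> A d}. mu d) = - (\<Sum>e\<in>{e \<in> D. real e < z \<and> A e \<and> e \<noteq> 1}. mu e) - (\<Sum>e\<in>V. mu e)" .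
  have oneD: "1 \<in> D" by (auto simp: D_def smooth_def)
  have "(\<Sum>d\<in>{d \<in> D. real d < z}. mu d) = (\<Sum>d\<in>{d \<in> D. real d < z \<and> \<not> A d}. mu d) + (\<Sum>d\<in>{d \<in> D. real d < z \<and> A d}. mu d)"
    by (subst sum.union_disjoint[symmetric]) (use finD in \<open>auto intro: sum.cong\<close>)
  moreover have "(\<Sum>d\<in>{d \<in> D. real d < z \<and> A d}. mu d) =
      (\<Sum>d\<in>{d \<in> D. real d < z \<and> A d \<and> d \<noteq> 1}. mu d) + (if A 1 then 1 else 0)"
  proof (cases "A 1")
    case True
    hence "{d \<in> D. real d < z \<and> A d} = insert 1 {d \<in> D. real d < z \<and> A d \<and> d \<noteq> 1}" using oneD z by auto
    thus ?thesis using True finD by (simp add: mu_def)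
  next
    case False
    hence "{d \<in> D. real d < z \<and> A d} = {d \<in> D. real d < z \<and> A d \<and> d \<noteq> 1}" by metis
    thus ?thesis using False by simp
  qed
  ultimately have "(\<Sum>d\<in>{d \<in> D. real d < z}. mu d) + (\<Sum>e\<in>V. mu e) = (if A 1 then 1 else 0)"
    using 1 by linarith
  moreover have "A 1 \<longleftrightarrow> (\<forall>p. prime p \<longrightarrow> p dvd t \<longrightarrow> z \<le> real p)" by (simp only: A_def if_True simp_thms)
  moreover have "{d \<in> D. real d < z} = {d. d dvd t \<and> squarefree d \<and> smooth z d \<and> real d < z}"
    by (auto simp: D_def)
  moreover have "V = {e. e dvd t \<and> squarefree e \<and> smooth z e \<and> z \<le> real e \<and> real (e div lpf e) < z
             \<and> rough (lpf e) (t div e)}" by (auto simp: D_def V_def)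
  ultimately show ?thesis by (simp only:)
qed

lemma sum_over_factorizations:
  fixes G :: "nat \<Rightarrow> nat \<Rightarrow> 'a :: comm_monoid_add"
  shows "(\<Sum>n=1..X. \<Sum>d | d dvd n. G d (n div d)) = (\<Sum>d=1..X. \<Sum>k=1..X. if d * k \<le> X then G d k else 0)"
proof -
  have "(\<Sum>n=1..X. \<Sum>d | d dvd n. G d (n div d)) = (\<Sum>(n,d)\<in>(SIGMA n:{1..X}. {d. d dvd n}). G d (n div d))"
    by (rule sum.Sigma) (auto simp: finite_divisors_nat)
  also have "\<dots> = (\<Sum>(d,k)\<in>{(d,k). d \<in> {1..X} \<and> k \<in> {1..X} \<and> d * k \<le> X}. G d k)"
  proof (rule sum.reindex_bij_witness[of _ "\<lambda>(d,k). (d * k, d)" "\<lambda>(n,d). (d, n div d)"], goal_cases)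
    case (2 x)
    then obtain d k where "x = (d * k, d)" "1 \<le> d * k" "d * k \<le> X" by (auto elim!: dvdE)
    moreover from this have "d \<ge> 1" "k \<ge> 1" by (cases d; cases k; simp)+
    moreover from calculation have "d \<le> X" "k \<le> X"
      using le_trans[of d "d * k" X] le_trans[of k "d * k" X] by auto
    ultimately show ?case by auto
  next
    case (4 x) thus ?case by (auto simp: Suc_le_eq)
  qed (auto elim!: dvdE)
  also have "\<dots> = (\<Sum>(d,k)\<in>{1..X} \<times> {1..X}. if d * k \<le> X then G d k else 0)"
    by (rule sum.mono_neutral_cong_left) (auto split: if_splits)
  finally show ?thesis by (simp add: sum.cartesian_product)
qed

section \<open>The divisor bound\<close>

lemma card_divisors_prime_power_mult_le:
  fixes m :: nat
  assumes "prime p" "m > 0"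
  shows "card {d. d dvd p ^ a * m} \<le> (a + 1) * card {d. d dvd m}"
proof -
  have fin: "finite ({..a} \<times> {d. d dvd m})" using assms by (simp add: finite_divisors_nat)
  have "{d. d dvd p ^ a * m} \<subseteq> (\<lambda>(i,e). p ^ i * e) ` ({..a} \<times> {d. d dvd m})"
  proof
    fix d assume "d \<in> {d. d dvd p ^ a * m}"
    then obtain b e where d: "d = b * e" "b dvd p ^ a" "e dvd m"
      using division_decomp[of d "p ^ a" m] by auto
    then obtain i where "i \<le> a" "b = p ^ i" using divides_primepow_nat[OF assms(1)] by auto
    thus "d \<in> (\<lambda>(i,e). p ^ i * e) ` ({..a} \<times> {d. d dvd m})" using d by force
  qed
  hence "card {d. d dvd p ^ a * m} \<le> card ((\<lambda>(i,e). p ^ i * e) ` ({..a} \<times> {d. d dvd m}))"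
    using fin by (intro card_mono) auto
  also have "\<dots> \<le> card ({..a} \<times> {d. d dvd m})" by (rule card_image_le[OF fin])
  finally show ?thesis by (simp add: card_cartesian_product)
qed

text \<open>Prime powers are removed one prime at a time. A prime p >= 2^(1/\<delta>) costs nothing,
  since p^(a \<delta>) >= 2^a >= a + 1. Each of the fewer than \<open>B\<close> smaller primes costs
  a factor \<open>K\<close>, whence the constant \<open>K ^ B\<close>.\<close>

lemma divisor_bound:
  fixes \<delta> :: real
  assumes \<delta>: "\<delta> > 0"
  shows "\<exists>C\<ge>1. \<forall>n::nat. n \<ge> 1 \<longrightarrow> real (card {d. d dvd n}) \<le> C * real n powr \<delta>"
proof -
  define B where "B = nat \<lceil>2 powr (1 / \<delta>)\<rceil>"
  \<comment> \<open>Chosen so that a + 1 <= K 2^(a \<delta>) for every a, by exp x >= 1 + x.\<close>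
  define K where "K = max 1 (1 / (\<delta> * ln 2))"
  have K1: "K \<ge> 1" by (simp add: K_def)
  have K: "real a + 1 \<le> K * 2 powr (real a * \<delta>)" for a :: nat
  proof -
    have "real a = (1 / (\<delta> * ln 2)) * (real a * \<delta> * ln 2)" using \<delta> by simp
    also have "\<dots> \<le> K * (real a * \<delta> * ln 2)" using \<delta> by (intro mult_right_mono) (auto simp: K_def)
    finally have "real a + 1 \<le> K * (1 + real a * \<delta> * ln 2)" using K1 by (simp add: distrib_left)
    also have "\<dots> \<le> K * exp (real a * \<delta> * ln 2)" using K1 by (intro mult_left_mono exp_ge_add_one_self) auto
    finally show ?thesis by (simp add: powr_def)
  qed
  have pow: "(real p ^ a) powr \<delta> = (real p powr \<delta>) ^ a" if "p > 0" for p a :: nat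
    using that by (simp add: powr_powr mult.commute flip: powr_realpow powr_power)
  have main: "real (card {d. d dvd n}) \<le> K ^ card {p. prime p \<and> p < B \<and> p dvd n} * real n powr \<delta>" if "n \<ge> 1" for n :: nat
    using that
  proof (induction n rule: less_induct)
    case (less n)
    show ?case
    proof (cases "n = 1")
      case True
      have "{d. d dvd (1::nat)} = {1}" by auto
      thus ?thesis using True K1 by simp
    next
      case False
      then obtain p where p: "prime p" "p dvd n" using prime_factor_nat by blast
      have n0: "n \<noteq> 0" using less by auto
      obtain m where m: "n = p ^ multiplicity p n * m" "\<not> p dvd m"
      proof (rule multiplicity_decompose'[of n p])
        show "\<not> is_unit p" using p by auto
      qed (use n0 in auto)
      define a where "a = multiplicity p n"
      have nm: "n = p ^ a * m" using m by (simp add: a_def)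
      have a1: "a \<ge> 1" using p n0 by (simp add: a_def multiplicity_geI Suc_le_eq prime_multiplicity_gt_zero_iff)
      have m1: "m \<ge> 1" using nm n0 by (cases m) auto
      have p1: "p > 1" using p prime_gt_1_nat by blast
      have "1 < p ^ a" using p1 a1 by (intro one_less_power) auto
      hence "m < n" using nm m1 by simp
      define cn where "cn = card {r. prime r \<and> r < B \<and> r dvd n}"
      define cm where "cm = card {r. prime r \<and> r < B \<and> r dvd m}"
      have IH: "real (card {d. d dvd m}) \<le> K ^ cm * real m powr \<delta>"
        unfolding cm_def using less.IH[OF \<open>m < n\<close> m1] .
      have sub: "{r. prime r \<and> r < B \<and> r dvd m} \<subseteq> {r. prime r \<and> r < B \<and> r dvd n}" using nm by auto
      have step: "real a + 1 \<le> K ^ (cn - cm) * (real p powr \<delta>) ^ a" and cmn: "cm \<le> cn"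
      proof -
        show cmn: "cm \<le> cn" unfolding cm_def cn_def using sub by (intro card_mono) auto
        show "real a + 1 \<le> K ^ (cn - cm) * (real p powr \<delta>) ^ a"
        proof (cases "p < B")
          case True
          have "{r. prime r \<and> r < B \<and> r dvd m} \<subset> {r. prime r \<and> r < B \<and> r dvd n}"
            using sub True p m(2) by blast
          hence "cm < cn" unfolding cm_def cn_def by (intro psubset_card_mono) auto
          have "real a + 1 \<le> K * 2 powr (real a * \<delta>)" by (rule K)
          also have "2 powr (real a * \<delta>) = (2 powr \<delta>) ^ a" by (simp add: powr_powr mult.commute powr_power)
          also have "K * (2 powr \<delta>) ^ a \<le> K ^ (cn - cm) * (real p powr \<delta>) ^ a"
          proof (rule mult_mono)
            have "K ^ 1 \<le> K ^ (cn - cm)" using K1 \<open>cm < cn\<close> by (intro power_increasing) auto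
            thus "K \<le> K ^ (cn - cm)" by simp
            show "(2 powr \<delta>) ^ a \<le> (real p powr \<delta>) ^ a" using p1 \<delta> by (intro power_mono powr_mono2) auto
          qed (use K1 in auto)
          finally show ?thesis .
        next
          case False
          have "2 powr (1 / \<delta>) \<le> real p" using False unfolding B_def by linarith
          hence "(2 powr (1 / \<delta>)) powr \<delta> \<le> real p powr \<delta>" using \<delta> by (intro powr_mono2) auto
          hence p2: "2 \<le> real p powr \<delta>" using \<delta> by (simp add: powr_powr)
          have "a + 1 \<le> 2 ^ a" by (induction a) auto
          hence "real (a + 1) \<le> real (2 ^ a)" by (simp only: of_nat_le_iff)
          hence "real a + 1 \<le> 1 * 2 ^ a" by simp
          also have "\<dots> \<le> K ^ (cn - cm) * (real p powr \<delta>) ^ a"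
            using K1 p2 by (intro mult_mono power_mono one_le_power) auto
          finally show ?thesis .
        qed
      qed
      have "card {d. d dvd n} \<le> (a + 1) * card {d. d dvd m}"
        unfolding nm using card_divisors_prime_power_mult_le[OF p(1)] m1 by simp
      hence "real (card {d. d dvd n}) \<le> real ((a + 1) * card {d. d dvd m})" by (simp only: of_nat_le_iff)
      also have "\<dots> = (real a + 1) * real (card {d. d dvd m})" by (simp add: distrib_right)
      also have "\<dots> \<le> (K ^ (cn - cm) * (real p powr \<delta>) ^ a) * (K ^ cm * real m powr \<delta>)"
        using step IH K1 by (intro mult_mono) auto
      also have "\<dots> = K ^ ((cn - cm) + cm) * ((real p powr \<delta>) ^ a * real m powr \<delta>)"
        by (simp add: power_add mult_ac)
      also have "(cn - cm) + cm = cn" using cmn by simp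
      also have "(real p powr \<delta>) ^ a * real m powr \<delta> = (real p ^ a) powr \<delta> * real m powr \<delta>"
        using pow[of p a] p1 by simp
      also have "\<dots> = real n powr \<delta>" unfolding nm using p1 by (simp add: powr_mult)
      finally show ?thesis by (simp add: cn_def)
    qed
  qed
  show ?thesis
  proof (intro exI[of _ "K ^ B"] conjI allI impI)
    show "1 \<le> K ^ B" using K1 by simp
    fix n :: nat assume n: "n \<ge> 1"
    have "card {p. prime p \<and> p < B \<and> p dvd n} \<le> card {..<B}" by (intro card_mono) auto
    hence "K ^ card {p. prime p \<and> p < B \<and> p dvd n} \<le> K ^ B" using K1 by (intro power_increasing) auto
    thus "real (card {d. d dvd n}) \<le> K ^ B * real n powr \<delta>"
      using main[OF n] by (meson mult_right_mono order_trans powr_ge_zero)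
  qed
qed

section \<open>Distances to the nearest integer\<close>

definition int_dist :: "real \<Rightarrow> real" where
  "int_dist t = min (frac t) (1 - frac t)"

lemma int_dist_range: "0 \<le> int_dist t" "int_dist t \<le> 1/2"
  using frac_lt_1[of t] frac_ge_0[of t] unfolding int_dist_def by linarith+

lemma int_dist_le: "int_dist t \<le> \<bar>t - of_int m\<bar>"
proof (cases "m \<le> \<lfloor>t\<rfloor>")
  case True
  hence "frac t \<le> t - of_int m" unfolding frac_def by linarith
  thus ?thesis unfolding int_dist_def by linarith
next
  case False
  hence "of_int m \<ge> of_int \<lfloor>t\<rfloor> + (1::real)" by linarith
  hence "1 - frac t \<le> of_int m - t" unfolding frac_def by linarith
  thus ?thesis unfolding int_dist_def by linarith
qed

lemma int_dist_attained: "\<exists>m. int_dist t = \<bar>t - of_int m\<bar>"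
proof (cases "frac t \<le> 1 - frac t")
  case True
  hence "int_dist t = \<bar>t - of_int \<lfloor>t\<rfloor>\<bar>" using frac_ge_0[of t] unfolding int_dist_def frac_def by linarith
  thus ?thesis by blast
next
  case False
  hence "int_dist t = \<bar>t - of_int (\<lfloor>t\<rfloor> + 1)\<bar>" using frac_lt_1[of t] unfolding int_dist_def frac_def by simp
  thus ?thesis by blast
qed

lemma int_dist_minus: "int_dist (- t) = int_dist t"
proof -
  have "int_dist (-t) \<le> int_dist t" for t
  proof -
    obtain m where "int_dist t = \<bar>t - of_int m\<bar>" using int_dist_attained by blast
    moreover have "int_dist (-t) \<le> \<bar>-t - of_int (-m)\<bar>" by (rule int_dist_le)
    ultimately show ?thesis by simp
  qed
  from this[of t] this[of "-t"] show ?thesis by simp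
qed

lemma int_dist_diff_le: "int_dist t - \<bar>s\<bar> \<le> int_dist (t + s)"
proof -
  obtain m where "int_dist (t + s) = \<bar>t + s - of_int m\<bar>" using int_dist_attained by blast
  moreover have "int_dist t \<le> \<bar>t - of_int m\<bar>" by (rule int_dist_le)
  ultimately show ?thesis by linarith
qed

text \<open>The usual minimum of K and the reciprocal distance to the nearest integer. Since 1 / 0 =
  0, a literal minimum would vanish at integers t; testing the product instead yields K
  there.\<close>

definition geo_bound :: "real \<Rightarrow> real \<Rightarrow> real" where
  "geo_bound K t = (if int_dist t * K \<le> 1 then K else 1 / int_dist t)"

lemma geo_bound_minus: "geo_bound K (- t) = geo_bound K t"
  by (simp add: geo_bound_def int_dist_minus)

lemma geo_bound_nonneg: "K \<ge> 0 \<Longrightarrow> geo_bound K t \<ge> 0"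
  using int_dist_range[of t] by (simp add: geo_bound_def)

lemma geo_bound_le1: "K \<ge> 0 \<Longrightarrow> geo_bound K t \<le> K"
proof (cases "int_dist t * K \<le> 1")
  case False
  assume "K \<ge> 0"
  have "int_dist t > 0" using False int_dist_range[of t] by (cases "int_dist t = 0") auto
  thus ?thesis using False by (simp add: geo_bound_def field_simps)
qed (simp add: geo_bound_def)

lemma geo_bound_le2: "c > 0 \<Longrightarrow> c \<le> int_dist t \<Longrightarrow> geo_bound K t \<le> 1 / c"
proof (cases "int_dist t * K \<le> 1")
  case True
  assume c: "c > 0" "c \<le> int_dist t"
  hence "K \<le> 1 / int_dist t" using True by (simp add: field_simps)
  also have "\<dots> \<le> 1 / c" using c by (simp add: frac_le)
  finally show ?thesis using True by (simp add: geo_bound_def)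
qed (auto simp: geo_bound_def frac_le)

lemma norm_add_char [simp]: "norm (add_char x) = 1"
  by (simp add: add_char_def)

lemma add_char_add: "add_char (x + y) = add_char x * add_char y"
  by (simp add: add_char_def ring_distribs exp_add)

lemma add_char_cnj: "cnj (add_char x) = add_char (- x)"
  by (simp add: add_char_def exp_cnj)

lemma add_char_int: "add_char (of_int m) = 1"
  unfolding add_char_def by (simp add: exp_eq_1 field_simps)

lemma add_char_of_nat_mult: "add_char (real n * x) = add_char x ^ n"
  by (simp add: add_char_def exp_of_nat_mult[symmetric] algebra_simps)

lemma norm_add_char_minus_1: "norm (add_char x - 1) = 2 * \<bar>sin (pi * x)\<bar>"
proof -
  have "add_char x = cis (2 * pi * x)"
    by (simp add: add_char_def cis_conv_exp algebra_simps)
  moreover have "(norm (cis (2*pi*x) - 1))\<^sup>2 = (2 * \<bar>sin (pi * x)\<bar>)\<^sup>2"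
  proof -
    have "(norm (cis (2*pi*x) - 1))\<^sup>2 = (cos (2*pi*x) - 1)\<^sup>2 + (sin (2*pi*x))\<^sup>2"
      by (simp add: cmod_power2)
    also have "\<dots> = 2 - 2 * cos (2 * (pi * x))"
      using sin_cos_squared_add[of "2*pi*x"] by (simp add: power2_eq_square algebra_simps)
    also have "\<dots> = (2 * \<bar>sin (pi * x)\<bar>)\<^sup>2"
      unfolding cos_double_sin by (simp add: power_mult_distrib)
    finally show ?thesis .
  qed
  ultimately show ?thesis by (metis abs_ge_zero mult_nonneg_nonneg norm_ge_zero power2_eq_imp_eq zero_le_numeral)
qed

text \<open>A weak form of Jordan's inequality. Up to t = 1/6 the cosine is at least 1/2 and pi / 2
  > 1; beyond that, monotonicity gives sin (pi t) >= 1/2 >= t.\<close>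

lemma sin_pi_ge:
  assumes "0 \<le> t" "t \<le> 1/2"
  shows "t \<le> sin (pi * t)"
proof (cases "t \<le> 1/6")
  case True
  have "pi * t \<le> pi / 6" using True by simp
  have c: "cos s \<ge> 1/2" if "0 \<le> s" "s \<le> pi * t" for s
  proof -
    have "s \<le> pi / 3" using that \<open>pi * t \<le> pi / 6\<close> pi_gt_zero by linarith
    thus ?thesis using that cos_monotone_0_pi_le[of s "pi/3"] by (simp add: cos_60)
  qed
  have "pi * t / 2 \<le> sin (pi * t)"
  proof -
    have "sin 0 - 0/2 \<le> sin (pi*t) - (pi*t)/2"
    proof (rule DERIV_nonneg_imp_nondecreasing[of 0 "pi*t" "\<lambda>s. sin s - s/2"])
      show "0 \<le> pi * t" using assms by simp
      fix s assume "0 \<le> s" "s \<le> pi * t"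
      thus "\<exists>y. ((\<lambda>s. sin s - s/2) has_real_derivative y) (at s) \<and> 0 \<le> y"
        using c[of s] by (intro exI[of _ "cos s - 1/2"]) (auto intro!: derivative_eq_intros)
    qed
    thus ?thesis by simp
  qed
  moreover have "t \<le> pi * t / 2" using mult_right_mono[of 2 pi t] assms pi_gt3 by simp
  ultimately show ?thesis by linarith
next
  case False
  have "pi * t \<ge> pi / 6" using False by simp
  moreover have "pi * t \<le> pi / 2" using assms by simp
  ultimately have "sin (pi/6) \<le> sin (pi * t)" by (intro sin_monotone_2pi_le) auto
  thus ?thesis using assms by (simp add: sin_30)
qed

lemma norm_add_char_minus_1_ge: "2 * int_dist x \<le> norm (add_char x - 1)"
proof -
  have "\<bar>sin (pi * x)\<bar> = \<bar>sin (pi * frac x)\<bar>"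
  proof -
    have "add_char x = add_char (frac x) * add_char (of_int \<lfloor>x\<rfloor>)"
      unfolding add_char_add[symmetric] by (simp add: frac_def)
    hence "norm (add_char x - 1) = norm (add_char (frac x) - 1)" by (simp add: add_char_int)
    thus ?thesis unfolding norm_add_char_minus_1 by simp
  qed
  moreover have "int_dist x \<le> sin (pi * frac x)"
  proof (cases "frac x \<le> 1/2")
    case True
    thus ?thesis using sin_pi_ge[of "frac x"] by (simp add: int_dist_def)
  next
    case False
    have "sin (pi * frac x) = sin (pi * (1 - frac x))" by (simp add: algebra_simps)
    thus ?thesis using sin_pi_ge[of "1 - frac x"] False frac_lt_1[of x] by (simp add: int_dist_def)
  qed
  ultimately show ?thesis using int_dist_range[of x] unfolding norm_add_char_minus_1 by linarith
qed

lemma norm_sum_add_char_le: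
  assumes "real n \<le> K"
  shows "norm (\<Sum>k<n. add_char (real k * t)) \<le> geo_bound K t"
proof (cases "int_dist t * K \<le> 1")
  case True
  have "norm (\<Sum>k<n. add_char (real k * t)) \<le> (\<Sum>k<n. norm (add_char (real k * t)))" by (rule norm_sum)
  also have "\<dots> = real n" by simp
  finally show ?thesis using True assms by (simp add: geo_bound_def)
next
  case False
  have d: "int_dist t > 0" using False int_dist_range[of t] by (cases "int_dist t = 0") auto
  hence n1: "norm (add_char t - 1) > 0" using norm_add_char_minus_1_ge[of t] by linarith
  hence "add_char t \<noteq> 1" by auto
  hence "(\<Sum>k<n. add_char (real k * t)) = (add_char t ^ n - 1) / (add_char t - 1)"
    by (simp add: add_char_of_nat_mult geometric_sum)
  hence "norm (\<Sum>k<n. add_char (real k * t)) = norm (add_char t ^ n - 1) / norm (add_char t - 1)"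
    by (simp add: norm_divide)
  also have "\<dots> \<le> 2 / (2 * int_dist t)"
  proof (rule frac_le)
    have "norm (add_char t ^ n - 1) \<le> norm (add_char t ^ n) + norm (1::complex)" by (rule norm_triangle_ineq4)
    thus "norm (add_char t ^ n - 1) \<le> 2" by (simp add: norm_power)
  qed (use d norm_add_char_minus_1_ge in auto)
  finally show ?thesis using False by (simp add: geo_bound_def)
qed

section \<open>Mean values of \<open>geo_bound\<close> along the multiples of \<alpha>\<close>

text \<open>As q does not divide j a, the fraction j a / q is at least 1/q away from the integers,
  and replacing a/q by \<alpha> costs at most j / q^2 <= 1 / (2q).\<close>

lemma int_dist_spacing:
  fixes a q :: int and \<alpha> :: real and j :: nat
  assumes q: "q \<ge> 1" and cop: "coprime a q"
    and ap: "\<bar>\<alpha> - of_int a / of_int q\<bar> \<le> 1 / (of_int q)\<^sup>2"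
    and j: "1 \<le> j" "2 * int j \<le> q"
  shows "1 / (2 * of_int q) \<le> int_dist (real j * \<alpha>)"
proof -
  have q0: "real_of_int q > 0" using q by simp
  obtain m where m: "int_dist (real j * of_int a / of_int q) = \<bar>real j * of_int a / of_int q - of_int m\<bar>"
    using int_dist_attained by blast
  have "int j * a - m * q \<noteq> 0"
  proof
    assume "int j * a - m * q = 0"
    hence "q dvd int j * a" by simp
    hence "q dvd int j" using cop by (simp add: coprime_commute coprime_dvd_mult_left_iff)
    thus False using j by (auto dest: zdvd_imp_le)
  qed
  hence "\<bar>int j * a - m * q\<bar> \<ge> 1" by linarith
  hence "real_of_int \<bar>int j * a - m * q\<bar> \<ge> 1" by linarith
  hence "1 \<le> \<bar>real j * of_int a - of_int m * of_int q\<bar>" by simp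
  moreover have "real j * of_int a / of_int q - of_int m = (real j * of_int a - of_int m * of_int q) / of_int q"
    using q0 by (simp add: field_simps)
  ultimately have 1: "1 / of_int q \<le> int_dist (real j * of_int a / of_int q)"
    unfolding m using q0 by (simp add: abs_divide divide_right_mono)
  have "\<bar>real j * (\<alpha> - of_int a / of_int q)\<bar> \<le> real j * (1 / (of_int q)\<^sup>2)"
    unfolding abs_mult using ap by (intro mult_mono) auto
  also have "\<dots> \<le> (of_int q / 2) * (1 / (of_int q)\<^sup>2)"
    using j(2) by (intro mult_right_mono) auto
  also have "\<dots> = 1 / (2 * of_int q)" using q0 by (simp add: power2_eq_square)
  finally have 2: "\<bar>real j * (\<alpha> - of_int a / of_int q)\<bar> \<le> 1 / (2 * of_int q)" .
  have "int_dist (real j * of_int a / of_int q + real j * (\<alpha> - of_int a / of_int q)) \<ge>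
     int_dist (real j * of_int a / of_int q) - \<bar>real j * (\<alpha> - of_int a / of_int q)\<bar>"
    by (rule int_dist_diff_le)
  hence "int_dist (real j * \<alpha>) \<ge> 1 / of_int q - 1 / (2 * of_int q)"
    using 1 2 by (simp add: algebra_simps)
  thus ?thesis using q0 by (simp add: field_simps)
qed

lemma sum_inverse_le: "(\<Sum>i=1..n. 1 / real i) \<le> 1 + ln (real n)" if "n \<ge> 1"
  using that
proof (induction n rule: nat_induct_at_least)
  case base thus ?case by simp
next
  case (Suc n)
  have "1 / real (Suc n) \<le> ln (real (Suc n)) - ln (real n)"
  proof -
    have "ln (real n / real (Suc n)) \<le> real n / real (Suc n) - 1"
      using Suc by (intro ln_le_minus_one) auto
    also have "\<dots> = - 1 / real (Suc n)" by (simp add: field_simps)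
    finally show ?thesis using Suc by (simp add: ln_div)
  qed
  thus ?case using Suc by simp
qed

text \<open>Within a block the differences of indices are at most q/2, so the points y \<alpha> are
  1/(2q)-spaced modulo 1 and each of the 2q cells of length 1/(2q) contains at most one of them. The
  two cells next to an integer cost K each; the others sum harmonically.\<close>

lemma sum_geo_bound_block:
  fixes a q :: int and \<alpha> K :: real and y0 :: nat
  assumes q: "q \<ge> 1" and cop: "coprime a q"
    and ap: "\<bar>\<alpha> - of_int a / of_int q\<bar> \<le> 1 / (of_int q)\<^sup>2" and K: "K \<ge> 0"
    and A: "A \<subseteq> {y0..<y0 + (nat q div 2 + 1)}"
  shows "(\<Sum>y\<in>A. geo_bound K (real y * \<alpha>)) \<le> 2 * K + 4 * of_int q * (1 + ln (2 * of_int q))"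
proof -
  define n where "n = 2 * nat q"
  have n: "n \<ge> 2" "real n = 2 * of_int q" using q by (auto simp: n_def)
  define \<phi> where "\<phi> = (\<lambda>y::nat. nat \<lfloor>real n * frac (real y * \<alpha>)\<rfloor>)"
  have fl: "real (\<phi> y) \<le> real n * frac (real y * \<alpha>)" "real n * frac (real y * \<alpha>) < real (\<phi> y) + 1" for y
  proof -
    have nn: "0 \<le> real n * frac (real y * \<alpha>)" using frac_ge_0 by simp
    hence e: "real (\<phi> y) = of_int \<lfloor>real n * frac (real y * \<alpha>)\<rfloor>" unfolding \<phi>_def
      by (simp add: zero_le_floor)
    show "real (\<phi> y) \<le> real n * frac (real y * \<alpha>)" "real n * frac (real y * \<alpha>) < real (\<phi> y) + 1"
      unfolding e by linarith+
  qed
  have rng: "\<phi> y < n" for y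
  proof -
    have "real n * frac (real y * \<alpha>) < real n * 1" using n frac_lt_1 by (intro mult_strict_left_mono) auto
    hence "real (\<phi> y) < real n" using fl(1)[of y] by linarith
    thus ?thesis by simp
  qed
  have sep: "\<phi> y \<noteq> \<phi> y'" if yy: "y \<in> A" "y' \<in> A" "y < y'" for y y'
  proof
    assume e: "\<phi> y = \<phi> y'"
    have "y \<ge> y0" "y' < y0 + (nat q div 2 + 1)" using yy A by auto
    hence "y' - y \<le> nat q div 2" by linarith
    hence "2 * (y' - y) \<le> nat q" by linarith
    hence "2 * int (y' - y) \<le> q" using q by linarith
    hence "1 / (2 * of_int q) \<le> int_dist (real (y' - y) * \<alpha>)"
      using yy by (intro int_dist_spacing[OF q cop ap]) auto
    also have "real (y' - y) * \<alpha> = real y' * \<alpha> - real y * \<alpha>" using yy by (simp add: algebra_simps of_nat_diff)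
    also have "int_dist \<dots> \<le> \<bar>frac (real y' * \<alpha>) - frac (real y * \<alpha>)\<bar>"
      using int_dist_le[of "real y' * \<alpha> - real y * \<alpha>" "\<lfloor>real y' * \<alpha>\<rfloor> - \<lfloor>real y * \<alpha>\<rfloor>"]
      by (simp add: frac_def algebra_simps)
    finally have "1 \<le> real n * \<bar>frac (real y' * \<alpha>) - frac (real y * \<alpha>)\<bar>"
      unfolding n(2)[symmetric] using n by (simp add: field_simps)
    also have "\<dots> = \<bar>real n * frac (real y' * \<alpha>) - real n * frac (real y * \<alpha>)\<bar>"
      by (simp add: right_diff_distrib[symmetric] abs_mult)
    also have "\<dots> < 1" using fl[of y] fl[of y'] e by linarith
    finally show False by simp
  qed
  have inj: "inj_on \<phi> A"
  proof (rule inj_onI)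
    fix y y' assume "y \<in> A" "y' \<in> A" "\<phi> y = \<phi> y'"
    thus "y = y'" using sep[of y y'] sep[of y' y] by (cases y y' rule: linorder_cases) auto
  qed
  \<comment> \<open>A point of cell i is at least i/n away from 0 and (n-1-i)/n away from 1. The sum
    of the two reciprocals covers both possibilities for the nearer endpoint.\<close>
  define G where "G = (\<lambda>i. if i = 0 \<or> i = n - 1 then K else real n / real i + real n / real (n - 1 - i))"
  have G: "geo_bound K (real y * \<alpha>) \<le> G (\<phi> y)" for y
  proof (cases "\<phi> y = 0 \<or> \<phi> y = n - 1")
    case True thus ?thesis using geo_bound_le1[OF K] by (simp add: G_def)
  next
    case False
    let ?i = "\<phi> y"
    have i: "?i > 0" "n - 1 - ?i > 0" using False rng[of y] by auto
    have ri: "real (n - 1 - ?i) = real n - 1 - real ?i" using i by linarith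
    have "real ?i / real n \<le> frac (real y * \<alpha>)" using fl(1)[of y] n by (simp add: field_simps)
    moreover have "real (n - 1 - ?i) / real n \<le> 1 - frac (real y * \<alpha>)"
      unfolding ri using fl(2)[of y] n by (simp add: field_simps)
    moreover have "int_dist (real y * \<alpha>) = frac (real y * \<alpha>) \<or> int_dist (real y * \<alpha>) = 1 - frac (real y * \<alpha>)"
      unfolding int_dist_def by linarith
    ultimately have "real ?i / real n \<le> int_dist (real y * \<alpha>) \<or> real (n - 1 - ?i) / real n \<le> int_dist (real y * \<alpha>)"
      by auto
    hence "geo_bound K (real y * \<alpha>) \<le> 1 / (real ?i / real n) \<or> geo_bound K (real y * \<alpha>) \<le> 1 / (real (n - 1 - ?i) / real n)"
      using geo_bound_le2[of "real ?i / real n"] geo_bound_le2[of "real (n - 1 - ?i) / real n"] i n by auto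
    hence "geo_bound K (real y * \<alpha>) \<le> real n / real ?i + real n / real (n - 1 - ?i)"
      using add_increasing add_increasing2 by (auto intro: add_increasing add_increasing2)
    thus ?thesis using False by (simp add: G_def)
  qed
  have Gn: "G i \<ge> 0" for i using K by (auto simp: G_def)
  have "(\<Sum>y\<in>A. geo_bound K (real y * \<alpha>)) \<le> (\<Sum>y\<in>A. G (\<phi> y))" by (intro sum_mono G)
  also have "\<dots> = (\<Sum>i\<in>\<phi> ` A. G i)" using inj by (simp add: sum.reindex)
  also have "\<dots> \<le> (\<Sum>i<n. G i)" using rng Gn by (intro sum_mono2) auto
  also have "\<dots> = (\<Sum>i\<in>{0, n-1} \<union> {1..n-2}. G i)" using n by (intro sum.cong) auto
  also have "\<dots> = (\<Sum>i\<in>{0, n-1}. G i) + (\<Sum>i\<in>{1..n-2}. G i)" using n by (intro sum.union_disjoint) auto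
  also have "(\<Sum>i\<in>{0, n-1}. G i) = 2 * K" using n by (simp add: G_def)
  also have "(\<Sum>i\<in>{1..n-2}. G i) = (\<Sum>i\<in>{1..n-2}. real n / real i + real n / real (n - 1 - i))"
    by (intro sum.cong) (auto simp: G_def)
  also have "\<dots> = (\<Sum>i\<in>{1..n-2}. real n / real i) + (\<Sum>i\<in>{1..n-2}. real n / real (n - 1 - i))"
    by (rule sum.distrib)
  also have "(\<Sum>i\<in>{1..n-2}. real n / real (n - 1 - i)) = (\<Sum>i\<in>{1..n-2}. real n / real i)"
    by (rule sum.reindex_bij_witness[of _ "\<lambda>i. n - 1 - i" "\<lambda>i. n - 1 - i"]) auto
  also have "(\<Sum>i\<in>{1..n-2}. real n / real i) \<le> (\<Sum>i=1..n. real n / real i)" by (intro sum_mono2) auto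
  also have "(\<Sum>i=1..n. real n / real i) = real n * (\<Sum>i=1..n. 1 / real i)" by (simp add: sum_distrib_left)
  also have "\<dots> \<le> real n * (1 + ln (real n))" using n by (intro mult_left_mono sum_inverse_le) auto
  finally show ?thesis unfolding n by simp
qed

lemma sum_geo_bound:
  fixes a q :: int and \<alpha> K :: real and Y :: nat
  assumes q: "q \<ge> 1" and cop: "coprime a q"
    and ap: "\<bar>\<alpha> - of_int a / of_int q\<bar> \<le> 1 / (of_int q)\<^sup>2" and K: "K \<ge> 0"
  shows "(\<Sum>y=1..Y. geo_bound K (real y * \<alpha>)) \<le>
    (2 * real Y / of_int q + 1) * (2 * K + 4 * of_int q * (1 + ln (2 * of_int q)))"
proof -
  define h where "h = nat q div 2 + 1"
  define E where "E = 2 * K + 4 * of_int q * (1 + ln (2 * of_int q))"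
  have E: "E \<ge> 0" using K q by (auto simp: E_def intro!: add_nonneg_nonneg mult_nonneg_nonneg)
  have h: "h > 0" "real h \<ge> of_int q / 2" using q by (auto simp: h_def)
  have "(\<Sum>y=1..Y. geo_bound K (real y * \<alpha>)) =
      (\<Sum>i\<in>{..Y div h}. \<Sum>y | y \<in> {1..Y} \<and> y div h = i. geo_bound K (real y * \<alpha>))"
    by (rule sum.group[symmetric]) (auto intro: div_le_mono)
  also have "\<dots> \<le> (\<Sum>i\<in>{..Y div h}. E)" unfolding E_def
  proof (intro sum_mono sum_geo_bound_block[OF q cop ap K])
    fix i
    show "{y. y \<in> {1..Y} \<and> y div h = i} \<subseteq> {i * h..<i * h + (nat q div 2 + 1)}"
    proof
      fix y assume "y \<in> {y. y \<in> {1..Y} \<and> y div h = i}"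
      moreover have "y div h * h + y mod h = y" "y mod h < h" using h by auto
      ultimately show "y \<in> {i * h..<i * h + (nat q div 2 + 1)}" unfolding h_def[symmetric] by auto
    qed
  qed
  also have "\<dots> = (real (Y div h) + 1) * E" by simp
  also have "\<dots> \<le> (2 * real Y / of_int q + 1) * E"
  proof (intro mult_right_mono add_right_mono E)
    have "real (Y div h) \<le> real Y / real h" by (rule of_nat_div_le_of_nat)
    also have "\<dots> \<le> real Y / (of_int q / 2)" using h q by (intro divide_left_mono) auto
    finally show "real (Y div h) \<le> 2 * real Y / of_int q" by (simp add: mult.commute)
  qed
  finally show ?thesis unfolding E_def .
qed

section \<open>Weyl differencing\<close>

lemma le_nat_floor_iff: "x \<ge> 0 \<Longrightarrow> k \<le> nat \<lfloor>x\<rfloor> \<longleftrightarrow> real k \<le> x"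
  by (simp add: le_nat_iff le_floor_iff)

lemma norm_sum_square_correlation:
  fixes g :: "nat \<Rightarrow> complex"
  assumes "\<And>k. norm (g k) = 1"
  shows "(norm (\<Sum>k<R. g k))\<^sup>2 = real R + 2 * Re (\<Sum>r=1..R. \<Sum>k<R-r. g (k + r) * cnj (g k))"
proof (induction R)
  case 0 thus ?case by simp
next
  case (Suc R)
  have nadd: "(norm (u + v))\<^sup>2 = (norm u)\<^sup>2 + (norm v)\<^sup>2 + 2 * Re (v * cnj u)" for u v :: complex
    by (simp only: cmod_power2) (simp add: power2_eq_square algebra_simps)
  have "(\<Sum>r=1..Suc R. \<Sum>k<Suc R - r. g (k + r) * cnj (g k)) = (\<Sum>r=1..R. \<Sum>k<Suc R - r. g (k + r) * cnj (g k))"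
    by simp
  also have "\<dots> = (\<Sum>r=1..R. (\<Sum>k<R - r. g (k + r) * cnj (g k)) + g R * cnj (g (R - r)))"
  proof (rule sum.cong[OF refl])
    fix r assume "r \<in> {1..R}"
    hence "Suc R - r = Suc (R - r)" "R - r + r = R" by auto
    thus "(\<Sum>k<Suc R - r. g (k + r) * cnj (g k)) = (\<Sum>k<R - r. g (k + r) * cnj (g k)) + g R * cnj (g (R - r))"
      by simp
  qed
  also have "\<dots> = (\<Sum>r=1..R. \<Sum>k<R - r. g (k + r) * cnj (g k)) + g R * (\<Sum>r=1..R. cnj (g (R - r)))"
    by (simp add: sum.distrib sum_distrib_left)
  also have "(\<Sum>r=1..R. cnj (g (R - r))) = (\<Sum>k<R. cnj (g k))"
    by (rule sum.reindex_bij_witness[of _ "\<lambda>k. R - k" "\<lambda>r. R - r"]) auto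
  finally have "(\<Sum>r=1..Suc R. \<Sum>k<Suc R - r. g (k + r) * cnj (g k)) =
     (\<Sum>r=1..R. \<Sum>k<R - r. g (k + r) * cnj (g k)) + g R * cnj (\<Sum>k<R. g k)" by simp
  moreover have "(norm (\<Sum>k<Suc R. g k))\<^sup>2 = (norm (\<Sum>k<R. g k))\<^sup>2 + 1 + 2 * Re (g R * cnj (\<Sum>k<R. g k))"
    by (simp add: nadd assms)
  ultimately show ?case unfolding Suc.IH by simp
qed

text \<open>Shifting k by r turns the quadratic phase into a linear one of frequency 2 r \<beta>.
  The lower coefficients \<gamma> and \<delta> only enter a unimodular factor or cancel, so the
  bound depends on \<beta> alone.\<close>

lemma weyl_differencing:
  assumes "real R \<le> K"
  shows "(norm (\<Sum>k<R. add_char (\<beta> * (real k)\<^sup>2 + \<gamma> * real k + \<delta>)))\<^sup>2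
           \<le> real R + 2 * (\<Sum>r=1..R. geo_bound K (2 * real r * \<beta>))"
proof -
  let ?g = "\<lambda>k. add_char (\<beta> * (real k)\<^sup>2 + \<gamma> * real k + \<delta>)"
  have "norm (\<Sum>k<R-r. ?g (k + r) * cnj (?g k)) \<le> geo_bound K (2 * real r * \<beta>)" for r
  proof -
    have "(\<Sum>k<R-r. ?g (k + r) * cnj (?g k)) =
        add_char (\<beta> * (real r)\<^sup>2 + \<gamma> * real r) * (\<Sum>k<R-r. add_char (real k * (2 * real r * \<beta>)))"
      unfolding sum_distrib_left add_char_cnj add_char_add[symmetric]
      by (rule sum.cong[OF refl]) (simp add: power2_eq_square algebra_simps)
    moreover have "norm (\<Sum>k<R-r. add_char (real k * (2 * real r * \<beta>))) \<le> geo_bound K (2 * real r * \<beta>)"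
      using assms by (intro norm_sum_add_char_le) simp
    ultimately show ?thesis by (simp add: norm_mult)
  qed
  hence "norm (\<Sum>r=1..R. \<Sum>k<R-r. ?g (k + r) * cnj (?g k)) \<le> (\<Sum>r=1..R. geo_bound K (2 * real r * \<beta>))"
    by (intro sum_norm_le) auto
  hence "Re (\<Sum>r=1..R. \<Sum>k<R-r. ?g (k + r) * cnj (?g k)) \<le> (\<Sum>r=1..R. geo_bound K (2 * real r * \<beta>))"
    using complex_Re_le_cmod order_trans by blast
  thus ?thesis by (subst norm_sum_square_correlation) auto
qed

lemma weyl_differencing_1:
  assumes "real R \<le> K"
  shows "(norm (\<Sum>k=1..R. add_char (\<beta> * (real k)\<^sup>2)))\<^sup>2
           \<le> real R + 2 * (\<Sum>r=1..R. geo_bound K (2 * real r * \<beta>))"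
proof -
  have "(\<Sum>k=1..R. add_char (\<beta> * (real k)\<^sup>2)) = (\<Sum>k<R. add_char (\<beta> * (real k)\<^sup>2 + 2 * \<beta> * real k + \<beta>))"
    by (rule sum.reindex_bij_witness[of _ Suc "\<lambda>k. k - 1"])
       (auto simp: power2_eq_square algebra_simps of_nat_diff)
  thus ?thesis using weyl_differencing[OF assms, of \<beta> "2 * \<beta>" \<beta>] by simp
qed

text \<open>Passes from a sum over tuples to a sum over the frequencies y they produce;
  \<open>C\<close> will be a bound for the number of tuples with the same frequency, supplied by the
  divisor bound.\<close>

lemma sum_fibres_le:
  fixes g :: "nat \<Rightarrow> real" and f :: "'a \<Rightarrow> nat"
  assumes "finite Q" "\<And>t. t \<in> Q \<Longrightarrow> f t \<in> {1..Y}" "\<And>y. g y \<ge> 0"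
    and card: "\<And>y. y \<in> {1..Y} \<Longrightarrow> real (card {t \<in> Q. f t = y}) \<le> C"
  shows "(\<Sum>t\<in>Q. g (f t)) \<le> C * (\<Sum>y=1..Y. g y)"
proof -
  have "(\<Sum>t\<in>Q. g (f t)) = (\<Sum>y=1..Y. \<Sum>t | t \<in> Q \<and> f t = y. g (f t))"
    using assms by (intro sum.group[symmetric]) auto
  also have "\<dots> = (\<Sum>y=1..Y. real (card {t \<in> Q. f t = y}) * g y)" by (intro sum.cong) auto
  also have "\<dots> \<le> (\<Sum>y=1..Y. C * g y)" using assms card by (intro sum_mono mult_right_mono) auto
  finally show ?thesis by (simp add: sum_distrib_left)
qed

lemma norm_sum_mult_square_le:
  fixes f g :: "'a \<Rightarrow> complex"
  shows "(norm (\<Sum>i\<in>A. f i * g i))\<^sup>2 \<le> (\<Sum>i\<in>A. (norm (f i))\<^sup>2) * (\<Sum>i\<in>A. (norm (g i))\<^sup>2)"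
proof -
  have "norm (\<Sum>i\<in>A. f i * g i) \<le> (\<Sum>i\<in>A. norm (f i) * norm (g i))"
    by (rule order_trans[OF norm_sum]) (simp add: norm_mult)
  hence "(norm (\<Sum>i\<in>A. f i * g i))\<^sup>2 \<le> (\<Sum>i\<in>A. norm (f i) * norm (g i))\<^sup>2" by (simp add: power_mono)
  also have "\<dots> \<le> (\<Sum>i\<in>A. (norm (f i))\<^sup>2) * (\<Sum>i\<in>A. (norm (g i))\<^sup>2)"
    by (rule Cauchy_Schwarz_ineq_sum)
  finally show ?thesis .
qed

lemma sum_le_sqrt_card_sum_squares:
  fixes f :: "'a \<Rightarrow> real"
  shows "(\<Sum>i\<in>A. f i) \<le> sqrt (real (card A) * (\<Sum>i\<in>A. (f i)\<^sup>2))"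
proof -
  have "(\<Sum>i\<in>A. 1 * f i)\<^sup>2 \<le> (\<Sum>i\<in>A. 1\<^sup>2) * (\<Sum>i\<in>A. (f i)\<^sup>2)" by (rule Cauchy_Schwarz_ineq_sum)
  hence "(\<Sum>i\<in>A. f i)\<^sup>2 \<le> real (card A) * (\<Sum>i\<in>A. (f i)\<^sup>2)" by simp
  thus ?thesis by (rule real_le_rsqrt)
qed

text \<open>The condition q <= N^2 keeps log q of the order of log N. \<open>T\<close> stands for
  the divisor bound; 128 N^2 covers the largest frequency that occurs, 32 r m^2 with r <= N/M, m <
  2M and M <= N.\<close>

locale quadratic_phase =
  fixes \<alpha> N T :: real and a q :: int
  assumes q: "q \<ge> 1" and cop: "coprime a q"
    and approx: "\<bar>\<alpha> - of_int a / of_int q\<bar> \<le> 1 / (of_int q)\<^sup>2"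
    and N: "N \<ge> 2" and qN: "of_int q \<le> N\<^sup>2" and T: "T \<ge> 1"
    and divisors: "\<And>n::nat. n \<ge> 1 \<Longrightarrow> real n \<le> 128 * N\<^sup>2 \<Longrightarrow> real (card {d. d dvd n}) \<le> T"
begin

definition Lg :: real where "Lg = 1 + ln N"

definition F :: "nat \<Rightarrow> complex" where "F n = add_char ((real n)\<^sup>2 * \<alpha>)"

lemma Lg: "Lg \<ge> 1" using N by (simp add: Lg_def)

lemma norm_F [simp]: "norm (F n) = 1" by (simp add: F_def)

lemma q0: "real_of_int q > 0" using q by simp

text \<open>The product in \<open>sum_geo_bound\<close> expands into 512 N^2/q, 2048 N M Lg, 2 N/M
  and 8 q Lg. As N/M <= N M, the third term joins the second, which gives 2050.\<close>

lemma sum_geo_bound_phase: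
  assumes M: "1 \<le> M" "M \<le> N" and Y: "real Y \<le> 128 * N * M"
  shows "(\<Sum>y=1..Y. geo_bound (N / M) (real y * \<alpha>)) \<le> 2050 * Lg * (N\<^sup>2 / of_int q + N * M + of_int q)"
proof -
  have K: "N / M \<ge> 0" using M N by simp
  have "ln (2 * real_of_int q) \<le> ln (2 * N\<^sup>2)" using q qN N by (intro ln_mono) auto
  also have "\<dots> = ln 2 + 2 * ln N" using N by (simp add: ln_mult ln_realpow)
  also have "\<dots> \<le> 1 + 2 * ln N" using ln_le_minus_one[of 2] by simp
  finally have l: "1 + ln (2 * real_of_int q) \<le> 2 * Lg" by (simp add: Lg_def)
  have NM: "N / M \<le> N * M"
  proof -
    have "N / M \<le> N / 1" using M N by (intro divide_left_mono) auto
    also have "\<dots> \<le> N * M" using M N by simp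
    finally show ?thesis .
  qed
  have "(\<Sum>y=1..Y. geo_bound (N / M) (real y * \<alpha>)) \<le>
    (2 * real Y / of_int q + 1) * (2 * (N / M) + 4 * of_int q * (1 + ln (2 * of_int q)))"
    by (rule sum_geo_bound[OF q cop approx K])
  also have "\<dots> \<le> (256 * N * M / of_int q + 1) * (2 * (N / M) + 4 * of_int q * (2 * Lg))"
  proof (intro mult_mono add_mono order_refl mult_left_mono l)
    show "2 * real Y / real_of_int q \<le> 256 * N * M / real_of_int q" using Y q0 by (intro divide_right_mono) (auto simp: mult_ac)
    have "0 \<le> ln (2 * real_of_int q)" using q by (intro ln_ge_zero) auto
    thus "0 \<le> 2 * (N / M) + 4 * real_of_int q * (1 + ln (2 * real_of_int q))" using q K
      by (intro add_nonneg_nonneg mult_nonneg_nonneg) auto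
    show "0 \<le> 256 * N * M / real_of_int q + 1" using N M q0 by (intro add_nonneg_nonneg divide_nonneg_pos) auto
  qed (use q K in auto)
  also have "\<dots> = 512 * (N\<^sup>2 / of_int q) + 2048 * (N * M) * Lg + 2 * (N / M) + 8 * of_int q * Lg"
    using M q0 by (simp add: field_simps power2_eq_square)
  also have "\<dots> \<le> 512 * (N\<^sup>2 / of_int q) * Lg + 2048 * (N * M) * Lg + 2 * (N * M) * Lg + 8 * of_int q * Lg"
  proof (intro add_mono order_refl)
    show "512 * (N\<^sup>2 / of_int q) \<le> 512 * (N\<^sup>2 / of_int q) * Lg"
      using mult_left_mono[OF Lg, of "512 * (N\<^sup>2 / of_int q)"] q by simp
    show "2 * (N / M) \<le> 2 * (N * M) * Lg"
    proof -
      have "N * M * 1 \<le> N * M * Lg" using Lg N M by (intro mult_left_mono) auto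
      thus ?thesis using NM by linarith
    qed
  qed
  also have "\<dots> \<le> 2050 * Lg * (N\<^sup>2 / of_int q) + 2050 * Lg * (N * M) + 2050 * Lg * of_int q"
  proof -
    have "512 * u * Lg + 2048 * v * Lg + 2 * v * Lg + 8 * w * Lg \<le> 2050 * Lg * u + 2050 * Lg * v + 2050 * Lg * w"
      if "0 \<le> Lg * u" "0 \<le> Lg * w" for u v w using that by (simp add: algebra_simps)
    from this[of "N\<^sup>2 / of_int q" "of_int q" "N * M"] show ?thesis using Lg q by (simp add: mult_ac)
  qed
  finally show ?thesis by (simp add: algebra_simps)
qed

text \<open>Up to 2050 Lg, the bound of \<open>sum_geo_bound_phase\<close> for the sum of
  \<open>geo_bound\<close> over all frequencies up to a constant multiple of N M. The dependence of
  the block estimates on q passes through this quantity.\<close>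

definition weyl_err :: "nat \<Rightarrow> real" where "weyl_err M = N\<^sup>2 / of_int q + N * real M + of_int q"

lemma weyl_err_ge: "weyl_err M \<ge> N * real M" "weyl_err M \<ge> 0"
  using q N by (auto simp: weyl_err_def intro!: add_nonneg_nonneg)

lemma card_divisor_pairs_le:
  assumes "y \<ge> 1" "real y \<le> 128 * N\<^sup>2" "inj_on h Q" "h ` Q \<subseteq> {d. d dvd y} \<times> {d. d dvd y}"
  shows "real (card Q) \<le> T\<^sup>2"
proof -
  have f: "finite {d. d dvd y}" using assms(1) by (simp add: finite_divisors_nat)
  have "card Q = card (h ` Q)" using assms(3) by (simp add: card_image)
  also have "\<dots> \<le> card ({d. d dvd y} \<times> {d. d dvd y})" using assms(4) f by (intro card_mono) auto
  finally have "real (card Q) \<le> real (card {d. d dvd y}) * real (card {d. d dvd y})"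
    by (simp add: card_cartesian_product flip: of_nat_mult)
  also have "\<dots> \<le> T * T" using divisors[OF assms(1,2)] by (intro mult_mono) auto
  finally show ?thesis by (simp add: power2_eq_square)
qed

text \<open>Weyl differencing in k leads to the frequencies 2 r (m - m') (m + m') \<alpha>. Given
  the integer y in front of \<alpha>, both r and m - m' are divisors of y and then determine m + m',
  so y occurs at most T^2 times. The undifferenced terms add at most M^2 N/M = N M, whence 4101 = 1
  + 2 * 2050.\<close>

lemma offdiagonal_sum_le:
  fixes M :: nat and R :: "nat \<Rightarrow> nat \<Rightarrow> nat"
  assumes M: "1 \<le> M" "real M \<le> N" and R: "\<And>m m'. m \<ge> M \<Longrightarrow> real (R m m') \<le> N / real M"
  defines "P \<equiv> {(m, m'). m \<in> {M..<2*M} \<and> m' \<in> {M..<2*M} \<and> m' < m}"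
  shows "(\<Sum>(m,m')\<in>P. (norm (\<Sum>k=1..R m m'. add_char (((real m)\<^sup>2 - (real m')\<^sup>2) * \<alpha> * (real k)\<^sup>2)))\<^sup>2)
     \<le> 4101 * T\<^sup>2 * Lg * weyl_err M"
proof -
  define K where "K = N / real M"
  define Kn where "Kn = nat \<lfloor>K\<rfloor>"
  have K: "K \<ge> 0" using N by (simp add: K_def)
  have Kn: "real Kn \<le> K" using K by (simp add: Kn_def)
  have fin: "finite P" unfolding P_def
    by (rule finite_subset[of _ "{M..<2*M} \<times> {M..<2*M}"]) auto
  have "(\<Sum>(m,m')\<in>P. (norm (\<Sum>k=1..R m m'. add_char (((real m)\<^sup>2 - (real m')\<^sup>2) * \<alpha> * (real k)\<^sup>2)))\<^sup>2)
     \<le> (\<Sum>(m,m')\<in>P. K + 2 * (\<Sum>r=1..Kn. geo_bound K (2 * real r * (((real m)\<^sup>2 - (real m')\<^sup>2) * \<alpha>))))"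
  proof (rule sum_mono, clarify)
    fix m m' assume "(m, m') \<in> P"
    hence RK: "real (R m m') \<le> K" using R by (auto simp: P_def K_def)
    hence "R m m' \<le> Kn" unfolding Kn_def by linarith
    hence "(\<Sum>r=1..R m m'. geo_bound K (2 * real r * (((real m)\<^sup>2 - (real m')\<^sup>2) * \<alpha>)))
       \<le> (\<Sum>r=1..Kn. geo_bound K (2 * real r * (((real m)\<^sup>2 - (real m')\<^sup>2) * \<alpha>)))"
      using geo_bound_nonneg[OF K] by (intro sum_mono2) auto
    thus "(norm (\<Sum>k=1..R m m'. add_char (((real m)\<^sup>2 - (real m')\<^sup>2) * \<alpha> * (real k)\<^sup>2)))\<^sup>2 \<le>
       K + 2 * (\<Sum>r=1..Kn. geo_bound K (2 * real r * (((real m)\<^sup>2 - (real m')\<^sup>2) * \<alpha>)))"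
      using weyl_differencing_1[OF RK, of "((real m)\<^sup>2 - (real m')\<^sup>2) * \<alpha>"] RK by linarith
  qed
  also have "\<dots> = real (card P) * K + 2 * (\<Sum>(m,m')\<in>P. \<Sum>r=1..Kn. geo_bound K (2 * real r * (((real m)\<^sup>2 - (real m')\<^sup>2) * \<alpha>)))"
    by (simp add: sum.distrib sum_distrib_left case_prod_beta)
  also have "(\<Sum>(m,m')\<in>P. \<Sum>r=1..Kn. geo_bound K (2 * real r * (((real m)\<^sup>2 - (real m')\<^sup>2) * \<alpha>)))
     = (\<Sum>((m,m'),r)\<in>P \<times> {1..Kn}. geo_bound K (real (2 * r * ((m - m') * (m + m'))) * \<alpha>))"
    unfolding sum.cartesian_product[symmetric]
  proof (rule sum.cong[OF refl], clarify, rule sum.cong[OF refl])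
    fix m m' r assume "(m,m') \<in> P"
    hence "m' \<le> m" by (simp add: P_def)
    hence "2 * real r * (((real m)\<^sup>2 - (real m')\<^sup>2) * \<alpha>) = real (2 * r * ((m - m') * (m + m'))) * \<alpha>"
      by (simp only: of_nat_mult of_nat_add of_nat_diff[OF \<open>m' \<le> m\<close>]) (simp add: power2_eq_square algebra_simps)
    thus "geo_bound K (2 * real r * (((real m)\<^sup>2 - (real m')\<^sup>2) * \<alpha>)) = geo_bound K (real (2 * r * ((m - m') * (m + m'))) * \<alpha>)"
      by (simp only:)
  qed
  also have "\<dots> = (\<Sum>t\<in>P \<times> {1..Kn}. geo_bound K (real ((\<lambda>((m,m'),r). 2 * r * ((m - m') * (m + m'))) t) * \<alpha>))"
    by (rule sum.cong[OF refl]) auto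
  also have "\<dots> \<le> T\<^sup>2 * (\<Sum>y=1..8 * Kn * M^2. geo_bound K (real y * \<alpha>))"
  proof (rule sum_fibres_le)
    show "finite (P \<times> {1..Kn})" using fin by simp
    show "\<And>y. 0 \<le> geo_bound K (real y * \<alpha>)" using geo_bound_nonneg[OF K] .
    show "(\<lambda>((m,m'),r). 2 * r * ((m - m') * (m + m'))) t \<in> {1..8 * Kn * M^2}" if "t \<in> P \<times> {1..Kn}" for t
    proof -
      obtain m m' r where t: "t = ((m,m'),r)" by (metis surj_pair)
      have h: "m' < m" "m < 2 * M" "m' < 2*M" "M \<le> m'" "1 \<le> r" "r \<le> Kn" using that t by (auto simp: P_def)
      have "(m - m') * (m + m') \<le> M * (4 * M)" using h by (intro mult_mono) auto
      hence "2 * r * ((m - m') * (m + m')) \<le> 2 * Kn * (M * (4 * M))" using h by (intro mult_mono) auto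
      also have "\<dots> = 8 * Kn * M^2" by (simp add: power2_eq_square)
      finally have "2 * r * ((m - m') * (m + m')) \<le> 8 * Kn * M^2" .
      moreover have "2 * r * ((m - m') * (m + m')) \<ge> 1" using h by simp
      ultimately show ?thesis using t by simp
    qed
    fix y assume y: "y \<in> {1..8 * Kn * M^2}"
    have "real y \<le> real (8 * Kn * M^2)" using y by (simp only: of_nat_le_iff) simp
    also have "\<dots> \<le> 8 * K * (real M)^2" using Kn by (simp add: mult_right_mono)
    also have "\<dots> = 8 * N * M" using M by (simp add: K_def power2_eq_square)
    also have "\<dots> \<le> 128 * N * N" using M N by (intro mult_mono) auto
    finally have y2: "real y \<le> 128 * N\<^sup>2" by (simp add: power2_eq_square)
    show "real (card {t \<in> P \<times> {1..Kn}. (\<lambda>((m,m'),r). 2 * r * ((m - m') * (m + m'))) t = y}) \<le> T\<^sup>2"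
    proof (rule card_divisor_pairs_le[where h="\<lambda>((m,m'),r). (r, m - m')"])
      show "inj_on (\<lambda>((m,m'),r). (r, m - m')) {t \<in> P \<times> {1..Kn}. (\<lambda>((m,m'),r). 2 * r * ((m - m') * (m + m'))) t = y}"
      proof (rule inj_onI)
        fix s t
        assume st: "s \<in> {t \<in> P \<times> {1..Kn}. (\<lambda>((m,m'),r). 2 * r * ((m - m') * (m + m'))) t = y}"
          "t \<in> {t \<in> P \<times> {1..Kn}. (\<lambda>((m,m'),r). 2 * r * ((m - m') * (m + m'))) t = y}"
          "(\<lambda>((m,m'),r). (r, m - m')) s = (\<lambda>((m,m'),r). (r, m - m')) t"
        obtain m m' r where s: "s = ((m,m'),r)" by (metis surj_pair)
        obtain n n' r' where t: "t = ((n,n'),r')" by (metis surj_pair)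
        have 1: "(m,m') \<in> P" "(n,n') \<in> P" "r \<in> {1..Kn}" "m - m' = n - n'" "r' = r"
          "2 * r * ((m - m') * (m + m')) = 2 * r * ((n - n') * (n + n'))"
          using st unfolding s t by auto
        have "m' < m" "n' < n" using 1 by (auto simp: P_def)
        moreover have "m + m' = n + n'" using 1 \<open>n' < n\<close> by simp
        ultimately have "m = n \<and> m' = n'" using 1(4) by linarith
        thus "s = t" using s t 1(5) by simp
      qed
    qed (use y y2 in auto)
  qed
  also have "(\<Sum>y=1..8 * Kn * M^2. geo_bound K (real y * \<alpha>)) \<le> 2050 * Lg * weyl_err M"
    unfolding K_def weyl_err_def
  proof (rule sum_geo_bound_phase)
    have "real (8 * Kn * M^2) \<le> 8 * K * (real M)^2" using Kn by (simp add: mult_right_mono)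
    also have "\<dots> = 8 * N * M" using M by (simp add: K_def power2_eq_square)
    also have "\<dots> \<le> 128 * N * M" using N by (intro mult_mono) auto
    finally show "real (8 * Kn * M^2) \<le> 128 * N * real M" .
  qed (use M in auto)
  also have "real (card P) * K \<le> T\<^sup>2 * Lg * weyl_err M"
  proof -
    have "card P \<le> card ({M..<2*M} \<times> {M..<2*M})" unfolding P_def by (intro card_mono) auto
    hence "real (card P) \<le> real M * real M" by (simp add: card_cartesian_product flip: of_nat_mult)
    hence "real (card P) * K \<le> real M * real M * K" using K by (intro mult_right_mono) auto
    also have "\<dots> = N * real M" using M by (simp add: K_def)
    also have "\<dots> \<le> 1 * weyl_err M" using weyl_err_ge by simp
    also have "\<dots> \<le> (T\<^sup>2 * Lg) * weyl_err M"
      using weyl_err_ge Lg T by (intro mult_right_mono) (auto simp: mult_ge1_I)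
    finally show ?thesis .
  qed
  finally show ?thesis using T by (simp add: algebra_simps)
qed

end

section \<open>Bilinear forms in a dyadic block\<close>

context quadratic_phase begin

lemma correlation_sum:
  assumes M: "1 \<le> M" and m: "M \<le> m" "M \<le> m'"
  shows "(\<Sum>k=1..nat \<lfloor>N / real M\<rfloor>. (if real (m * k) \<le> N then F (m * k) else 0) *
      cnj (if real (m' * k) \<le> N then F (m' * k) else 0)) =
    (\<Sum>k=1..nat \<lfloor>N / real (max m m')\<rfloor>. add_char (((real m)\<^sup>2 - (real m')\<^sup>2) * \<alpha> * (real k)\<^sup>2))"
proof -
  have mx: "max m m' \<ge> M" "max m m' > 0" using m M by auto
  have iff: "k \<le> nat \<lfloor>N / real (max m m')\<rfloor> \<longleftrightarrow> real (m * k) \<le> N \<and> real (m' * k) \<le> N" for k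
  proof -
    have "k \<le> nat \<lfloor>N / real (max m m')\<rfloor> \<longleftrightarrow> real k \<le> N / real (max m m')" using N
      by (intro le_nat_floor_iff) auto
    also have "\<dots> \<longleftrightarrow> real (max m m') * real k \<le> N" using mx by (simp add: field_simps)
    also have "\<dots> \<longleftrightarrow> real (m * k) \<le> N \<and> real (m' * k) \<le> N"
    proof (cases "m \<le> m'")
      case True
      hence "real m * real k \<le> real m' * real k" by (intro mult_right_mono) auto
      thus ?thesis using True by (auto simp: max_def)
    next
      case False
      hence "real m' * real k \<le> real m * real k" by (intro mult_right_mono) auto
      thus ?thesis using False by (auto simp: max_def)
    qed
    finally show ?thesis .
  qed
  have "nat \<lfloor>N / real (max m m')\<rfloor> \<le> nat \<lfloor>N / real M\<rfloor>"
    using mx M N by (intro nat_mono floor_mono divide_left_mono) auto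
  hence "{1..nat \<lfloor>N / real (max m m')\<rfloor>} \<subseteq> {1..nat \<lfloor>N / real M\<rfloor>}" by auto
  hence "(\<Sum>k=1..nat \<lfloor>N / real M\<rfloor>. (if real (m * k) \<le> N then F (m * k) else 0) *
      cnj (if real (m' * k) \<le> N then F (m' * k) else 0)) =
     (\<Sum>k=1..nat \<lfloor>N / real (max m m')\<rfloor>. (if real (m * k) \<le> N then F (m * k) else 0) *
      cnj (if real (m' * k) \<le> N then F (m' * k) else 0))"
    using iff by (intro sum.mono_neutral_right) auto
  also have "\<dots> = (\<Sum>k=1..nat \<lfloor>N / real (max m m')\<rfloor>. add_char (((real m)\<^sup>2 - (real m')\<^sup>2) * \<alpha> * (real k)\<^sup>2))"
  proof (rule sum.cong[OF refl])
    fix k assume "k \<in> {1..nat \<lfloor>N / real (max m m')\<rfloor>}"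
    hence "real (m * k) \<le> N \<and> real (m' * k) \<le> N" using iff by auto
    moreover have "F (m * k) * cnj (F (m' * k)) = add_char ((real (m * k))\<^sup>2 * \<alpha> + - ((real (m' * k))\<^sup>2 * \<alpha>))"
      by (simp only: F_def add_char_cnj add_char_add)
    moreover have "(real (m * k))\<^sup>2 * \<alpha> + - ((real (m' * k))\<^sup>2 * \<alpha>) = ((real m)\<^sup>2 - (real m')\<^sup>2) * \<alpha> * (real k)\<^sup>2"
      by (simp add: algebra_simps power_mult_distrib)
    ultimately show "(if real (m * k) \<le> N then F (m * k) else 0) * cnj (if real (m' * k) \<le> N then F (m' * k) else 0)
      = add_char (((real m)\<^sup>2 - (real m')\<^sup>2) * \<alpha> * (real k)\<^sup>2)" by (simp only: if_True)
  qed
  finally show ?thesis .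
qed

text \<open>Cauchy-Schwarz is applied twice: the first time to remove the unknown coefficients of the
  long variable, the second time to the off-diagonal pairs, whose Weyl sums are controlled only on
  average.\<close>

lemma bilinear_block_square:
  fixes M :: nat and A c :: "nat \<Rightarrow> complex"
  assumes M: "1 \<le> M" "real M \<le> N" and A: "\<And>m. norm (A m) \<le> 1" and c: "\<And>k. norm (c k) \<le> T"
  shows "(norm (\<Sum>m\<in>{M..<2*M}. \<Sum>k=1..nat \<lfloor>N / real M\<rfloor>. if real (m * k) \<le> N then A m * c k * F (m * k) else 0))\<^sup>2
    \<le> T\<^sup>2 * (N / real M) * (N + real M * sqrt (8202 * T\<^sup>2 * Lg * weyl_err M))"
proof -
  define I where "I = {M..<2*M}"
  define Kn where "Kn = nat \<lfloor>N / real M\<rfloor>"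
  define G where "G = (\<lambda>m k. if real (m * k) \<le> N then F (m * k) else 0)"
  define W where "W = (\<lambda>m m'. \<Sum>k=1..Kn. G m k * cnj (G m' k))"
  have Kn: "real Kn \<le> N / real M" using N M by (simp add: Kn_def)
  have G1: "norm (G m k) \<le> 1" for m k by (simp add: G_def)
  have "(\<Sum>m\<in>I. \<Sum>k=1..Kn. if real (m * k) \<le> N then A m * c k * F (m * k) else 0)
     = (\<Sum>m\<in>I. \<Sum>k=1..Kn. c k * (A m * G m k))"
    by (intro sum.cong refl) (simp add: G_def)
  also have "\<dots> = (\<Sum>k=1..Kn. c k * (\<Sum>m\<in>I. A m * G m k))"
    unfolding sum_distrib_left by (rule sum.swap)
  also have "(norm \<dots>)\<^sup>2 \<le> (\<Sum>k=1..Kn. (norm (c k))\<^sup>2) * (\<Sum>k=1..Kn. (norm (\<Sum>m\<in>I. A m * G m k))\<^sup>2)"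
    by (rule norm_sum_mult_square_le)
  also have "\<dots> \<le> (T\<^sup>2 * (N / real M)) * (N + real M * sqrt (8202 * T\<^sup>2 * Lg * weyl_err M))"
  proof (rule mult_mono)
    have "(\<Sum>k=1..Kn. (norm (c k))\<^sup>2) \<le> (\<Sum>k=1..Kn. T\<^sup>2)" using c by (intro sum_mono power_mono) auto
    also have "\<dots> = T\<^sup>2 * real Kn" by simp
    also have "\<dots> \<le> T\<^sup>2 * (N / real M)" using Kn by (intro mult_left_mono) auto
    finally show "(\<Sum>k=1..Kn. (norm (c k))\<^sup>2) \<le> T\<^sup>2 * (N / real M)" .
    have "complex_of_real (\<Sum>k=1..Kn. (norm (\<Sum>m\<in>I. A m * G m k))\<^sup>2)
        = (\<Sum>k=1..Kn. \<Sum>m\<in>I. \<Sum>m'\<in>I. (A m * cnj (A m')) * (G m k * cnj (G m' k)))"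
      unfolding of_real_sum complex_norm_square
      by (simp add: sum_product mult_ac)
    also have "\<dots> = (\<Sum>m\<in>I. \<Sum>m'\<in>I. (A m * cnj (A m')) * W m m')"
      unfolding W_def sum_distrib_left by (subst sum.swap, subst (2) sum.swap, rule refl)
    finally have "(\<Sum>k=1..Kn. (norm (\<Sum>m\<in>I. A m * G m k))\<^sup>2) = Re (\<Sum>m\<in>I. \<Sum>m'\<in>I. (A m * cnj (A m')) * W m m')"
      by (metis Re_complex_of_real)
    also have "\<dots> \<le> norm (\<Sum>m\<in>I. \<Sum>m'\<in>I. (A m * cnj (A m')) * W m m')" by (rule complex_Re_le_cmod)
    also have "\<dots> \<le> (\<Sum>m\<in>I. \<Sum>m'\<in>I. norm (W m m'))"
    proof (intro sum_norm_le)
      fix m m'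
      have "norm (A m) * norm (A m') \<le> 1 * 1" using A by (intro mult_mono) auto
      thus "norm (A m * cnj (A m') * W m m') \<le> norm (W m m')"
        by (simp add: norm_mult mult_left_le_one_le)
    qed
    also have "\<dots> = (\<Sum>(m,m')\<in>I \<times> I. norm (W m m'))" by (rule sum.cartesian_product)
    also have "\<dots> \<le> N + real M * sqrt (8202 * T\<^sup>2 * Lg * weyl_err M)"
    proof -
      \<comment> \<open>\<open>W\<close> is Hermitian, so the two off-diagonal halves contribute
        equally and the constant 4101 doubles to 8202. The diagonal contributes at most M times N/M,
        that is N.\<close>
      define P where "P = {(m, m'). m \<in> {M..<2*M} \<and> m' \<in> {M..<2*M} \<and> m' < m}"
      define P' where "P' = {(m, m'). m \<in> {M..<2*M} \<and> m' \<in> {M..<2*M} \<and> m < m'}"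
      have split: "I \<times> I = (\<lambda>m. (m,m)) ` I \<union> (P \<union> P')" unfolding I_def P_def P'_def by force
      have fin: "finite P" "finite P'" "P \<union> P' \<subseteq> I \<times> I"
        unfolding P_def P'_def I_def by (rule finite_subset[of _ "{M..<2*M} \<times> {M..<2*M}"]; auto)+ auto
      have sym: "norm (W m m') = norm (W m' m)" for m m'
      proof -
        have "W m m' = cnj (W m' m)" unfolding W_def by (simp add: mult.commute)
        thus ?thesis by simp
      qed
      have sq: "(\<Sum>(m,m')\<in>P. (norm (W m m'))\<^sup>2) \<le> 4101 * T\<^sup>2 * Lg * weyl_err M"
      proof -
        have "(\<Sum>(m,m')\<in>P. (norm (W m m'))\<^sup>2) = (\<Sum>(m,m')\<in>P.
          (norm (\<Sum>k=1..nat \<lfloor>N / real (max m m')\<rfloor>. add_char (((real m)\<^sup>2 - (real m')\<^sup>2) * \<alpha> * (real k)\<^sup>2)))\<^sup>2)"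
          unfolding W_def G_def Kn_def
          by (rule sum.cong[OF refl], clarify, subst correlation_sum[OF M(1)]) (auto simp: P_def)
        also have "\<dots> \<le> 4101 * T\<^sup>2 * Lg * weyl_err M" unfolding P_def
        proof (rule offdiagonal_sum_le[OF M])
          fix m m' assume "M \<le> m"
          hence "N / real (max m m') \<le> N / real M" using M N by (intro divide_left_mono) auto
          moreover have "real (nat \<lfloor>N / real (max m m')\<rfloor>) \<le> N / real (max m m')" using N by simp
          ultimately show "real (nat \<lfloor>N / real (max m m')\<rfloor>) \<le> N / real M" by linarith
        qed
        finally show ?thesis .
      qed
      have sq': "(\<Sum>(m,m')\<in>P'. (norm (W m m'))\<^sup>2) = (\<Sum>(m,m')\<in>P. (norm (W m m'))\<^sup>2)"
        by (rule sum.reindex_bij_witness[of _ "\<lambda>(m,m'). (m',m)" "\<lambda>(m,m'). (m',m)"])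
           (auto simp: P_def P'_def sym)
      have "(\<Sum>(m,m')\<in>I \<times> I. norm (W m m')) = (\<Sum>(m,m')\<in>(\<lambda>m. (m,m)) ` I. norm (W m m')) + (\<Sum>(m,m')\<in>P \<union> P'. norm (W m m'))"
        unfolding split using fin by (intro sum.union_disjoint) (auto simp: I_def P_def P'_def)
      also have "(\<Sum>(m,m')\<in>(\<lambda>m. (m,m)) ` I. norm (W m m')) = (\<Sum>m\<in>I. norm (W m m))"
        by (subst sum.reindex) (auto simp: inj_on_def)
      also have "\<dots> \<le> (\<Sum>m\<in>I. N / real M)"
      proof (rule sum_mono)
        fix m
        have "norm (W m m) \<le> (\<Sum>k=1..Kn. 1)" unfolding W_def
        proof (rule sum_norm_le)
          fix k
          have "norm (G m k) * norm (G m k) \<le> 1 * 1" using G1 by (intro mult_mono) auto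
          thus "norm (G m k * cnj (G m k)) \<le> 1" by (simp add: norm_mult)
        qed
        thus "norm (W m m) \<le> N / real M" using Kn by simp
      qed
      also have "\<dots> = N" using M by (simp add: I_def)
      also have "(\<Sum>(m,m')\<in>P \<union> P'. norm (W m m')) \<le>
        sqrt (real (card (P \<union> P')) * (\<Sum>t\<in>P \<union> P'. ((\<lambda>(m,m'). norm (W m m')) t)\<^sup>2))"
        by (rule sum_le_sqrt_card_sum_squares)
      also have "\<dots> \<le> sqrt ((real M)\<^sup>2 * (8202 * T\<^sup>2 * Lg * weyl_err M))"
      proof (intro real_sqrt_le_mono mult_mono)
        have "card (P \<union> P') \<le> card (I \<times> I)" using fin(3) by (intro card_mono) (auto simp: I_def)
        hence "real (card (P \<union> P')) \<le> real (M * M)" by (simp only: of_nat_le_iff) (simp add: I_def card_cartesian_product)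
        thus "real (card (P \<union> P')) \<le> (real M)\<^sup>2" by (simp add: power2_eq_square)
        have "(\<Sum>t\<in>P \<union> P'. ((\<lambda>(m,m'). norm (W m m')) t)\<^sup>2) = (\<Sum>(m,m')\<in>P. (norm (W m m'))\<^sup>2) + (\<Sum>(m,m')\<in>P'. (norm (W m m'))\<^sup>2)"
          using fin by (subst sum.union_disjoint) (auto simp: P_def P'_def case_prod_beta)
        thus "(\<Sum>t\<in>P \<union> P'. ((\<lambda>(m,m'). norm (W m m')) t)\<^sup>2) \<le> 8202 * T\<^sup>2 * Lg * weyl_err M"
          using sq sq' by linarith
      qed (auto intro: sum_nonneg)
      also have "\<dots> = real M * sqrt (8202 * T\<^sup>2 * Lg * weyl_err M)" by (simp add: real_sqrt_mult)
      finally show ?thesis by simp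
    qed
    finally show "(\<Sum>k=1..Kn. (norm (\<Sum>m\<in>I. A m * G m k))\<^sup>2) \<le> N + real M * sqrt (8202 * T\<^sup>2 * Lg * weyl_err M)" .
  qed (use N in \<open>auto intro!: sum_nonneg\<close>)
  finally show ?thesis unfolding I_def Kn_def by simp
qed

text \<open>Here the frequencies \<open>32 r m\<^sup>2\<close> are sparse, so the bound loses a factor \<open>M\<close>;
  it is used only for small \<open>M\<close>.\<close>

lemma smooth_block:
  fixes M :: nat and \<psi> :: "nat \<Rightarrow> complex"
  assumes M: "1 \<le> M" "real M \<le> N" and \<psi>: "\<And>n. norm (\<psi> n) \<le> 1" "\<psi> 0 = 0" "\<And>n. \<psi> (n + 4) = \<psi> n"
  shows "(\<Sum>m\<in>{M..<2*M}. norm (\<Sum>l=1..nat \<lfloor>N / real M\<rfloor>. if real (m * l) \<le> N then \<psi> l * F (m * l) else 0))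
    \<le> sqrt (36909 * T\<^sup>2 * Lg * (real M * weyl_err M))"
proof -
  define I where "I = {M..<2*M}"
  define K where "K = N / real M"
  define Kn where "Kn = nat \<lfloor>K\<rfloor>"
  define W where "W = (\<lambda>m. \<Sum>l=1..Kn. if real (m * l) \<le> N then \<psi> l * F (m * l) else 0)"
  define H where "H = (\<lambda>m. \<Sum>r=1..Kn. geo_bound K (real (32 * r * m\<^sup>2) * \<alpha>))"
  have K: "K \<ge> 0" using N by (simp add: K_def)
  have Kn: "real Kn \<le> K" using K by (simp add: Kn_def)
  have per: "\<psi> (4 * j + c) = \<psi> c" for j c
  proof (induction j)
    case (Suc j)
    have "\<psi> (4 * Suc j + c) = \<psi> (4 * j + c + 4)" by (simp add: algebra_simps)
    thus ?case using Suc \<psi>(3) by simp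
  qed simp
  have W: "(norm (W m))\<^sup>2 \<le> 9 * (K + 2 * H m)" if m: "m \<in> I" for m
  proof -
    have m0: "m \<ge> M" "m \<ge> 1" using m M by (auto simp: I_def)
    define L where "L = nat \<lfloor>N / real m\<rfloor>"
    have LK: "real L \<le> K"
    proof -
      have "real L \<le> N / real m" using N by (simp add: L_def)
      also have "\<dots> \<le> K" unfolding K_def using m0 M N by (intro divide_left_mono) auto
      finally show ?thesis .
    qed
    have LKn: "L \<le> Kn" using LK unfolding Kn_def by linarith
    have iff: "real (m * l) \<le> N \<longleftrightarrow> l \<le> L" for l
    proof -
      have "l \<le> L \<longleftrightarrow> real l \<le> N / real m" unfolding L_def using N by (intro le_nat_floor_iff) auto
      also have "\<dots> \<longleftrightarrow> real (m * l) \<le> N" using m0 by (simp add: field_simps)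
      finally show ?thesis by simp
    qed
    have "W m = (\<Sum>l=1..L. \<psi> l * F (m * l))"
      unfolding W_def by (rule sum.mono_neutral_cong_right) (use LKn iff in auto)
    also have "\<dots> = (\<Sum>l\<in>{..L}. \<psi> l * F (m * l))"
      by (rule sum.mono_neutral_left) (auto simp: \<psi>(2) not_less_eq_eq)
    \<comment> \<open>On a residue class modulo 4 the weight \<psi> is constant and can be taken out
      of the sum. Class 0 vanishes, so three classes remain; this is the origin of the factor 9 =
      3^2.\<close>
    also have "\<dots> = (\<Sum>c\<in>{..<4}. \<Sum>l | l \<in> {..L} \<and> l mod 4 = c. \<psi> l * F (m * l))"
      by (rule sum.group[symmetric]) auto
    also have "\<dots> = (\<Sum>c\<in>{1..<4}. \<Sum>l | l \<in> {..L} \<and> l mod 4 = c. \<psi> l * F (m * l))"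
    proof -
      have "(\<Sum>l | l \<in> {..L} \<and> l mod 4 = 0. \<psi> l * F (m * l)) = 0"
      proof (rule sum.neutral, rule ballI)
        fix l assume "l \<in> {l. l \<in> {..L} \<and> l mod 4 = 0}"
        hence "l mod 4 = 0" by simp
        hence "l = 4 * (l div 4) + 0" by presburger
        hence "\<psi> l = 0" using per[of "l div 4" 0] \<psi>(2) by metis
        thus "\<psi> l * F (m * l) = 0" by simp
      qed
      moreover have "{..<4} = insert (0::nat) {1..<4}" by auto
      ultimately show ?thesis by simp
    qed
    finally have Wm: "W m = (\<Sum>c\<in>{1..<4}. \<Sum>l | l \<in> {..L} \<and> l mod 4 = c. \<psi> l * F (m * l))" .
    have "norm (\<Sum>l | l \<in> {..L} \<and> l mod 4 = c. \<psi> l * F (m * l)) \<le> sqrt (K + 2 * H m)" if c: "c \<in> {1..<4}" for c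
    proof -
      \<comment> \<open>\<open>R\<close> counts the j >= 0 with 4 j + c <= L.\<close>
      define R where "R = (L + 4 - c) div 4"
      have R: "R \<le> L" using c unfolding R_def by auto
      have jR: "j < R \<longleftrightarrow> 4 * j + c \<le> L" for j using c unfolding R_def by auto
      have bij: "bij_betw (\<lambda>j. 4 * j + c) {..<R} {l. l \<in> {..L} \<and> l mod 4 = c}"
      proof (rule bij_betw_byWitness[where f'="\<lambda>l. l div 4"])
        show "(\<lambda>j. 4 * j + c) ` {..<R} \<subseteq> {l. l \<in> {..L} \<and> l mod 4 = c}"
          using c by (auto simp: jR)
        show "(\<lambda>l. l div 4) ` {l. l \<in> {..L} \<and> l mod 4 = c} \<subseteq> {..<R}"
        proof
          fix x assume "x \<in> (\<lambda>l. l div 4) ` {l. l \<in> {..L} \<and> l mod 4 = c}"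
          then obtain l where l: "l \<le> L" "l mod 4 = c" "x = l div 4" by auto
          have "4 * x + c = l" unfolding l(3) l(2)[symmetric] by simp
          thus "x \<in> {..<R}" using l(1) by (simp add: jR)
        qed
      qed (use c in auto)
      have "(\<Sum>l | l \<in> {..L} \<and> l mod 4 = c. \<psi> l * F (m * l)) = (\<Sum>j<R. \<psi> (4 * j + c) * F (m * (4 * j + c)))"
        by (rule sum.reindex_bij_betw[OF bij, symmetric])
      \<comment> \<open>Expanding the square of m (4 j + c) gives leading coefficient 16 m^2
        \<alpha>, hence the frequency 32 r m^2 \<alpha> after differencing, independently of
        c.\<close>
      also have "\<dots> = (\<Sum>j<R. \<psi> c * add_char (16 * (real m)\<^sup>2 * \<alpha> * (real j)\<^sup>2 + 8 * (real m)\<^sup>2 * real c * \<alpha> * real j + (real m)\<^sup>2 * (real c)\<^sup>2 * \<alpha>))"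
      proof (rule sum.cong[OF refl])
        fix j
        have "(real (m * (4 * j + c)))\<^sup>2 * \<alpha> = 16 * (real m)\<^sup>2 * \<alpha> * (real j)\<^sup>2 + 8 * (real m)\<^sup>2 * real c * \<alpha> * real j + (real m)\<^sup>2 * (real c)\<^sup>2 * \<alpha>"
          by (simp add: power2_eq_square algebra_simps)
        thus "\<psi> (4 * j + c) * F (m * (4 * j + c)) = \<psi> c * add_char (16 * (real m)\<^sup>2 * \<alpha> * (real j)\<^sup>2 + 8 * (real m)\<^sup>2 * real c * \<alpha> * real j + (real m)\<^sup>2 * (real c)\<^sup>2 * \<alpha>)"
          by (simp only: per F_def)
      qed
      also have "\<dots> = \<psi> c * (\<Sum>j<R. add_char (16 * (real m)\<^sup>2 * \<alpha> * (real j)\<^sup>2 + 8 * (real m)\<^sup>2 * real c * \<alpha> * real j + (real m)\<^sup>2 * (real c)\<^sup>2 * \<alpha>))"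
        by (rule sum_distrib_left[symmetric])
      finally have "norm (\<Sum>l | l \<in> {..L} \<and> l mod 4 = c. \<psi> l * F (m * l)) \<le> norm (\<Sum>j<R. add_char (16 * (real m)\<^sup>2 * \<alpha> * (real j)\<^sup>2 + 8 * (real m)\<^sup>2 * real c * \<alpha> * real j + (real m)\<^sup>2 * (real c)\<^sup>2 * \<alpha>))"
        using \<psi>(1)[of c] by (simp add: norm_mult mult_left_le_one_le)
      also have "\<dots> \<le> sqrt (K + 2 * H m)"
      proof (rule real_le_rsqrt)
        have RK: "real R \<le> K" using R LK by linarith
        have "(\<Sum>r=1..R. geo_bound K (2 * real r * (16 * (real m)\<^sup>2 * \<alpha>))) = (\<Sum>r=1..R. geo_bound K (real (32 * r * m\<^sup>2) * \<alpha>))"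
          by (simp add: mult_ac)
        also have "\<dots> \<le> H m" unfolding H_def using R LKn geo_bound_nonneg[OF K] by (intro sum_mono2) auto
        finally show "(norm (\<Sum>j<R. add_char (16 * (real m)\<^sup>2 * \<alpha> * (real j)\<^sup>2 + 8 * (real m)\<^sup>2 * real c * \<alpha> * real j + (real m)\<^sup>2 * (real c)\<^sup>2 * \<alpha>)))\<^sup>2
          \<le> K + 2 * H m"
          using weyl_differencing[OF RK, of "16 * (real m)\<^sup>2 * \<alpha>" "8 * (real m)\<^sup>2 * real c * \<alpha>" "(real m)\<^sup>2 * (real c)\<^sup>2 * \<alpha>"] RK
          by linarith
      qed
      finally show ?thesis .
    qed
    hence "norm (W m) \<le> (\<Sum>c\<in>{1..<4::nat}. sqrt (K + 2 * H m))" unfolding Wm by (intro sum_norm_le) auto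
    hence "norm (W m) \<le> 3 * sqrt (K + 2 * H m)" by simp
    hence "(norm (W m))\<^sup>2 \<le> (3 * sqrt (K + 2 * H m))\<^sup>2" by (intro power_mono) auto
    also have "\<dots> = 9 * (K + 2 * H m)"
      using K geo_bound_nonneg[OF K] by (simp add: power_mult_distrib H_def sum_nonneg)
    finally show ?thesis .
  qed
  have "(\<Sum>m\<in>I. H m) = (\<Sum>t\<in>I \<times> {1..Kn}. geo_bound K (real ((\<lambda>(m,r). 32 * r * m\<^sup>2) t) * \<alpha>))"
    unfolding H_def sum.cartesian_product by (rule sum.cong) auto
  also have "\<dots> \<le> T\<^sup>2 * (\<Sum>y=1..128 * Kn * M\<^sup>2. geo_bound K (real y * \<alpha>))"
  proof (rule sum_fibres_le)
    show "finite (I \<times> {1..Kn})" by (simp add: I_def)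
    show "\<And>y. 0 \<le> geo_bound K (real y * \<alpha>)" using geo_bound_nonneg[OF K] .
    show "(\<lambda>(m,r). 32 * r * m\<^sup>2) t \<in> {1..128 * Kn * M\<^sup>2}" if "t \<in> I \<times> {1..Kn}" for t
    proof -
      obtain m r where t: "t = (m,r)" by (cases t)
      have h: "m \<le> 2 * M" "1 \<le> m" "1 \<le> r" "r \<le> Kn" using that t M by (auto simp: I_def)
      have "32 * r * m\<^sup>2 \<le> 32 * Kn * (2 * M)\<^sup>2" using h by (intro mult_mono power_mono) auto
      thus ?thesis using h t by (simp add: power_mult_distrib)
    qed
    fix y assume y: "y \<in> {1..128 * Kn * M\<^sup>2}"
    have "real y \<le> real (128 * Kn * M\<^sup>2)" using y by (simp only: of_nat_le_iff) simp
    also have "\<dots> \<le> 128 * K * (real M)^2" using Kn by (simp add: mult_right_mono)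
    also have "\<dots> = 128 * N * M" using M by (simp add: K_def power2_eq_square)
    also have "\<dots> \<le> 128 * N * N" using M N by (intro mult_mono) auto
    finally have y2: "real y \<le> 128 * N\<^sup>2" by (simp add: power2_eq_square)
    show "real (card {t \<in> I \<times> {1..Kn}. (\<lambda>(m,r). 32 * r * m\<^sup>2) t = y}) \<le> T\<^sup>2"
      by (rule card_divisor_pairs_le[where h="\<lambda>t. t"]) (use y y2 in \<open>auto simp: power2_eq_square\<close>)
  qed
  also have "(\<Sum>y=1..128 * Kn * M\<^sup>2. geo_bound K (real y * \<alpha>)) \<le> 2050 * Lg * weyl_err M"
    unfolding K_def weyl_err_def
  proof (rule sum_geo_bound_phase)
    have "real (128 * Kn * M^2) \<le> 128 * K * (real M)^2" using Kn by (simp add: mult_right_mono)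
    also have "\<dots> = 128 * N * M" using M by (simp add: K_def power2_eq_square)
    finally show "real (128 * Kn * M^2) \<le> 128 * N * real M" .
  qed (use M in auto)
  finally have H: "(\<Sum>m\<in>I. H m) \<le> 2050 * T\<^sup>2 * Lg * weyl_err M" using T by (simp add: mult_left_mono)
  \<comment> \<open>Cauchy-Schwarz over m, because the individual Weyl sums are controlled only on
    average. The constant is 36909 = 9 + 18 * 2050.\<close>
  have "(\<Sum>m\<in>I. norm (W m)) \<le> sqrt (real (card I) * (\<Sum>m\<in>I. (norm (W m))\<^sup>2))"
    by (rule sum_le_sqrt_card_sum_squares)
  also have "\<dots> \<le> sqrt (real M * (36909 * T\<^sup>2 * Lg * weyl_err M))"
  proof (intro real_sqrt_le_mono mult_mono)
    have "(\<Sum>m\<in>I. (norm (W m))\<^sup>2) \<le> (\<Sum>m\<in>I. 9 * (K + 2 * H m))" by (intro sum_mono W)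
    also have "\<dots> = 9 * (real M * K) + 18 * (\<Sum>m\<in>I. H m)"
      by (simp add: I_def sum.distrib sum_distrib_left algebra_simps)
    also have "real M * K = N" using M by (simp add: K_def)
    also have "9 * N \<le> 9 * T\<^sup>2 * Lg * weyl_err M"
    proof -
      have "N \<le> N * real M" using M N by simp
      also have "\<dots> \<le> 1 * weyl_err M" using weyl_err_ge by simp
      also have "\<dots> \<le> (T\<^sup>2 * Lg) * weyl_err M"
        using weyl_err_ge Lg T by (intro mult_right_mono) (auto simp: mult_ge1_I)
      finally show ?thesis by simp
    qed
    finally show "(\<Sum>m\<in>I. (norm (W m))\<^sup>2) \<le> 36909 * T\<^sup>2 * Lg * weyl_err M" using H by simp
  qed (auto simp: I_def intro: sum_nonneg)
  finally show ?thesis unfolding W_def I_def Kn_def K_def by (simp add: mult_ac)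
qed

end

section \<open>Dyadic summation\<close>

lemma sum_dyadic_blocks:
  fixes f :: "nat \<Rightarrow> 'a :: comm_monoid_add"
  shows "(\<Sum>m=1..<2^n. f m) = (\<Sum>i<n. \<Sum>m\<in>{2^i..<2*2^i}. f m)"
proof (induction n)
  case (Suc n)
  have "(\<Sum>m=1..<2^Suc n. f m) = (\<Sum>m=1..<2^n. f m) + (\<Sum>m=2^n..<2^Suc n. f m)"
    by (rule sum.atLeastLessThan_concat[symmetric]) auto
  thus ?case using Suc by simp
qed simp

context quadratic_phase begin

text \<open>The three terms of the claimed bound. In these terms \<open>weyl_err M\<close> is N^2
  (u^4 + v^4 + M w^8), and size conditions are written with powers of \<open>w\<close>: 1 <= m w^2
  means m >= N^(1/4), and m w^4 <= 1 means m <= N^(1/2).\<close>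

definition u :: real where "u = of_int q powr (- 1/4)"
definition v :: real where "v = N powr (- 1/2) * of_int q powr (1/4)"
definition w :: real where "w = N powr (- 1/8)"
definition Om :: real where "Om = u + v + w"
definition X :: nat where "X = nat \<lfloor>N\<rfloor>"

lemma X: "n \<le> X \<longleftrightarrow> real n \<le> N"
  unfolding X_def using N by (intro le_nat_floor_iff) auto

lemma uvw_pos: "u > 0" "v > 0" "w > 0" "Om > 0"
  using q0 N by (auto simp: u_def v_def w_def Om_def intro!: add_pos_pos)

lemma uvw_le_Om: "u \<le> Om" "v \<le> Om" "w \<le> Om"
  using uvw_pos by (auto simp: Om_def)

lemma u4: "u ^ 4 = 1 / of_int q"
proof -
  have "u ^ 4 = of_int q powr (-1)" unfolding u_def using q0 by (simp add: powr_power)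
  thus ?thesis using q0 by (simp add: powr_minus_divide)
qed

lemma v4: "v ^ 4 = of_int q / N\<^sup>2"
proof -
  have "v ^ 4 = N powr (-2) * of_int q powr 1" unfolding v_def using q0 N by (simp add: power_mult_distrib powr_power)
  also have "N powr (-2) = 1 / N\<^sup>2" using N by (simp add: powr_minus_divide)
  finally show ?thesis using q0 by simp
qed

lemma w8: "w ^ 8 = 1 / N"
proof -
  have "w ^ 8 = N powr (-1)" unfolding w_def using N by (simp add: powr_power)
  thus ?thesis using N by (simp add: powr_minus_divide)
qed

lemma w_le_1: "w \<le> 1"
proof -
  have "N powr (- 1/8) \<le> N powr 0" using N by (intro powr_mono) auto
  thus ?thesis using N by (simp add: w_def)
qed

lemma le_N_if_w4: 
  assumes "real m * w ^ 4 \<le> 1" shows "real m \<le> N"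
proof -
  have "real m * w ^ 8 \<le> real m * w ^ 4" using w_le_1 uvw_pos by (intro mult_left_mono power_decreasing) auto
  also have "\<dots> \<le> 1" by (rule assms)
  finally show ?thesis unfolding w8 using N by (simp add: field_simps)
qed

lemma weyl_err_eq: "weyl_err M = N\<^sup>2 * (u ^ 4 + real M * w ^ 8 + v ^ 4)"
  unfolding u4 v4 w8 weyl_err_def using N by (simp add: distrib_left power2_eq_square)

lemma sqrt_const_T_Lg:
  assumes "c \<le> d\<^sup>2" "0 \<le> d" "0 \<le> x"
  shows "sqrt (c * T\<^sup>2 * Lg * x) \<le> d * T * Lg * sqrt x"
proof (rule real_le_lsqrt)
  have "c * T\<^sup>2 * Lg * x \<le> d\<^sup>2 * T\<^sup>2 * (Lg * Lg) * x"
    using assms T Lg by (intro mult_mono) (auto simp: mult_le_cancel_left1)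
  also have "\<dots> = (d * T * Lg * sqrt x)\<^sup>2" using assms by (simp add: power_mult_distrib power2_eq_square)
  finally show "c * T\<^sup>2 * Lg * x \<le> (d * T * Lg * sqrt x)\<^sup>2" .
qed (use assms T Lg in auto)

text \<open>The upper limit on M gives M w^8 <= w^4, so the square root of \<open>weyl_err M\<close>
  is at most N Om^2; the lower limit bounds the diagonal N^2/M by 4 N^2 Om^2. The factor 2 beside
  \<open>Om\<close> leaves room for a lower bound that is known only for some m < 2M.\<close>

lemma bilinear_block:
  fixes M :: nat and A c :: "nat \<Rightarrow> complex"
  assumes M: "1 \<le> M" "real M * w ^ 4 \<le> 1" and OmM: "1 \<le> real M * (2 * Om)\<^sup>2"
    and A: "\<And>m. norm (A m) \<le> 1" and c: "\<And>k. norm (c k) \<le> T"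
  shows "norm (\<Sum>m\<in>{M..<2*M}. \<Sum>k=1..nat \<lfloor>N / real M\<rfloor>. if real (m * k) \<le> N then A m * c k * F (m * k) else 0)
    \<le> 10 * T\<^sup>2 * Lg * N * Om"
proof -
  have MN: "real M \<le> N" using le_N_if_w4 M by blast
  have "weyl_err M \<le> N\<^sup>2 * Om ^ 4"
  proof -
    have "real M * w ^ 8 = (real M * w ^ 4) * w ^ 4" by (simp flip: power_add)
    also have "\<dots> \<le> 1 * w ^ 4" using M uvw_pos by (intro mult_right_mono) auto
    finally have "u ^ 4 + real M * w ^ 8 + v ^ 4 \<le> u ^ 4 + v ^ 4 + w ^ 4" by simp
    also have "\<dots> \<le> Om ^ 4"
    proof -
      have "x ^ 4 + y ^ 4 \<le> (x + y) ^ 4" if "x \<ge> 0" "y \<ge> 0" for x y :: real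
      proof -
        have "(x + y) ^ 4 = x ^ 4 + y ^ 4 + (4 * x ^ 3 * y + 6 * x\<^sup>2 * y\<^sup>2 + 4 * x * y ^ 3)"
          by (simp add: power4_eq_xxxx power3_eq_cube power2_eq_square algebra_simps)
        thus ?thesis using that by simp
      qed
      from this[of u v] this[of "u + v" w] show ?thesis using uvw_pos by (simp add: Om_def)
    qed
    finally show ?thesis unfolding weyl_err_eq by (intro mult_left_mono) auto
  qed
  hence "sqrt (weyl_err M) \<le> sqrt ((N * Om\<^sup>2)\<^sup>2)" by (intro real_sqrt_le_mono) (simp add: power_mult_distrib)
  also have "\<dots> = N * Om\<^sup>2" using N by simp
  finally have sr: "sqrt (weyl_err M) \<le> N * Om\<^sup>2" .
  have "sqrt (8202 * T\<^sup>2 * Lg * weyl_err M) \<le> 91 * T * Lg * sqrt (weyl_err M)"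
    using weyl_err_ge by (intro sqrt_const_T_Lg) auto
  also have "\<dots> \<le> 91 * T * Lg * (N * Om\<^sup>2)" using sr T Lg by (intro mult_left_mono) auto
  finally have s: "sqrt (8202 * T\<^sup>2 * Lg * weyl_err M) \<le> 91 * T * Lg * (N * Om\<^sup>2)" .
  let ?S = "norm (\<Sum>m\<in>{M..<2*M}. \<Sum>k=1..nat \<lfloor>N / real M\<rfloor>. if real (m * k) \<le> N then A m * c k * F (m * k) else 0)"
  have "?S\<^sup>2 \<le> T\<^sup>2 * (N / real M) * (N + real M * sqrt (8202 * T\<^sup>2 * Lg * weyl_err M))"
    by (rule bilinear_block_square[OF M(1) MN A c])
  also have "\<dots> \<le> T\<^sup>2 * (N / real M) * (N * (real M * (2 * Om)\<^sup>2) + real M * (91 * T * Lg * (N * Om\<^sup>2)))"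
  proof (intro mult_left_mono add_mono s)
    show "N \<le> N * (real M * (2 * Om)\<^sup>2)" using OmM N mult_left_mono[OF OmM, of N] by simp
  qed (use N in auto)
  also have "\<dots> = T\<^sup>2 * N\<^sup>2 * Om\<^sup>2 * (4 + 91 * (T * Lg))"
    using M by (simp add: field_simps power2_eq_square)
  also have "\<dots> \<le> T\<^sup>2 * N\<^sup>2 * Om\<^sup>2 * (100 * (T\<^sup>2 * Lg\<^sup>2))"
  proof (rule mult_left_mono)
    have 1: "1 \<le> T * Lg" using T Lg by (rule mult_ge1_I)
    hence "1 * (T * Lg) \<le> (T * Lg) * (T * Lg)" by (intro mult_right_mono) auto
    thus "4 + 91 * (T * Lg) \<le> 100 * (T\<^sup>2 * Lg\<^sup>2)" using 1 by (simp add: power2_eq_square mult_ac)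
  qed auto
  also have "\<dots> = (10 * T\<^sup>2 * Lg * N * Om)\<^sup>2" by (simp add: power2_eq_square)
  finally show ?thesis by (rule power2_le_imp_le) (use T Lg N uvw_pos in auto)
qed

text \<open>If M is at most u^(-2), v^(-2) and w^(-2), then M times \<open>weyl_err M\<close> is at
  most N^2 (u^2 + v^2 + w^2), and the loss of the factor M in \<open>smooth_block\<close> is
  harmless. If M exceeds one of them, then M Om^2 >= 1, and the bilinear bound applies with \<psi>
  treated as an arbitrary coefficient.\<close>

lemma smooth_or_bilinear_block:
  fixes M :: nat and c \<psi> :: "nat \<Rightarrow> complex"
  assumes M: "1 \<le> M" "real M * w ^ 4 \<le> 1"
    and \<psi>: "\<And>n. norm (\<psi> n) \<le> 1" "\<psi> 0 = 0" "\<And>n. \<psi> (n + 4) = \<psi> n"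
    and c: "\<And>m. norm (c m) \<le> T"
  shows "norm (\<Sum>m\<in>{M..<2*M}. \<Sum>l=1..nat \<lfloor>N / real M\<rfloor>. if real (m * l) \<le> N then c m * \<psi> l * F (m * l) else 0)
    \<le> 193 * T^3 * Lg * N * Om"
proof (cases "real M * u\<^sup>2 \<le> 1 \<and> real M * v\<^sup>2 \<le> 1 \<and> real M * w\<^sup>2 \<le> 1")
  case True
  have MN: "real M \<le> N" using le_N_if_w4 M by blast
  have "real M * (u ^ 4 + real M * w ^ 8 + v ^ 4) = (real M * u\<^sup>2) * u\<^sup>2 + (real M * w\<^sup>2) * (real M * w\<^sup>2) * w ^ 4 + (real M * v\<^sup>2) * v\<^sup>2"
    by (simp add: power_eq_if algebra_simps)
  also have "\<dots> \<le> 1 * u\<^sup>2 + 1 * 1 * w\<^sup>2 + 1 * v\<^sup>2"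
  proof (intro add_mono)
    show "real M * u\<^sup>2 * u\<^sup>2 \<le> 1 * u\<^sup>2" "real M * v\<^sup>2 * v\<^sup>2 \<le> 1 * v\<^sup>2"
      by (rule mult_right_mono, use True in simp, simp)+
    show "real M * w\<^sup>2 * (real M * w\<^sup>2) * w ^ 4 \<le> 1 * 1 * w\<^sup>2"
      using True w_le_1 uvw_pos by (intro mult_mono power_decreasing) auto
  qed
  also have "\<dots> \<le> Om\<^sup>2" using uvw_pos by (simp add: Om_def power2_eq_square algebra_simps)
  finally have "real M * weyl_err M \<le> N\<^sup>2 * Om\<^sup>2" unfolding weyl_err_eq
    using mult_left_mono[of "real M * (u ^ 4 + real M * w ^ 8 + v ^ 4)" "Om\<^sup>2" "N\<^sup>2"] by (simp add: mult_ac)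
  hence "sqrt (real M * weyl_err M) \<le> sqrt ((N * Om)\<^sup>2)" by (intro real_sqrt_le_mono) (simp add: power_mult_distrib)
  also have "\<dots> = N * Om" using N uvw_pos by simp
  finally have sr: "sqrt (real M * weyl_err M) \<le> N * Om" .
  have "norm (\<Sum>m\<in>{M..<2*M}. \<Sum>l=1..nat \<lfloor>N / real M\<rfloor>. if real (m * l) \<le> N then c m * \<psi> l * F (m * l) else 0)
     = norm (\<Sum>m\<in>{M..<2*M}. c m * (\<Sum>l=1..nat \<lfloor>N / real M\<rfloor>. if real (m * l) \<le> N then \<psi> l * F (m * l) else 0))"
    unfolding sum_distrib_left by (intro arg_cong[of _ _ norm] sum.cong refl) (auto simp: mult_ac)
  also have "\<dots> \<le> (\<Sum>m\<in>{M..<2*M}. T * norm (\<Sum>l=1..nat \<lfloor>N / real M\<rfloor>. if real (m * l) \<le> N then \<psi> l * F (m * l) else 0))"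
    using c by (intro sum_norm_le) (auto simp: norm_mult intro!: mult_right_mono)
  also have "\<dots> = T * (\<Sum>m\<in>{M..<2*M}. norm (\<Sum>l=1..nat \<lfloor>N / real M\<rfloor>. if real (m * l) \<le> N then \<psi> l * F (m * l) else 0))"
    by (rule sum_distrib_left[symmetric])
  also have "\<dots> \<le> T * sqrt (36909 * T\<^sup>2 * Lg * (real M * weyl_err M))"
    using T by (intro mult_left_mono smooth_block[OF M(1) MN \<psi>]) auto
  also have "\<dots> \<le> T * (193 * T * Lg * sqrt (real M * weyl_err M))"
    using T weyl_err_ge by (intro mult_left_mono sqrt_const_T_Lg) auto
  also have "\<dots> \<le> T * (193 * T * Lg * (N * Om))" using T Lg sr by (intro mult_left_mono) auto
  also have "\<dots> = 193 * T^2 * Lg * N * Om" by (simp add: power2_eq_square)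
  also have "\<dots> \<le> 193 * T^3 * Lg * N * Om"
    using T Lg N uvw_pos by (intro mult_right_mono mult_left_mono power_increasing) auto
  finally show ?thesis .
next
  case False
  have OmM: "1 \<le> real M * (2 * Om)\<^sup>2"
  proof -
    have "\<exists>t\<in>{u, v, w}. 1 \<le> real M * t\<^sup>2" using False by auto
    then obtain t where t: "1 \<le> real M * t\<^sup>2" "0 \<le> t" "t \<le> Om" using uvw_pos uvw_le_Om by auto
    note t(1)
    also have "real M * t\<^sup>2 \<le> real M * (2 * Om)\<^sup>2" using t uvw_pos by (intro mult_left_mono power_mono) auto
    finally show ?thesis .
  qed
  \<comment> \<open>\<open>bilinear_block\<close> asks for first coefficients bounded by 1, so c is
    divided by T and the factor restored afterwards.\<close>
  have "(\<Sum>m\<in>{M..<2*M}. \<Sum>l=1..nat \<lfloor>N / real M\<rfloor>. if real (m * l) \<le> N then c m * \<psi> l * F (m * l) else 0) =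
    of_real T * (\<Sum>m\<in>{M..<2*M}. \<Sum>l=1..nat \<lfloor>N / real M\<rfloor>. if real (m * l) \<le> N then (c m / of_real T) * \<psi> l * F (m * l) else 0)"
    unfolding sum_distrib_left using T by (intro sum.cong refl) auto
  also have "norm \<dots> \<le> T * (10 * T\<^sup>2 * Lg * N * Om)"
    unfolding norm_mult using T c \<psi>
    by (intro mult_mono bilinear_block[OF M OmM])
       (auto simp: norm_divide divide_le_eq_1 intro: order_trans[OF \<psi>(1)] order_trans[OF c])
  also have "\<dots> = 10 * (T^3 * Lg * N * Om)" by (simp add: power3_eq_cube power2_eq_square)
  also have "\<dots> \<le> 193 * (T^3 * Lg * N * Om)" using T Lg N uvw_pos by (intro mult_right_mono) auto
  finally show ?thesis by (simp add: mult_ac)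
qed

text \<open>The support lies below N^(1/2). As 2 >= e^(1/2), the power of 2 with exponent floor (ln
  N) + 1 already exceeds N^(1/2), so at most 1 + ln N = \<open>Lg\<close> blocks occur.\<close>

lemma norm_sum_dyadic_le:
  fixes f :: "nat \<Rightarrow> complex"
  assumes f: "\<And>m. f m \<noteq> 0 \<Longrightarrow> real m * w ^ 4 \<le> 1"
    and B: "\<And>M. 1 \<le> M \<Longrightarrow> real M * w ^ 4 \<le> 1 \<Longrightarrow> norm (\<Sum>m\<in>{M..<2*M}. f m) \<le> B"
  shows "norm (\<Sum>m=1..X. f m) \<le> Lg * B"
proof -
  define I where "I = nat \<lfloor>ln N\<rfloor>"
  have lnN: "ln N \<ge> 0" using N by simp
  have I: "real I \<le> ln N" "ln N < real I + 1" using lnN by (auto simp: I_def)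
  have B0: "B \<ge> 0"
  proof -
    have "norm (\<Sum>m\<in>{1..<2*1}. f m) \<le> B" by (rule B) (use w_le_1 uvw_pos in \<open>auto intro: power_le_one\<close>)
    thus ?thesis using norm_ge_zero order_trans by blast
  qed
  have w4: "w ^ 4 = N powr (-1/2)" unfolding w_def using N by (simp add: powr_power)
  have big: "1 < real (2 ^ (Suc I)) * w ^ 4"
  proof -
    have "exp (1/2::real) \<le> 2"
    proof -
      have "(exp (1/2::real))\<^sup>2 \<le> 2\<^sup>2" using exp_le by (simp add: power2_eq_square flip: exp_add)
      thus ?thesis by (rule power2_le_imp_le) simp
    qed
    hence "exp (1/2) ^ Suc I \<le> (2::real) ^ Suc I" by (intro power_mono) auto
    hence "exp (real (Suc I) * (1/2)) \<le> (2::real) ^ Suc I" by (simp only: exp_of_nat_mult)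
    hence "exp (real (Suc I) * (1/2)) \<le> real (2 ^ Suc I)" by (simp only: of_nat_power of_nat_numeral)
    moreover have "exp (ln N * (1/2)) < exp (real (Suc I) * (1/2))" using I by simp
    ultimately have lt: "exp (ln N * (1/2)) < real (2 ^ Suc I)" by (rule less_le_trans[rotated])
    have "1 = exp (ln N * (1/2)) * w ^ 4" unfolding w4 using N by (simp add: powr_def flip: exp_add)
    also have "\<dots> < real (2 ^ Suc I) * w ^ 4" using lt uvw_pos by (intro mult_strict_right_mono) auto
    finally show ?thesis .
  qed
  have supp: "f m = 0" if "m \<ge> 2 ^ Suc I" for m
  proof (rule ccontr)
    assume "f m \<noteq> 0"
    hence "real m * w ^ 4 \<le> 1" by (rule f)
    moreover have "real (2 ^ Suc I) \<le> real m" using that by (simp only: of_nat_le_iff)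
    hence "real (2 ^ Suc I) * w ^ 4 \<le> real m * w ^ 4" by (rule mult_right_mono) simp
    ultimately show False using big by linarith
  qed
  have supp': "m \<le> X" if "f m \<noteq> 0" for m using f[OF that] le_N_if_w4 unfolding X by blast
  have "(\<Sum>m=1..X. f m) = (\<Sum>m\<in>{1..X} \<inter> {1..<2^Suc I}. f m)"
    by (rule sum.mono_neutral_right) (use supp in \<open>auto simp: not_less\<close>)
  also have "\<dots> = (\<Sum>m=1..<2^Suc I. f m)"
    by (rule sum.mono_neutral_left) (auto dest: supp')
  also have "\<dots> = (\<Sum>i<Suc I. \<Sum>m\<in>{2^i..<2*2^i}. f m)" by (rule sum_dyadic_blocks)
  also have "norm \<dots> \<le> (\<Sum>i<Suc I. B)"
  proof (rule sum_norm_le)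
    fix i assume "i \<in> {..<Suc I}"
    show "norm (\<Sum>m\<in>{2^i..<2*2^i}. f m) \<le> B"
    proof (cases "real (2^i) * w ^ 4 \<le> 1")
      case True thus ?thesis by (intro B) auto
    next
      case False
      have "f m = 0" if "m \<in> {2^i..<2*2^i}" for m
      proof (rule ccontr)
        assume "f m \<noteq> 0"
        hence "real m * w ^ 4 \<le> 1" by (rule f)
        moreover have "real (2 ^ i) \<le> real m" using that by (simp only: of_nat_le_iff atLeastLessThan_iff)
        hence "real (2 ^ i) * w ^ 4 \<le> real m * w ^ 4" by (rule mult_right_mono) simp
        ultimately show False using False by linarith
      qed
      thus ?thesis using B0 by simp
    qed
  qed
  also have "\<dots> = (real I + 1) * B" by (simp add: algebra_simps)
  also have "\<dots> \<le> Lg * B" using I B0 by (intro mult_right_mono) (auto simp: Lg_def)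
  finally show ?thesis .
qed

lemma inner_sum_restrict:
  assumes "1 \<le> M" "M \<le> m"
  shows "(\<Sum>k=1..X. if m * k \<le> X then h k else 0) = (\<Sum>k=1..nat \<lfloor>N / real M\<rfloor>. if real (m * k) \<le> N then h k else (0::complex))"
proof -
  have bd: "k \<le> X \<and> k \<le> nat \<lfloor>N / real M\<rfloor>" if "m * k \<le> X" for k
  proof -
    have "k * 1 \<le> k * m" using assms by (intro mult_le_mono) auto
    hence "k \<le> m * k" by (simp add: mult.commute)
    moreover have "real k * real M \<le> real k * real m" using assms by (intro mult_left_mono) auto
    hence "real k * real M \<le> N" using that unfolding X by (simp add: mult.commute)
    hence "real k \<le> N / real M" using assms by (simp add: field_simps)
    hence "k \<le> nat \<lfloor>N / real M\<rfloor>" by linarith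
    ultimately show ?thesis using that by linarith
  qed
  hence "(\<Sum>k=1..X. if m * k \<le> X then h k else 0) = (\<Sum>k\<in>{1..X} \<inter> {1..nat \<lfloor>N / real M\<rfloor>}. if m * k \<le> X then h k else 0)"
    by (intro sum.mono_neutral_right) auto
  also have "\<dots> = (\<Sum>k=1..nat \<lfloor>N / real M\<rfloor>. if m * k \<le> X then h k else 0)"
    using bd by (intro sum.mono_neutral_left) auto
  finally show ?thesis unfolding X .
qed

lemma bilinear_sum:
  fixes A c :: "nat \<Rightarrow> complex"
  assumes A: "\<And>m. norm (A m) \<le> 1" "\<And>m. A m \<noteq> 0 \<Longrightarrow> 1 \<le> real m * w\<^sup>2 \<and> real m * w ^ 4 \<le> 1"
    and c: "\<And>k. norm (c k) \<le> T"
  shows "norm (\<Sum>m=1..X. \<Sum>k=1..X. if m * k \<le> X then A m * c k * F (m * k) else 0) \<le> 10 * T\<^sup>2 * Lg\<^sup>2 * N * Om"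
proof -
  have "norm (\<Sum>m=1..X. \<Sum>k=1..X. if m * k \<le> X then A m * c k * F (m * k) else 0) \<le> Lg * (10 * T\<^sup>2 * Lg * N * Om)"
  proof (rule norm_sum_dyadic_le)
    fix m assume "(\<Sum>k=1..X. if m * k \<le> X then A m * c k * F (m * k) else 0) \<noteq> 0"
    hence "A m \<noteq> 0" by (cases "A m = 0") (simp_all cong: if_cong)
    thus "real m * w ^ 4 \<le> 1" using A by blast
  next
    fix M assume M: "1 \<le> M" "real M * w ^ 4 \<le> 1"
    have eq: "(\<Sum>m\<in>{M..<2*M}. \<Sum>k=1..X. if m * k \<le> X then A m * c k * F (m * k) else 0) =
      (\<Sum>m\<in>{M..<2*M}. \<Sum>k=1..nat \<lfloor>N / real M\<rfloor>. if real (m * k) \<le> N then A m * c k * F (m * k) else 0)"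
      using M by (intro sum.cong refl inner_sum_restrict) auto
    show "norm (\<Sum>m\<in>{M..<2*M}. \<Sum>k=1..X. if m * k \<le> X then A m * c k * F (m * k) else 0) \<le> 10 * T\<^sup>2 * Lg * N * Om"
    proof (cases "\<exists>m\<in>{M..<2*M}. A m \<noteq> 0")
      \<comment> \<open>A single nonzero coefficient in the block shows that M is at least about
        N^(1/4), which is the lower limit that \<open>bilinear_block\<close> requires.\<close>
      case True
      then obtain m where m: "m \<in> {M..<2*M}" "1 \<le> real m * w\<^sup>2" using A by blast
      note m(2)
      also have "real m * w\<^sup>2 \<le> real M * (2 * w)\<^sup>2"
      proof -
        have "m \<le> M * 4" using m(1) by auto
        hence "real m \<le> real (M * 4)" by (simp only: of_nat_le_iff)
        hence "real m \<le> real M * 4" by simp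
        hence "real m * w\<^sup>2 \<le> (real M * 4) * w\<^sup>2" by (rule mult_right_mono) auto
        thus ?thesis by (simp add: power_mult_distrib)
      qed
      also have "\<dots> \<le> real M * (2 * Om)\<^sup>2" using uvw_le_Om uvw_pos by (intro mult_left_mono power_mono) auto
      finally show ?thesis unfolding eq by (intro bilinear_block M A c)
    next
      case False
      hence "(\<Sum>m\<in>{M..<2*M}. \<Sum>k=1..X. if m * k \<le> X then A m * c k * F (m * k) else 0) = 0"
        by (intro sum.neutral ballI) auto
      thus ?thesis using T Lg N uvw_pos by simp
    qed
  qed
  also have "\<dots> = 10 * T\<^sup>2 * Lg\<^sup>2 * N * Om" by (simp add: power2_eq_square)
  finally show ?thesis .
qed

lemma smooth_sum:
  fixes c \<psi> :: "nat \<Rightarrow> complex"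
  assumes \<psi>: "\<And>n. norm (\<psi> n) \<le> 1" "\<psi> 0 = 0" "\<And>n. \<psi> (n + 4) = \<psi> n"
    and c: "\<And>m. norm (c m) \<le> T" "\<And>m. c m \<noteq> 0 \<Longrightarrow> real m * w ^ 4 \<le> 1"
  shows "norm (\<Sum>m=1..X. \<Sum>l=1..X. if m * l \<le> X then c m * \<psi> l * F (m * l) else 0) \<le> 193 * T^3 * Lg\<^sup>2 * N * Om"
proof -
  have "norm (\<Sum>m=1..X. \<Sum>l=1..X. if m * l \<le> X then c m * \<psi> l * F (m * l) else 0) \<le> Lg * (193 * T^3 * Lg * N * Om)"
  proof (rule norm_sum_dyadic_le)
    fix m assume "(\<Sum>l=1..X. if m * l \<le> X then c m * \<psi> l * F (m * l) else 0) \<noteq> 0"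
    hence "c m \<noteq> 0" by (cases "c m = 0") (simp_all cong: if_cong)
    thus "real m * w ^ 4 \<le> 1" using c by blast
  next
    fix M assume M: "1 \<le> M" "real M * w ^ 4 \<le> 1"
    have eq: "(\<Sum>m\<in>{M..<2*M}. \<Sum>k=1..X. if m * k \<le> X then c m * \<psi> k * F (m * k) else 0) =
      (\<Sum>m\<in>{M..<2*M}. \<Sum>k=1..nat \<lfloor>N / real M\<rfloor>. if real (m * k) \<le> N then c m * \<psi> k * F (m * k) else 0)"
      using M by (intro sum.cong refl inner_sum_restrict) auto
    show "norm (\<Sum>m\<in>{M..<2*M}. \<Sum>l=1..X. if m * l \<le> X then c m * \<psi> l * F (m * l) else 0) \<le> 193 * T^3 * Lg * N * Om"
      unfolding eq by (intro smooth_or_bilinear_block M \<psi> c(1))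
  qed
  also have "\<dots> = 193 * T^3 * Lg\<^sup>2 * N * Om" by (simp add: power2_eq_square)
  finally show ?thesis .
qed

end

section \<open>Separation of variables\<close>

lemma sum_add_char_orthogonality:
  fixes Q :: nat and t :: int
  assumes "\<bar>t\<bar> < int Q"
  shows "(\<Sum>h=1..Q. add_char (real h * (of_int t / real Q))) = (if t = 0 then of_nat Q else 0)"
proof (cases "t = 0")
  case True
  have "add_char 0 = 1" using add_char_int[of 0] by simp
  thus ?thesis using True by simp
next
  case False
  have Q0: "real Q > 0" using assms by (cases Q) auto
  define x where "x = of_int t / real Q"
  have x: "\<bar>x\<bar> < 1" "x \<noteq> 0"
  proof -
    have "\<bar>real_of_int t\<bar> < real Q" using assms by linarith
    thus "\<bar>x\<bar> < 1" using Q0 by (simp add: x_def)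
    show "x \<noteq> 0" using False Q0 by (simp add: x_def)
  qed
  have ne: "add_char x \<noteq> 1"
  proof
    assume "add_char x = 1"
    hence "int_dist x = 0" using norm_add_char_minus_1_ge[of x] int_dist_range[of x] by simp
    then obtain m where "x = of_int m" using int_dist_attained[of x] by auto
    thus False using x by auto
  qed
  have "(\<Sum>h=1..Q. add_char (real h * x)) = (\<Sum>h<Q. add_char x * add_char x ^ h)"
    by (rule sum.reindex_bij_witness[of _ Suc "\<lambda>h. h - 1"]) (auto simp: add_char_of_nat_mult simp flip: power_Suc)
  also have "\<dots> = add_char x * ((add_char x ^ Q - 1) / (add_char x - 1))"
    using ne by (simp add: sum_distrib_left[symmetric] geometric_sum)
  also have "add_char x ^ Q = add_char (real Q * x)" by (simp add: add_char_of_nat_mult)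
  also have "real Q * x = of_int t" using Q0 by (simp add: x_def)
  finally show ?thesis using False by (simp add: add_char_int x_def)
qed

text \<open>The Fourier coefficients of the indicator function of {0..<L} modulo 2L. With modulus 2L
  the integers y - x - s, for x, y, s < L, lie strictly between -2L and 2L and are never -2L or 2L,
  but may wrap only if divisible by 2L, that is, if zero.\<close>

definition order_weight :: "nat \<Rightarrow> nat \<Rightarrow> complex" where
  "order_weight L h = (\<Sum>s<L. add_char (- (real h * (real s / real (2 * L))))) / of_nat (2 * L)"

text \<open>The condition \<open>x \<le> y\<close> is expanded into additive characters modulo \<open>2L\<close>, which separates
  the two variables.\<close>

lemma order_indicator_expansion:
  assumes "x < L" "y < L"
  shows "(\<Sum>h=1..2*L. order_weight L h * (add_char (- (real h * (real x / real (2*L)))) * add_char (real h * (real y / real (2*L)))))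
     = (if x \<le> y then 1 else 0)"
proof -
  have L: "L > 0" using assms by simp
  have "(\<Sum>h=1..2*L. order_weight L h * (add_char (- (real h * (real x / real (2*L)))) * add_char (real h * (real y / real (2*L)))))
    = (\<Sum>h=1..2*L. \<Sum>s<L. add_char (real h * (of_int (int y - int x - int s) / real (2*L))) / of_nat (2*L))"
    unfolding order_weight_def sum_divide_distrib sum_distrib_right
  proof (intro sum.cong refl)
    fix h s
    have "real h * (of_int (int y - int x - int s) / real (2*L)) =
       - (real h * (real s / real (2 * L))) + (- (real h * (real x / real (2*L))) + real h * (real y / real (2*L)))"
      using L by (simp add: field_simps)
    thus "add_char (- (real h * (real s / real (2 * L)))) / of_nat (2 * L) *
      (add_char (- (real h * (real x / real (2*L)))) * add_char (real h * (real y / real (2*L)))) =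
      add_char (real h * (of_int (int y - int x - int s) / real (2*L))) / of_nat (2*L)"
      by (simp only: add_char_add) simp
  qed
  also have "\<dots> = (\<Sum>s<L. (\<Sum>h=1..2*L. add_char (real h * (of_int (int y - int x - int s) / real (2*L)))) / of_nat (2*L))"
    unfolding sum_divide_distrib by (rule sum.swap)
  also have "\<dots> = (\<Sum>s<L. (if int y - int x - int s = 0 then of_nat (2*L) else 0) / of_nat (2*L))"
    by (intro sum.cong refl arg_cong2[of _ _ _ _ "(/)"] sum_add_char_orthogonality) (use assms in auto)
  also have "\<dots> = (\<Sum>s<L. if s = y - x \<and> x \<le> y then 1 else 0)"
    using L by (intro sum.cong refl) auto
  also have "\<dots> = (if x \<le> y then 1 else 0)" using assms by (auto simp: sum.delta)
  finally show ?thesis .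
qed

text \<open>The weights are geometric sums at the multiples of 1/(2L), so
  \<open>sum_geo_bound\<close> applies with a = 1, q = 2L and K = L. Separating variables thus costs
  only a logarithm.\<close>

lemma sum_norm_order_weight_le:
  assumes "L \<ge> 1"
  shows "(\<Sum>h=1..2*L. norm (order_weight L h)) \<le> 15 + 12 * ln (4 * real L)"
proof -
  have L: "real L > 0" using assms by simp
  have "(\<Sum>h=1..2*L. norm (order_weight L h)) \<le> (\<Sum>h=1..2*L. geo_bound (real L) (real h * (1 / real (2*L))) / real (2 * L))"
  proof (rule sum_mono)
    fix h
    have "norm (\<Sum>s<L. add_char (real s * (- (real h * (1 / real (2*L)))))) \<le> geo_bound (real L) (- (real h * (1 / real (2*L))))"
      by (rule norm_sum_add_char_le) simp
    moreover have "(\<Sum>s<L. add_char (real s * (- (real h * (1 / real (2*L)))))) = (\<Sum>s<L. add_char (- (real h * (real s / real (2 * L)))))"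
      by (simp add: mult_ac)
    ultimately show "norm (order_weight L h) \<le> geo_bound (real L) (real h * (1 / real (2*L))) / real (2 * L)"
      using L unfolding order_weight_def norm_divide norm_of_nat geo_bound_minus by (simp add: divide_right_mono)
  qed
  also have "\<dots> = (\<Sum>h=1..2*L. geo_bound (real L) (real h * (1 / real (2*L)))) / real (2 * L)"
    by (simp only: sum_divide_distrib)
  also have "\<dots> \<le> ((2 * real (2*L) / of_int (int (2*L)) + 1) * (2 * real L + 4 * of_int (int (2*L)) * (1 + ln (2 * of_int (int (2*L)))))) / real (2*L)"
    by (intro divide_right_mono sum_geo_bound[where a = 1]) (use assms in auto)
  also have "\<dots> = 15 + 12 * ln (4 * real L)" using L by (simp add: field_simps)
  finally show ?thesis .
qed

context quadratic_phase begin

text \<open>The hypothesis is uniform in \<theta> because each frequency of the expansion twists the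
  two variables by unimodular factors, which the coefficients of a bilinear form can absorb. The
  constant is 51 = 15 + 36, from 4 (X + 2) <= 8 N and ln 8 <= 3.\<close>

lemma decouple_order:
  fixes G :: "'a \<Rightarrow> complex" and x y :: "'a \<Rightarrow> nat"
  assumes xy: "\<And>i. i \<in> I \<Longrightarrow> x i < X + 2" "\<And>i. i \<in> I \<Longrightarrow> y i < X + 2"
    and B: "\<And>\<theta>. norm (\<Sum>i\<in>I. add_char (- (\<theta> * real (x i))) * add_char (\<theta> * real (y i)) * G i) \<le> B"
  shows "norm (\<Sum>i\<in>I. if x i \<le> y i then G i else 0) \<le> 51 * Lg * B"
proof -
  define L where "L = X + 2"
  define \<Theta> where "\<Theta> = (\<lambda>h::nat. real h / real (2 * L))"
  have B0: "B \<ge> 0" using B[of 0] norm_ge_zero order_trans by blast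
  have "(\<Sum>i\<in>I. if x i \<le> y i then G i else 0) =
     (\<Sum>i\<in>I. (\<Sum>h=1..2*L. order_weight L h * (add_char (- (\<Theta> h * real (x i))) * add_char (\<Theta> h * real (y i)))) * G i)"
  proof (rule sum.cong[OF refl])
    fix i assume i: "i \<in> I"
    have "(\<Sum>h=1..2*L. order_weight L h * (add_char (- (\<Theta> h * real (x i))) * add_char (\<Theta> h * real (y i)))) = (if x i \<le> y i then 1 else 0)"
      using order_indicator_expansion[of "x i" L "y i"] xy[OF i] by (simp add: L_def \<Theta>_def)
    thus "(if x i \<le> y i then G i else 0) = (\<Sum>h=1..2*L. order_weight L h * (add_char (- (\<Theta> h * real (x i))) * add_char (\<Theta> h * real (y i)))) * G i"
      by simp
  qed
  also have "\<dots> = (\<Sum>h=1..2*L. order_weight L h * (\<Sum>i\<in>I. add_char (- (\<Theta> h * real (x i))) * add_char (\<Theta> h * real (y i)) * G i))"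
    unfolding sum_distrib_left sum_distrib_right by (subst sum.swap) (simp add: mult_ac)
  also have "norm \<dots> \<le> (\<Sum>h=1..2*L. norm (order_weight L h) * B)"
    using B by (intro sum_norm_le) (auto simp: norm_mult intro!: mult_left_mono)
  also have "\<dots> = (\<Sum>h=1..2*L. norm (order_weight L h)) * B" by (simp only: sum_distrib_right)
  also have "\<dots> \<le> (51 * Lg) * B"
  proof (rule mult_right_mono[OF _ B0])
    have "(\<Sum>h=1..2*L. norm (order_weight L h)) \<le> 15 + 12 * ln (4 * real L)"
      by (rule sum_norm_order_weight_le) (simp add: L_def)
    also have "4 * real L \<le> 8 * N" using N X[of X] by (simp add: L_def)
    hence "ln (4 * real L) \<le> ln (8 * N)" using N by (intro ln_mono) (auto simp: L_def)
    also have "ln (8 * N) = ln 8 + ln N" using N by (simp add: ln_mult)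
    also have "ln (8::real) = 3 * ln 2" by (simp flip: ln_powr ln_realpow)
    also have "ln (2::real) \<le> 1" using ln_le_minus_one[of "2::real"] by simp
    finally have "(\<Sum>h=1..2*L. norm (order_weight L h)) \<le> 15 + 12 * (3 * 1 + ln N)" by simp
    also have "\<dots> \<le> 51 * Lg" using N by (simp add: Lg_def)
    finally show "(\<Sum>h=1..2*L. norm (order_weight L h)) \<le> 51 * Lg" .
  qed
  finally show ?thesis .
qed

text \<open>Roughness of k is an inequality between x m and the least prime factor of k, so
  \<open>decouple_order\<close> removes it. Afterwards s and k enter only through j = s k, whose
  coefficient is a sum over the divisors of j and hence at most T.\<close>

lemma coupled_bilinear_sum:
  fixes a' g c :: "nat \<Rightarrow> complex" and x :: "nat \<Rightarrow> nat"
  assumes a: "\<And>m. norm (a' m) \<le> 1" "\<And>m. a' m \<noteq> 0 \<Longrightarrow> 1 \<le> real m * w\<^sup>2 \<and> real m * w ^ 4 \<le> 1"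
    and g: "\<And>s. norm (g s) \<le> 1" and c: "\<And>k. norm (c k) \<le> 1"
  shows "norm (\<Sum>m=1..X. \<Sum>s=1..X. \<Sum>k=1..X. if m * (s * k) \<le> X \<and> rough (x m) k then a' m * g s * c k * F (m * (s * k)) else 0)
     \<le> 510 * T\<^sup>2 * Lg^3 * N * Om"
proof -
  \<comment> \<open>The value X + 1 at k = 1 exceeds every least prime factor that occurs, so that 1
    passes every roughness test. Capping x at X + 1 leaves all comparisons unchanged and keeps the
    values below X + 2.\<close>
  define y where "y = (\<lambda>k. if k = 1 then X + 1 else lpf k)"
  define x' where "x' = (\<lambda>m. min (x m) (X + 1))"
  define I where "I = {1..X} \<times> {1..X} \<times> {1..X}"
  define G where "G = (\<lambda>(m,s,k). if m * (s * k) \<le> X then a' m * g s * c k * F (m * (s * k)) else 0)"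
  have lpfX: "lpf k \<le> X" if "k > 1" "k \<le> X" for k using lpf(2)[OF that(1)] that by (auto dest: dvd_imp_le)
  have iff: "rough (x m) k \<longleftrightarrow> x' m \<le> y k" if k: "k \<in> {1..X}" for m k
  proof (cases "k = 1")
    case True thus ?thesis by (simp add: rough_def y_def x'_def)
  next
    case False
    hence k1: "k > 1" using k by auto
    have "rough (x m) k \<longleftrightarrow> x m \<le> lpf k" using lpf[OF k1] unfolding rough_def using order_trans by blast
    thus ?thesis using False lpfX[OF k1] k by (auto simp: y_def x'_def min_def)
  qed
  have "(\<Sum>m=1..X. \<Sum>s=1..X. \<Sum>k=1..X. if m * (s * k) \<le> X \<and> rough (x m) k then a' m * g s * c k * F (m * (s * k)) else 0)
     = (\<Sum>i\<in>I. if x' (fst i) \<le> y (snd (snd i)) then G i else 0)"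
    unfolding I_def sum.cartesian_product'
    by (intro sum.cong refl) (auto simp: G_def iff)
  also have "norm \<dots> \<le> 51 * Lg * (10 * T\<^sup>2 * Lg\<^sup>2 * N * Om)"
  proof (rule decouple_order)
    show "x' (fst i) < X + 2" "y (snd (snd i)) < X + 2" if "i \<in> I" for i
      using that lpfX[of "snd (snd i)"] by (auto simp: I_def x'_def y_def)
    fix \<theta> :: real
    define A where "A = (\<lambda>m. a' m * add_char (- (\<theta> * real (x' m))))"
    define c' where "c' = (\<lambda>k. c k * add_char (\<theta> * real (y k)))"
    \<comment> \<open>Cut off outside {1..X} so that the divisor bound applies wherever
      \<open>C\<close> is nonzero.\<close>
    define C where "C = (\<lambda>j. if j \<in> {1..X} then \<Sum>d | d dvd j. g d * c' (j div d) else 0)"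
    have "(\<Sum>i\<in>I. add_char (- (\<theta> * real (x' (fst i)))) * add_char (\<theta> * real (y (snd (snd i)))) * G i)
      = (\<Sum>m=1..X. \<Sum>s=1..X. \<Sum>k=1..X. if m * (s * k) \<le> X then A m * (g s * c' k) * F (m * (s * k)) else 0)"
      unfolding I_def sum.cartesian_product'
      by (intro sum.cong refl) (auto simp: G_def A_def c'_def)
    also have "\<dots> = (\<Sum>m=1..X. \<Sum>j=1..X. if m * j \<le> X then A m * C j * F (m * j) else 0)"
    proof (rule sum.cong[OF refl])
      fix m assume m: "m \<in> {1..X}"
      have "(\<Sum>s=1..X. \<Sum>k=1..X. if m * (s * k) \<le> X then A m * (g s * c' k) * F (m * (s * k)) else 0)
        = (\<Sum>s=1..X. \<Sum>k=1..X. if s * k \<le> X then (if m * (s * k) \<le> X then A m * (g s * c' k) * F (m * (s * k)) else 0) else 0)"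
      proof (intro sum.cong refl)
        fix s k
        have "s * k \<le> X" if "m * (s * k) \<le> X"
        proof -
          have "1 * (s * k) \<le> m * (s * k)" using m by (intro mult_le_mono1) auto
          thus ?thesis using that by linarith
        qed
        thus "(if m * (s * k) \<le> X then A m * (g s * c' k) * F (m * (s * k)) else 0) =
         (if s * k \<le> X then (if m * (s * k) \<le> X then A m * (g s * c' k) * F (m * (s * k)) else 0) else 0)" by auto
      qed
      also have "\<dots> = (\<Sum>j=1..X. \<Sum>d | d dvd j. if m * (d * (j div d)) \<le> X then A m * (g d * c' (j div d)) * F (m * (d * (j div d))) else 0)"
        by (rule sum_over_factorizations[symmetric])
      also have "\<dots> = (\<Sum>j=1..X. if m * j \<le> X then A m * C j * F (m * j) else 0)"
      proof (rule sum.cong[OF refl])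
        fix j assume j: "j \<in> {1..X}"
        have "(\<Sum>d | d dvd j. if m * (d * (j div d)) \<le> X then A m * (g d * c' (j div d)) * F (m * (d * (j div d))) else 0)
           = (\<Sum>d | d dvd j. if m * j \<le> X then A m * (g d * c' (j div d)) * F (m * j) else 0)"
          by (intro sum.cong refl) auto
        also have "\<dots> = (if m * j \<le> X then A m * C j * F (m * j) else 0)"
          using j by (auto simp: C_def sum_distrib_left sum_distrib_right)
        finally show "(\<Sum>d | d dvd j. if m * (d * (j div d)) \<le> X then A m * (g d * c' (j div d)) * F (m * (d * (j div d))) else 0)
          = (if m * j \<le> X then A m * C j * F (m * j) else 0)" .
      qed
      finally show "(\<Sum>s=1..X. \<Sum>k=1..X. if m * (s * k) \<le> X then A m * (g s * c' k) * F (m * (s * k)) else 0) =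
        (\<Sum>j=1..X. if m * j \<le> X then A m * C j * F (m * j) else 0)" .
    qed
    also have "norm \<dots> \<le> 10 * T\<^sup>2 * Lg\<^sup>2 * N * Om"
    proof (rule bilinear_sum)
      show "norm (A m) \<le> 1" for m using a(1) by (simp add: A_def norm_mult)
      show "1 \<le> real m * w\<^sup>2 \<and> real m * w ^ 4 \<le> 1" if "A m \<noteq> 0" for m using a(2)[of m] that by (auto simp: A_def)
      show "norm (C j) \<le> T" for j
      proof (cases "j \<in> {1..X}")
        case True
        have "norm (C j) \<le> (\<Sum>d | d dvd j. 1)" unfolding C_def using True
        proof (simp only: if_True, intro sum_norm_le)
          fix d
          have "norm (g d) * norm (c (j div d)) \<le> 1 * 1" using g c by (intro mult_mono) auto
          thus "norm (g d * c' (j div d)) \<le> 1" by (simp add: c'_def norm_mult)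
        qed
        also have "\<dots> = real (card {d. d dvd j})" by simp
        also have "\<dots> \<le> T"
        proof (rule divisors)
          have "real j \<le> N" using True X by auto
          also have "N * 1 \<le> N * N" using N by (intro mult_left_mono) auto
          finally show "real j \<le> 128 * N\<^sup>2" using N by (simp add: power2_eq_square)
        qed (use True in auto)
        finally show ?thesis .
      qed (use T in \<open>auto simp: C_def\<close>)
    qed
    finally show "norm (\<Sum>i\<in>I. add_char (- (\<theta> * real (x' (fst i)))) * add_char (\<theta> * real (y (snd (snd i)))) * G i)
      \<le> 10 * T\<^sup>2 * Lg\<^sup>2 * N * Om" .
  qed
  also have "\<dots> = 510 * T\<^sup>2 * Lg^3 * N * Om" by (simp add: power3_eq_cube power2_eq_square)
  finally show ?thesis .
qed

end

section \<open>Decomposition of the sum\<close>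

lemma sum_divisors_of_second_factor:
  fixes G :: "nat \<Rightarrow> nat \<Rightarrow> nat \<Rightarrow> 'a :: comm_monoid_add"
  shows "(\<Sum>s=1..X. \<Sum>t=1..X. if s * t \<le> X then \<Sum>d | d dvd t. G d s (t div d) else 0)
       = (\<Sum>d=1..X. \<Sum>s=1..X. \<Sum>k=1..X. if d * (s * k) \<le> X then G d s k else 0)"
proof -
  have "(\<Sum>t=1..X. if s * t \<le> X then \<Sum>d | d dvd t. G d s (t div d) else 0)
     = (\<Sum>d=1..X. \<Sum>k=1..X. if d * (s * k) \<le> X then G d s k else 0)" if s: "s \<in> {1..X}" for s
  proof -
    have "(\<Sum>t=1..X. if s * t \<le> X then \<Sum>d | d dvd t. G d s (t div d) else 0)
       = (\<Sum>t=1..X. \<Sum>d | d dvd t. if s * (d * (t div d)) \<le> X then G d s (t div d) else 0)"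
      by (rule sum.cong[OF refl]) auto
    also have "\<dots> = (\<Sum>d=1..X. \<Sum>k=1..X. if d * k \<le> X then (if s * (d * k) \<le> X then G d s k else 0) else 0)"
      by (rule sum_over_factorizations)
    also have "\<dots> = (\<Sum>d=1..X. \<Sum>k=1..X. if d * (s * k) \<le> X then G d s k else 0)"
    proof (intro sum.cong refl)
      fix d k
      have eq: "s * (d * k) = d * (s * k)" by (rule mult.left_commute)
      have "1 * (d * k) \<le> s * (d * k)" using s by (intro mult_le_mono1) auto
      hence "d * (s * k) \<le> X \<Longrightarrow> d * k \<le> X" unfolding eq by linarith
      thus "(if d * k \<le> X then (if s * (d * k) \<le> X then G d s k else 0) else 0) = (if d * (s * k) \<le> X then G d s k else 0)"
        unfolding eq by auto
    qed
    finally show ?thesis .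
  qed
  hence "(\<Sum>s=1..X. \<Sum>t=1..X. if s * t \<le> X then \<Sum>d | d dvd t. G d s (t div d) else 0)
     = (\<Sum>s=1..X. \<Sum>d=1..X. \<Sum>k=1..X. if d * (s * k) \<le> X then G d s k else 0)" by (rule sum.cong[OF refl])
  also have "\<dots> = (\<Sum>d=1..X. \<Sum>s=1..X. \<Sum>k=1..X. if d * (s * k) \<le> X then G d s k else 0)" by (rule sum.swap)
  finally show ?thesis .
qed

lemma sum_if_const_card:
  fixes c :: complex
  assumes "finite A"
  shows "(\<Sum>x\<in>A. if P x then c else 0) = of_nat (card {x \<in> A. P x}) * c"
  using assms by (simp add: sum.If_cases Int_def)

section \<open>The two characters modulo 4 and the reduction to primes\<close>

definition chi0 :: "nat \<Rightarrow> complex" where "chi0 n = (if odd n then 1 else 0)"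

definition chi4 :: "nat \<Rightarrow> complex" where
  "chi4 n = (if n mod 4 = 1 then 1 else if n mod 4 = 3 then - 1 else 0)"

lemma chi4_mult: "chi4 (m * n) = chi4 m * chi4 n"
proof -
  have "m mod 4 \<in> {0,1,2,3}" "n mod 4 \<in> {0,1,2,3}" by auto
  moreover have "(m * n) mod 4 = ((m mod 4) * (n mod 4)) mod 4" by (simp add: mod_mult_eq)
  ultimately show ?thesis unfolding chi4_def by auto
qed

lemma b_prime_eq_characters: "prime p \<Longrightarrow> b p = (chi0 p + chi4 p) / 2"
proof -
  assume p: "prime p"
  have "p mod 4 \<in> {0,1,2,3}" by auto
  moreover have "odd p \<longleftrightarrow> p mod 4 = 1 \<or> p mod 4 = 3" by presburger
  ultimately show ?thesis unfolding b_prime[OF p] chi0_def chi4_def by auto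
qed

context quadratic_phase begin

definition z :: real where "z = 1 / w\<^sup>2"

lemma z: "z > 1" "z ^ 4 = N" "z \<le> N * Om"
proof -
  have "N powr (- 1/8) < N powr 0" using N by (intro powr_less_mono) auto
  hence w1: "w < 1" using N by (simp add: w_def)
  hence "w\<^sup>2 < 1" using uvw_pos by (simp add: power_less_one_iff)
  thus "z > 1" using uvw_pos by (simp add: z_def)
  have "z ^ 4 = 1 / w ^ 8" by (simp add: z_def power_divide flip: power_mult)
  thus "z ^ 4 = N" using w8 N by simp
  have "z = N * w ^ 6"
  proof -
    have "N * w ^ 6 = N * (w ^ 8 / w\<^sup>2)" using uvw_pos by (simp add: power_eq_if)
    thus ?thesis unfolding w8 using N by (simp add: z_def)
  qed
  also have "\<dots> \<le> N * w ^ 1" using uvw_pos w_le_1 N by (intro mult_left_mono power_decreasing) auto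
  also have "\<dots> \<le> N * Om" using uvw_le_Om N by simp
  finally show "z \<le> N * Om" .
qed

lemma z_iff: "1 \<le> real m * w\<^sup>2 \<longleftrightarrow> z \<le> real m" "real m * w ^ 4 \<le> 1 \<longleftrightarrow> real m \<le> z\<^sup>2"
proof -
  show "1 \<le> real m * w\<^sup>2 \<longleftrightarrow> z \<le> real m" using uvw_pos by (simp add: z_def field_simps)
  have "z\<^sup>2 = 1 / w ^ 4" by (simp add: z_def power_divide flip: power_mult)
  thus "real m * w ^ 4 \<le> 1 \<longleftrightarrow> real m \<le> z\<^sup>2" using uvw_pos by (simp add: pos_le_divide_eq)
qed

definition BT :: real where "BT = 510 * T\<^sup>2 * Lg^3 * N * Om"

definition short :: "nat \<Rightarrow> complex" where "short s = (if real s < z then b s else 0)"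

lemma norm_short: "norm (short s) \<le> 1"
  by (simp add: short_def norm_b_le)

definition large_prime :: "nat \<Rightarrow> bool" where "large_prime p \<longleftrightarrow> prime p \<and> z \<le> real p"

text \<open>Terms n = p s k with s < z, p >= z prime and every prime factor of k at least p. This
  shape arises twice: for f = b from the prefixes sp that jump past z, and for a character from
  cutting the least prime off a number without prime factors below z. \<open>J1\<close> is the part
  k = 1.\<close>

definition J :: "(nat \<Rightarrow> complex) \<Rightarrow> complex" where
  "J f = (\<Sum>p=1..X. \<Sum>s=1..X. \<Sum>k=1..X.
     if p * (s * k) \<le> X then (if large_prime p \<and> rough p k then short s * f p * f k * F (p * (s * k)) else 0) else 0)"

definition J1 :: "(nat \<Rightarrow> complex) \<Rightarrow> complex" where
  "J1 f = (\<Sum>p=1..X. \<Sum>s=1..X. if p * s \<le> X \<and> large_prime p then short s * f p * F (p * s) else 0)"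

text \<open>If k > 1, then k has a prime factor of at least p, so p^2 <= N and p lies between z and
  z^2, the range of the bilinear bound.\<close>

lemma norm_J_diff_J1:
  assumes f: "\<And>n. norm (f n) \<le> 1" "f 1 = 1"
  shows "norm (J f - J1 f) \<le> BT"
proof -
  define a' where "a' = (\<lambda>p. if large_prime p \<and> real p \<le> z\<^sup>2 then f p else 0)"
  define c where "c = (\<lambda>k. if k > 1 then f k else 0)"
  let ?G = "\<lambda>p s k. if p * (s * k) \<le> X then (if large_prime p \<and> rough p k then short s * f p * f k * F (p * (s * k)) else 0) else 0"
  have "(\<Sum>k=1..X. ?G p s k) = (if p * s \<le> X \<and> large_prime p then short s * f p * F (p * s) else 0)
     + (\<Sum>k=1..X. if p * (s * k) \<le> X \<and> rough p k then a' p * short s * c k * F (p * (s * k)) else 0)"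
    if ps: "p \<in> {1..X}" "s \<in> {1..X}" for p s
  proof -
    have "1 \<in> {1..X}" using ps by auto
    hence "(\<Sum>k=1..X. ?G p s k) = ?G p s 1 + (\<Sum>k\<in>{1..X} - {1}. ?G p s k)" by (intro sum.remove) auto
    also have "?G p s 1 = (if p * s \<le> X \<and> large_prime p then short s * f p * F (p * s) else 0)"
      using f(2) by (simp add: rough_def)
    also have "(\<Sum>k\<in>{1..X} - {1}. ?G p s k) = (\<Sum>k=1..X. if p * (s * k) \<le> X \<and> rough p k then a' p * short s * c k * F (p * (s * k)) else 0)"
    proof (rule sum.mono_neutral_cong_left)
      fix k assume k: "k \<in> {1..X} - {1}"
      have "real p \<le> z\<^sup>2" if "p * (s * k) \<le> X" "rough p k"
      proof -
        have k1: "k > 1" using k by auto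
        have "p \<le> lpf k" using that(2) lpf[OF k1] by (auto simp: rough_def)
        also have "lpf k \<le> k" using lpf(2)[OF k1] k1 by (auto dest: dvd_imp_le)
        also have "k \<le> s * k" using ps by simp
        finally have "p * p \<le> p * (s * k)" by (rule mult_le_mono2)
        hence "p * p \<le> X" using that by linarith
        hence "(real p)\<^sup>2 \<le> N" unfolding X by (simp add: power2_eq_square)
        also have "N = (z\<^sup>2)\<^sup>2" using z by (simp flip: power_mult)
        finally show ?thesis by (rule power2_le_imp_le) simp
      qed
      thus "?G p s k = (if p * (s * k) \<le> X \<and> rough p k then a' p * short s * c k * F (p * (s * k)) else 0)"
        using k by (auto simp: a'_def c_def)
    qed (auto simp: c_def)
    finally show ?thesis .
  qed
  hence "J f = (\<Sum>p=1..X. \<Sum>s=1..X. (if p * s \<le> X \<and> large_prime p then short s * f p * F (p * s) else 0)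
     + (\<Sum>k=1..X. if p * (s * k) \<le> X \<and> rough p k then a' p * short s * c k * F (p * (s * k)) else 0))"
    unfolding J_def by (intro sum.cong refl) auto
  also have "\<dots> = J1 f + (\<Sum>p=1..X. \<Sum>s=1..X. \<Sum>k=1..X. if p * (s * k) \<le> X \<and> rough p k then a' p * short s * c k * F (p * (s * k)) else 0)"
    by (simp add: J1_def sum.distrib)
  finally have "J f - J1 f = (\<Sum>p=1..X. \<Sum>s=1..X. \<Sum>k=1..X. if p * (s * k) \<le> X \<and> rough p k then a' p * short s * c k * F (p * (s * k)) else 0)"
    by simp
  also have "norm \<dots> \<le> BT" unfolding BT_def
    by (rule coupled_bilinear_sum[where x = "\<lambda>p. p"])
       (auto simp: a'_def c_def f norm_short z_iff large_prime_def split: if_splits)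
  finally show ?thesis .
qed

text \<open>The analogue of \<open>J1\<close> with primes p replaced by all t free of primes below
  z, t = 1 included; this is the set the sieve detects.\<close>

definition R :: "(nat \<Rightarrow> complex) \<Rightarrow> complex" where
  "R \<psi> = (\<Sum>s=1..X. \<Sum>t=1..X. if s * t \<le> X then
      (if \<forall>p. prime p \<longrightarrow> p dvd t \<longrightarrow> z \<le> real p then short s * \<psi> t * F (s * t) else 0) else 0)"

lemma norm_sum_short_le: "norm (\<Sum>n=1..X. short n * F n) \<le> z"
proof -
  have "norm (\<Sum>n=1..X. short n * F n) \<le> (\<Sum>n=1..X. if real n < z then 1 else 0)"
    by (rule sum_norm_le) (auto simp: norm_mult short_def norm_b_le)
  also have "\<dots> = real (card {n \<in> {1..X}. real n < z})" by (simp add: sum.If_cases Int_def)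
  also have "\<dots> \<le> real (card {1..nat \<lfloor>z\<rfloor>})"
  proof -
    have "{n \<in> {1..X}. real n < z} \<subseteq> {1..nat \<lfloor>z\<rfloor>}" using z(1) by (auto simp: le_nat_floor_iff)
    hence "card {n \<in> {1..X}. real n < z} \<le> card {1..nat \<lfloor>z\<rfloor>}" by (intro card_mono) auto
    thus ?thesis by (simp only: of_nat_le_iff)
  qed
  also have "\<dots> \<le> z" using z(1) by simp
  finally show ?thesis .
qed

text \<open>For t > 1 the least prime factor p of t is split off, and multiplicativity separates
  \<psi> p from \<psi> (t / p). The term t = 1 gives the short sum.\<close>

lemma R_eq:
  assumes mult: "\<And>m n. \<psi> (m * n) = \<psi> m * \<psi> n" and one: "\<psi> 1 = 1"
  shows "R \<psi> = (\<Sum>n=1..X. short n * F n) + J \<psi>"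
proof -
  have key: "(if \<forall>p. prime p \<longrightarrow> p dvd t \<longrightarrow> z \<le> real p then short s * \<psi> t * F (s * t) else 0)
     = (if t = 1 then short s * F s else 0)
     + (\<Sum>p | p dvd t. if large_prime p \<and> rough p (t div p) then short s * \<psi> p * \<psi> (t div p) * F (p * (s * (t div p))) else 0)"
    (is "?L = ?A + ?B") if t: "t \<in> {1..X}" for s t
  proof -
    have "?B = (\<Sum>p | p dvd t. if large_prime p \<and> rough p (t div p) then short s * \<psi> t * F (s * t) else 0)"
    proof (rule sum.cong[OF refl])
      fix p assume "p \<in> {p. p dvd t}"
      hence "t = p * (t div p)" by simp
      hence "\<psi> t = \<psi> p * \<psi> (t div p)" "s * t = p * (s * (t div p))" using mult by (metis, metis mult.left_commute)
      thus "(if large_prime p \<and> rough p (t div p) then short s * \<psi> p * \<psi> (t div p) * F (p * (s * (t div p))) else 0)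
        = (if large_prime p \<and> rough p (t div p) then short s * \<psi> t * F (s * t) else 0)" by (simp only: mult.assoc)
    qed
    also have "\<dots> = of_nat (card {p \<in> {p. p dvd t}. large_prime p \<and> rough p (t div p)}) * (short s * \<psi> t * F (s * t))"
      using t by (intro sum_if_const_card) (simp add: finite_divisors_nat)
    also have "{p \<in> {p. p dvd t}. large_prime p \<and> rough p (t div p)} = {p \<in> {p. p dvd t \<and> prime p \<and> rough p (t div p)}. z \<le> real p}"
      by (auto simp: large_prime_def)
    also have "\<dots> = (if t \<noteq> 1 \<and> z \<le> real (lpf t) then {lpf t} else {})"
      using t by (subst card_least_prime_factor) auto
    finally have B: "?B = (if t \<noteq> 1 \<and> z \<le> real (lpf t) then short s * \<psi> t * F (s * t) else 0)" by simp
    show ?thesis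
    proof (cases "t = 1")
      case True thus ?thesis unfolding B using one by auto
    next
      case False
      hence t1: "t > 1" using t by auto
      have "(\<forall>p. prime p \<longrightarrow> p dvd t \<longrightarrow> z \<le> real p) \<longleftrightarrow> z \<le> real (lpf t)"
        using lpf[OF t1] unfolding rough_def by (meson of_nat_le_iff order_trans)
      thus ?thesis unfolding B using False by simp
    qed
  qed
  have "R \<psi> = (\<Sum>s=1..X. \<Sum>t=1..X. if s * t \<le> X then (if t = 1 then short s * F s else 0)
     + (\<Sum>p | p dvd t. if large_prime p \<and> rough p (t div p) then short s * \<psi> p * \<psi> (t div p) * F (p * (s * (t div p))) else 0) else 0)"
    unfolding R_def by (intro sum.cong refl if_cong key)
  also have "\<dots> = (\<Sum>s=1..X. \<Sum>t=1..X. (if s * t \<le> X then (if t = 1 then short s * F s else 0) else 0)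
     + (if s * t \<le> X then \<Sum>p | p dvd t. if large_prime p \<and> rough p (t div p) then short s * \<psi> p * \<psi> (t div p) * F (p * (s * (t div p))) else 0 else 0))"
    by (intro sum.cong refl) auto
  also have "\<dots> = (\<Sum>s=1..X. \<Sum>t=1..X. if s * t \<le> X then (if t = 1 then short s * F s else 0) else 0)
     + (\<Sum>s=1..X. \<Sum>t=1..X. if s * t \<le> X then \<Sum>p | p dvd t. if large_prime p \<and> rough p (t div p) then short s * \<psi> p * \<psi> (t div p) * F (p * (s * (t div p))) else 0 else 0)"
    by (simp only: sum.distrib)
  also have "(\<Sum>s=1..X. \<Sum>t=1..X. if s * t \<le> X then (if t = 1 then short s * F s else 0) else 0) = (\<Sum>s=1..X. short s * F s)"
  proof (rule sum.cong[OF refl])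
    fix s assume s: "s \<in> {1..X}"
    have "(\<Sum>t=1..X. if s * t \<le> X then (if t = 1 then short s * F s else 0) else 0) = (\<Sum>t=1..X. if t = 1 then short s * F s else 0)"
      using s by (intro sum.cong refl) auto
    also have "\<dots> = short s * F s" using s by (subst sum.delta) auto
    finally show "(\<Sum>t=1..X. if s * t \<le> X then (if t = 1 then short s * F s else 0) else 0) = short s * F s" .
  qed
  also have "(\<Sum>s=1..X. \<Sum>t=1..X. if s * t \<le> X then \<Sum>p | p dvd t. if large_prime p \<and> rough p (t div p) then short s * \<psi> p * \<psi> (t div p) * F (p * (s * (t div p))) else 0 else 0) = J \<psi>"
    unfolding J_def by (rule sum_divisors_of_second_factor)
  finally show ?thesis .
qed

text \<open>The truncated sieve detects the condition on t. For divisors d < z the product m = d s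
  is below z^2 and faces a free variable with weight \<psi>, as in \<open>smooth_sum\<close>. A
  divisor e >= z has lpf e < z and e / lpf e < z, so it lies between z and z^2, and the remaining
  roughness condition is that of \<open>coupled_bilinear_sum\<close>.\<close>

lemma norm_R_le:
  assumes \<psi>: "\<And>n. norm (\<psi> n) \<le> 1" "\<psi> 0 = 0" "\<And>n. \<psi> (n + 4) = \<psi> n" and mult: "\<And>m n. \<psi> (m * n) = \<psi> m * \<psi> n"
  shows "norm (R \<psi>) \<le> 193 * T^3 * Lg\<^sup>2 * N * Om + BT"
proof -
  define \<mu> where "\<mu> = (\<lambda>d. if squarefree d \<and> smooth z d \<and> real d < z then of_int (mu d) * \<psi> d else 0)"
  define a' where "a' = (\<lambda>e. if squarefree e \<and> smooth z e \<and> z \<le> real e \<and> real (e div lpf e) < z then of_int (mu e) * \<psi> e else 0)"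
  define C where "C = (\<lambda>m. if m \<in> {1..X} then \<Sum>d | d dvd m. \<mu> d * short (m div d) else 0)"
  have nmu: "norm (of_int (mu d) :: complex) \<le> 1" for d
  proof -
    have "norm (of_int (mu d) :: complex) = real_of_int \<bar>mu d\<bar>" by (simp add: norm_of_int)
    thus ?thesis using abs_mu_le[of d] by linarith
  qed
  have n1: "norm (of_int (mu d) * \<psi> d) \<le> 1" for d
    using mult_mono[OF nmu[of d] \<psi>(1)[of d]] by (simp add: norm_mult)
  have key: "(if \<forall>p. prime p \<longrightarrow> p dvd t \<longrightarrow> z \<le> real p then short s * \<psi> t * F (s * t) else 0)
     = (\<Sum>d | d dvd t. \<mu> d * short s * \<psi> (t div d) * F (d * (s * (t div d))))
     + (\<Sum>e | e dvd t. if rough (lpf e) (t div e) then a' e * short s * \<psi> (t div e) * F (e * (s * (t div e))) else 0)"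
    (is "?L = ?A + ?B") if t: "t \<in> {1..X}" for s t
  proof -
    have fin: "finite {d. d dvd t}" using t by (simp add: finite_divisors_nat)
    have split: "\<psi> t = \<psi> d * \<psi> (t div d)" "F (d * (s * (t div d))) = F (s * t)" if "d dvd t" for d
    proof -
      have "t = d * (t div d)" using that by simp
      thus "\<psi> t = \<psi> d * \<psi> (t div d)" "F (d * (s * (t div d))) = F (s * t)" using mult by (metis, metis mult.left_commute)
    qed
    have "?A = (\<Sum>d | d dvd t. if squarefree d \<and> smooth z d \<and> real d < z then of_int (mu d) * (short s * \<psi> t * F (s * t)) else 0)"
      by (rule sum.cong[OF refl]) (auto simp: \<mu>_def split)
    also have "\<dots> = (\<Sum>d\<in>{d \<in> {d. d dvd t}. squarefree d \<and> smooth z d \<and> real d < z}. of_int (mu d) * (short s * \<psi> t * F (s * t)))"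
      by (rule sum.inter_filter[OF fin, symmetric])
    also have "\<dots> = of_int (\<Sum>d | d dvd t \<and> squarefree d \<and> smooth z d \<and> real d < z. mu d) * (short s * \<psi> t * F (s * t))"
      by (simp add: sum_distrib_right)
    finally have A: "?A = of_int (\<Sum>d | d dvd t \<and> squarefree d \<and> smooth z d \<and> real d < z. mu d) * (short s * \<psi> t * F (s * t))" .
    have "?B = (\<Sum>e | e dvd t. if squarefree e \<and> smooth z e \<and> z \<le> real e \<and> real (e div lpf e) < z \<and> rough (lpf e) (t div e)
        then of_int (mu e) * (short s * \<psi> t * F (s * t)) else 0)"
      by (rule sum.cong[OF refl]) (auto simp: a'_def split)
    also have "\<dots> = (\<Sum>e\<in>{e \<in> {e. e dvd t}. squarefree e \<and> smooth z e \<and> z \<le> real e \<and> real (e div lpf e) < z \<and> rough (lpf e) (t div e)}.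
        of_int (mu e) * (short s * \<psi> t * F (s * t)))"
      by (rule sum.inter_filter[OF fin, symmetric])
    also have "\<dots> = of_int (\<Sum>e | e dvd t \<and> squarefree e \<and> smooth z e \<and> z \<le> real e \<and> real (e div lpf e) < z \<and> rough (lpf e) (t div e). mu e) * (short s * \<psi> t * F (s * t))"
      by (simp add: sum_distrib_right)
    finally have B: "?B = of_int (\<Sum>e | e dvd t \<and> squarefree e \<and> smooth z e \<and> z \<le> real e \<and> real (e div lpf e) < z \<and> rough (lpf e) (t div e). mu e) * (short s * \<psi> t * F (s * t))" .
    have "?A + ?B = of_int (if \<forall>p. prime p \<longrightarrow> p dvd t \<longrightarrow> z \<le> real p then 1 else 0) * (short s * \<psi> t * F (s * t))"
      unfolding A B distrib_right[symmetric] of_int_add[symmetric]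
      using truncated_legendre_sieve[of t z] t z(1) by simp
    note AB = this
    show ?thesis
    proof (cases "\<forall>p. prime p \<longrightarrow> p dvd t \<longrightarrow> z \<le> real p")
      case True
      show ?thesis unfolding AB if_P[OF True] by simp
    next
      case False
      show ?thesis unfolding AB if_not_P[OF False] by simp
    qed
  qed
  have "R \<psi> = (\<Sum>s=1..X. \<Sum>t=1..X. if s * t \<le> X then (\<Sum>d | d dvd t. \<mu> d * short s * \<psi> (t div d) * F (d * (s * (t div d))))
     + (\<Sum>e | e dvd t. if rough (lpf e) (t div e) then a' e * short s * \<psi> (t div e) * F (e * (s * (t div e))) else 0) else 0)"
    unfolding R_def by (intro sum.cong refl if_cong key)
  also have "\<dots> = (\<Sum>s=1..X. \<Sum>t=1..X. (if s * t \<le> X then \<Sum>d | d dvd t. \<mu> d * short s * \<psi> (t div d) * F (d * (s * (t div d))) else 0)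
     + (if s * t \<le> X then \<Sum>e | e dvd t. if rough (lpf e) (t div e) then a' e * short s * \<psi> (t div e) * F (e * (s * (t div e))) else 0 else 0))"
    by (intro sum.cong refl) auto
  also have "\<dots> = (\<Sum>s=1..X. \<Sum>t=1..X. if s * t \<le> X then \<Sum>d | d dvd t. \<mu> d * short s * \<psi> (t div d) * F (d * (s * (t div d))) else 0)
     + (\<Sum>s=1..X. \<Sum>t=1..X. if s * t \<le> X then \<Sum>e | e dvd t. if rough (lpf e) (t div e) then a' e * short s * \<psi> (t div e) * F (e * (s * (t div e))) else 0 else 0)"
    by (simp only: sum.distrib)
  also have "(\<Sum>s=1..X. \<Sum>t=1..X. if s * t \<le> X then \<Sum>d | d dvd t. \<mu> d * short s * \<psi> (t div d) * F (d * (s * (t div d))) else 0)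
    = (\<Sum>d=1..X. \<Sum>s=1..X. \<Sum>k=1..X. if d * (s * k) \<le> X then \<mu> d * short s * \<psi> k * F (d * (s * k)) else 0)"
    by (rule sum_divisors_of_second_factor)
  \<comment> \<open>After exchanging s and k, the same rearrangement is used backwards to collect d
    and s into the single variable m, leaving k free.\<close>
  also have "\<dots> = (\<Sum>d=1..X. \<Sum>k=1..X. \<Sum>s=1..X. if d * (k * s) \<le> X then \<mu> d * short s * \<psi> k * F (d * (k * s)) else 0)"
  proof (rule sum.cong[OF refl])
    fix d
    show "(\<Sum>s=1..X. \<Sum>k=1..X. if d * (s * k) \<le> X then \<mu> d * short s * \<psi> k * F (d * (s * k)) else 0)
      = (\<Sum>k=1..X. \<Sum>s=1..X. if d * (k * s) \<le> X then \<mu> d * short s * \<psi> k * F (d * (k * s)) else 0)"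
      by (subst sum.swap, intro sum.cong refl) (simp only: mult.commute)
  qed
  also have "\<dots> = (\<Sum>k=1..X. \<Sum>m=1..X. if k * m \<le> X then \<Sum>d | d dvd m. \<mu> d * short (m div d) * \<psi> k * F (d * (k * (m div d))) else 0)"
    by (rule sum_divisors_of_second_factor[symmetric])
  also have "\<dots> = (\<Sum>k=1..X. \<Sum>m=1..X. if m * k \<le> X then C m * \<psi> k * F (m * k) else 0)"
  proof (intro sum.cong refl)
    fix k m assume m: "m \<in> {1..X}"
    have "(\<Sum>d | d dvd m. \<mu> d * short (m div d) * \<psi> k * F (d * (k * (m div d)))) = (\<Sum>d | d dvd m. \<mu> d * short (m div d) * (\<psi> k * F (m * k)))"
    proof (rule sum.cong[OF refl])
      fix d assume "d \<in> {d. d dvd m}"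
      hence "d * (k * (m div d)) = m * k" by (metis dvd_mult_div_cancel mem_Collect_eq mult.commute mult.left_commute)
      thus "\<mu> d * short (m div d) * \<psi> k * F (d * (k * (m div d))) = \<mu> d * short (m div d) * (\<psi> k * F (m * k))"
        by (simp only: mult.assoc)
    qed
    also have "\<dots> = C m * \<psi> k * F (m * k)" using m by (simp add: C_def sum_distrib_right mult.assoc)
    finally show "(if k * m \<le> X then \<Sum>d | d dvd m. \<mu> d * short (m div d) * \<psi> k * F (d * (k * (m div d))) else 0)
       = (if m * k \<le> X then C m * \<psi> k * F (m * k) else 0)" by (simp add: mult.commute)
  qed
  also have "\<dots> = (\<Sum>m=1..X. \<Sum>k=1..X. if m * k \<le> X then C m * \<psi> k * F (m * k) else 0)" by (rule sum.swap)
  also have "(\<Sum>s=1..X. \<Sum>t=1..X. if s * t \<le> X then \<Sum>e | e dvd t. if rough (lpf e) (t div e) then a' e * short s * \<psi> (t div e) * F (e * (s * (t div e))) else 0 else 0)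
    = (\<Sum>e=1..X. \<Sum>s=1..X. \<Sum>k=1..X. if e * (s * k) \<le> X then (if rough (lpf e) k then a' e * short s * \<psi> k * F (e * (s * k)) else 0) else 0)"
    by (rule sum_divisors_of_second_factor)
  also have "\<dots> = (\<Sum>e=1..X. \<Sum>s=1..X. \<Sum>k=1..X. if e * (s * k) \<le> X \<and> rough (lpf e) k then a' e * short s * \<psi> k * F (e * (s * k)) else 0)"
    by (intro sum.cong refl) auto
  finally have "norm (R \<psi>) \<le> norm (\<Sum>m=1..X. \<Sum>k=1..X. if m * k \<le> X then C m * \<psi> k * F (m * k) else 0)
    + norm (\<Sum>e=1..X. \<Sum>s=1..X. \<Sum>k=1..X. if e * (s * k) \<le> X \<and> rough (lpf e) k then a' e * short s * \<psi> k * F (e * (s * k)) else 0)"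
    by (simp only: norm_triangle_ineq)
  also have "\<dots> \<le> 193 * T^3 * Lg\<^sup>2 * N * Om + BT"
  proof (rule add_mono)
    show "norm (\<Sum>m=1..X. \<Sum>k=1..X. if m * k \<le> X then C m * \<psi> k * F (m * k) else 0) \<le> 193 * T^3 * Lg\<^sup>2 * N * Om"
    proof (rule smooth_sum[OF \<psi>])
      show "norm (C m) \<le> T" for m
      proof (cases "m \<in> {1..X}")
        case True
        have "norm (C m) \<le> (\<Sum>d | d dvd m. 1)" unfolding C_def using True
        proof (simp only: if_True, intro sum_norm_le)
          fix d
          have "norm (\<mu> d) \<le> 1" using n1 by (simp add: \<mu>_def)
          hence "norm (\<mu> d) * norm (short (m div d)) \<le> 1 * 1" using norm_short by (intro mult_mono) auto
          thus "norm (\<mu> d * short (m div d)) \<le> 1" by (simp add: norm_mult)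
        qed
        also have "\<dots> = real (card {d. d dvd m})" by simp
        also have "\<dots> \<le> T"
        proof (rule divisors)
          have "real m \<le> N" using True X by auto
          also have "N * 1 \<le> N * N" using N by (intro mult_left_mono) auto
          finally show "real m \<le> 128 * N\<^sup>2" using N by (simp add: power2_eq_square)
        qed (use True in auto)
        finally show ?thesis .
      qed (use T in \<open>auto simp: C_def\<close>)
      show "real m * w ^ 4 \<le> 1" if "C m \<noteq> 0" for m
      proof -
        have "\<exists>d. d dvd m \<and> \<mu> d * short (m div d) \<noteq> 0"
        proof (rule ccontr)
          assume "\<nexists>d. d dvd m \<and> \<mu> d * short (m div d) \<noteq> 0"
          hence "C m = 0" unfolding C_def by (auto intro!: sum.neutral)
          thus False using that by simp
        qed
        then obtain d where d: "d dvd m" "real d < z" "real (m div d) < z" by (auto simp: \<mu>_def short_def split: if_splits)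
        have "real m = real d * real (m div d)" using d(1) by (metis dvd_mult_div_cancel of_nat_mult)
        also have "\<dots> \<le> z * z" using d z(1) by (intro mult_mono) auto
        finally show ?thesis unfolding z_iff by (simp add: power2_eq_square)
      qed
    qed
    show "norm (\<Sum>e=1..X. \<Sum>s=1..X. \<Sum>k=1..X. if e * (s * k) \<le> X \<and> rough (lpf e) k then a' e * short s * \<psi> k * F (e * (s * k)) else 0) \<le> BT"
      unfolding BT_def
    proof (rule coupled_bilinear_sum[where x = lpf])
      show "norm (a' m) \<le> 1" for m using n1 by (simp add: a'_def)
      show "1 \<le> real m * w\<^sup>2 \<and> real m * w ^ 4 \<le> 1" if "a' m \<noteq> 0" for m
      proof -
        have h: "smooth z m" "z \<le> real m" "real (m div lpf m) < z" using that by (auto simp: a'_def split: if_splits)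
        have m1: "m > 1" using h(2) z(1) by linarith
        have "real (lpf m) < z" using h(1) lpf[OF m1] by (auto simp: smooth_def)
        moreover have "real m = real (m div lpf m) * real (lpf m)" using lpf(2)[OF m1] by (metis dvd_div_mult_self of_nat_mult)
        ultimately have "real m \<le> z * z" using h(3) z(1) by (simp add: mult_mono)
        thus ?thesis using h(2) unfolding z_iff by (simp add: power2_eq_square)
      qed
    qed (auto simp: norm_short \<psi>(1))
  qed
  finally show ?thesis .
qed

text \<open>The sieve bounds \<open>R\<close>, which differs from \<open>J\<close> by the short sum;
  \<open>J\<close> in turn differs from the prime sum \<open>J1\<close> by a bilinear form. Solving
  for \<open>J1\<close> gives the bound.\<close>

lemma norm_J1_le:
  assumes \<psi>: "\<And>n. norm (\<psi> n) \<le> 1" "\<psi> 0 = 0" "\<And>n. \<psi> (n + 4) = \<psi> n" 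
    and mult: "\<And>m n. \<psi> (m * n) = \<psi> m * \<psi> n" and one: "\<psi> 1 = 1"
  shows "norm (J1 \<psi>) \<le> 193 * T^3 * Lg\<^sup>2 * N * Om + 2 * BT + z"
proof -
  have "J1 \<psi> = R \<psi> - (\<Sum>n=1..X. short n * F n) - (J \<psi> - J1 \<psi>)" using R_eq[OF mult one] by simp
  also have "norm \<dots> \<le> norm (R \<psi>) + norm (\<Sum>n=1..X. short n * F n) + norm (J \<psi> - J1 \<psi>)"
    by (meson add_mono_thms_linordered_semiring(3) norm_triangle_ineq4 order_trans)
  also have "\<dots> \<le> (193 * T^3 * Lg\<^sup>2 * N * Om + BT) + z + BT"
    by (intro add_mono norm_R_le[OF \<psi> mult] norm_sum_short_le norm_J_diff_J1 \<psi> one)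
  finally show ?thesis by simp
qed

text \<open>If the cofactor is below z <= p, then p exceeds all its prime factors and is the
  greatest prime of e. This turns the condition on a prefix e into a sum over factorizations e = p
  s.\<close>

lemma gpf_unique_large_prime:
  assumes "e \<ge> 1"
  shows "{p. p dvd e \<and> large_prime p \<and> real (e div p) < z} =
    (if z \<le> real e \<and> real (e div gpf e) < z \<and> z \<le> real (gpf e) then {gpf e} else {})"
proof -
  have "p = gpf e \<and> z \<le> real e" if p: "p dvd e" "large_prime p" "real (e div p) < z" for p
  proof -
    have pp: "prime p" "z \<le> real p" using p by (auto simp: large_prime_def)
    have "p \<le> e" using p assms by (auto dest: dvd_imp_le)
    have "gpf e = p"
    proof (rule gpf_eqI[OF pp(1) p(1)])
      fix r assume r: "prime r" "r dvd e"
      have "e = p * (e div p)" using p by simp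
      hence "r dvd p \<or> r dvd e div p" using r prime_dvd_mult_iff by metis
      thus "r \<le> p"
      proof
        assume "r dvd e div p"
        moreover have "e div p > 0" using p assms by (metis \<open>p \<le> e\<close> div_greater_zero_iff pp(1) prime_gt_0_nat)
        ultimately have "r \<le> e div p" by (auto dest: dvd_imp_le)
        thus ?thesis using pp(2) p(3) by linarith
      qed (use r pp in \<open>auto dest: primes_dvd_imp_eq\<close>)
    qed (use assms in auto)
    thus ?thesis using \<open>p \<le> e\<close> pp(2) by simp
  qed
  moreover have "gpf e dvd e \<and> large_prime (gpf e)" if "z \<le> real e" "z \<le> real (gpf e)"
  proof -
    have "e > 1" using that z(1) by linarith
    thus ?thesis using gpf(1,2) that by (simp add: large_prime_def)
  qed
  ultimately show ?thesis by (auto simp: large_prime_def)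
qed

text \<open>The prefix e that first reaches z satisfies e <= z^2 when its greatest prime is below z;
  these terms form \<open>I1\<close>. Otherwise e = p s with p >= z, and these terms form
  \<open>I2\<close>, which equals \<open>J b\<close>. The numbers n < z have no such prefix and are
  estimated trivially.\<close>

lemma norm_sum_b_le: "norm (\<Sum>n=1..X. b n * F n) \<le> 2300 * T^3 * Lg^3 * N * Om"
proof -
  define P where "P = (\<lambda>e. z \<le> real e \<and> real (e div gpf e) < z)"
  define a' where "a' = (\<lambda>e. if P e \<and> real (gpf e) < z then b e else 0)"
  \<comment> \<open>Makes the middle variable of \<open>coupled_bilinear_sum\<close>
    trivial.\<close>
  define g where "g = (\<lambda>s::nat. if s = 1 then 1 else (0::complex))"
  define I1 where "I1 = (\<Sum>e=1..X. \<Sum>k=1..X. if e * k \<le> X \<and> rough (gpf e) k then a' e * b k * F (e * k) else 0)"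
  define I2 where "I2 = (\<Sum>k=1..X. \<Sum>e=1..X. if k * e \<le> X then
     (if P e \<and> z \<le> real (gpf e) \<and> rough (gpf e) k then b e * b k * F (e * k) else 0) else 0)"
  have "(\<Sum>n=1..X. b n * F n) = (\<Sum>n=1..X. short n * F n + (\<Sum>e | e dvd n. if P e \<and> rough (gpf e) (n div e) then b e * b (n div e) * F (e * (n div e)) else 0))"
  proof (rule sum.cong[OF refl])
    fix n assume n: "n \<in> {1..X}"
    have "(\<Sum>e | e dvd n. if P e \<and> rough (gpf e) (n div e) then b e * b (n div e) * F (e * (n div e)) else 0)
       = (\<Sum>e | e dvd n. if P e \<and> rough (gpf e) (n div e) then b n * F n else 0)"
      by (rule sum.cong[OF refl]) (auto simp flip: b_mult)
    also have "\<dots> = of_nat (card {e \<in> {e. e dvd n}. P e \<and> rough (gpf e) (n div e)}) * (b n * F n)"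
      using n by (intro sum_if_const_card) (simp add: finite_divisors_nat)
    also have "{e \<in> {e. e dvd n}. P e \<and> rough (gpf e) (n div e)} =
      {e. e dvd n \<and> z \<le> real e \<and> real (e div gpf e) < z \<and> rough (gpf e) (n div e)}" by (auto simp: P_def)
    also have "card \<dots> = (if real n < z then 0 else 1)" using n z(1) by (intro card_first_prefix) auto
    finally show "b n * F n = short n * F n + (\<Sum>e | e dvd n. if P e \<and> rough (gpf e) (n div e) then b e * b (n div e) * F (e * (n div e)) else 0)"
      by (simp add: short_def)
  qed
  also have "\<dots> = (\<Sum>n=1..X. short n * F n) + (\<Sum>e=1..X. \<Sum>k=1..X. if e * k \<le> X then (if P e \<and> rough (gpf e) k then b e * b k * F (e * k) else 0) else 0)"
    unfolding sum.distrib
    by (simp only: sum_over_factorizations[where G = "\<lambda>e k. if P e \<and> rough (gpf e) k then b e * b k * F (e * k) else 0"])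
  also have "(\<Sum>e=1..X. \<Sum>k=1..X. if e * k \<le> X then (if P e \<and> rough (gpf e) k then b e * b k * F (e * k) else 0) else 0)
     = (\<Sum>e=1..X. \<Sum>k=1..X. (if e * k \<le> X \<and> rough (gpf e) k then a' e * b k * F (e * k) else 0) +
       (if k * e \<le> X then (if P e \<and> z \<le> real (gpf e) \<and> rough (gpf e) k then b e * b k * F (e * k) else 0) else 0))"
    by (intro sum.cong refl) (auto simp: a'_def mult.commute not_less)
  also have "\<dots> = I1 + I2" unfolding I1_def I2_def sum.distrib by (subst (3) sum.swap) simp
  finally have S: "(\<Sum>n=1..X. b n * F n) = (\<Sum>n=1..X. short n * F n) + (I1 + I2)" .
  have I1: "norm I1 \<le> BT"
  proof -
    have "I1 = (\<Sum>e=1..X. \<Sum>s=1..X. \<Sum>k=1..X. if e * (s * k) \<le> X \<and> rough (gpf e) k then a' e * g s * b k * F (e * (s * k)) else 0)"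
      unfolding I1_def
    proof (rule sum.cong[OF refl])
      fix e assume e: "e \<in> {1..X}"
      have "(\<Sum>s=1..X. \<Sum>k=1..X. if e * (s * k) \<le> X \<and> rough (gpf e) k then a' e * g s * b k * F (e * (s * k)) else 0)
        = (\<Sum>s\<in>{1..X}. if s = 1 then \<Sum>k=1..X. if e * k \<le> X \<and> rough (gpf e) k then a' e * b k * F (e * k) else 0 else 0)"
        by (rule sum.cong[OF refl]) (auto simp: g_def intro!: sum.neutral cong: if_cong)
      also have "\<dots> = (\<Sum>k=1..X. if e * k \<le> X \<and> rough (gpf e) k then a' e * b k * F (e * k) else 0)"
        using e by (subst sum.delta) auto
      finally show "(\<Sum>k=1..X. if e * k \<le> X \<and> rough (gpf e) k then a' e * b k * F (e * k) else 0) =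
        (\<Sum>s=1..X. \<Sum>k=1..X. if e * (s * k) \<le> X \<and> rough (gpf e) k then a' e * g s * b k * F (e * (s * k)) else 0)" by simp
    qed
    also have "norm \<dots> \<le> BT" unfolding BT_def
    proof (rule coupled_bilinear_sum[where x = gpf])
      show "1 \<le> real m * w\<^sup>2 \<and> real m * w ^ 4 \<le> 1" if "a' m \<noteq> 0" for m
      proof -
        have h: "real (gpf m) < z" "z \<le> real m" "real (m div gpf m) < z" using that by (auto simp: a'_def P_def split: if_splits)
        have m1: "m > 1" using h(2) z(1) by linarith
        have "real m = real (m div gpf m) * real (gpf m)" using gpf(2)[OF m1] by (metis dvd_div_mult_self of_nat_mult)
        hence "real m \<le> z * z" using h z(1) by (simp add: mult_mono)
        thus ?thesis using h(2) unfolding z_iff by (simp add: power2_eq_square)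
      qed
    qed (auto simp: a'_def g_def norm_b_le)
    finally show ?thesis .
  qed
  have "I2 = (\<Sum>k=1..X. \<Sum>e=1..X. if k * e \<le> X then
      \<Sum>p | p dvd e. if large_prime p \<and> rough p k then short (e div p) * b p * b k * F (p * (k * (e div p))) else 0 else 0)"
    unfolding I2_def
  proof (intro sum.cong refl if_cong)
    fix k e assume e: "e \<in> {1..X}"
    have fin: "finite {p. p dvd e}" using e by (simp add: finite_divisors_nat)
    have "(\<Sum>p | p dvd e. if large_prime p \<and> rough p k then short (e div p) * b p * b k * F (p * (k * (e div p))) else 0)
       = (\<Sum>p | p dvd e. if large_prime p \<and> real (e div p) < z then (if rough p k then b e * b k * F (e * k) else 0) else 0)"
    proof (rule sum.cong[OF refl])
      fix p assume "p \<in> {p. p dvd e}"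
      hence "e = p * (e div p)" by simp
      hence 1: "b e = b p * b (e div p)" and 2: "e * k = p * (k * (e div p))"
        by (metis b_mult, metis mult.commute mult.left_commute)
      have "F (e * k) = F (p * (k * (e div p)))" by (simp only: 2)
      thus "(if large_prime p \<and> rough p k then short (e div p) * b p * b k * F (p * (k * (e div p))) else 0)
        = (if large_prime p \<and> real (e div p) < z then (if rough p k then b e * b k * F (e * k) else 0) else 0)"
        by (simp add: short_def 1)
    qed
    also have "\<dots> = (\<Sum>p\<in>{p \<in> {p. p dvd e}. large_prime p \<and> real (e div p) < z}. if rough p k then b e * b k * F (e * k) else 0)"
      by (rule sum.inter_filter[OF fin, symmetric])
    also have "{p \<in> {p. p dvd e}. large_prime p \<and> real (e div p) < z} = (if P e \<and> z \<le> real (gpf e) then {gpf e} else {})"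
      using gpf_unique_large_prime[of e] e by (auto simp: P_def)
    also have "(\<Sum>p\<in>\<dots>. if rough p k then b e * b k * F (e * k) else 0) = (if P e \<and> z \<le> real (gpf e) \<and> rough (gpf e) k then b e * b k * F (e * k) else 0)"
      by auto
    finally show "(if P e \<and> z \<le> real (gpf e) \<and> rough (gpf e) k then b e * b k * F (e * k) else 0) =
      (\<Sum>p | p dvd e. if large_prime p \<and> rough p k then short (e div p) * b p * b k * F (p * (k * (e div p))) else 0)" by simp
  qed
  also have "\<dots> = (\<Sum>p=1..X. \<Sum>k=1..X. \<Sum>s=1..X. if p * (k * s) \<le> X then
      (if large_prime p \<and> rough p k then short s * b p * b k * F (p * (k * s)) else 0) else 0)"
    by (rule sum_divisors_of_second_factor)
  also have "\<dots> = J b" unfolding J_def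
  proof (rule sum.cong[OF refl])
    fix p
    show "(\<Sum>k=1..X. \<Sum>s=1..X. if p * (k * s) \<le> X then
        (if large_prime p \<and> rough p k then short s * b p * b k * F (p * (k * s)) else 0) else 0)
      = (\<Sum>s=1..X. \<Sum>k=1..X. if p * (s * k) \<le> X then
        (if large_prime p \<and> rough p k then short s * b p * b k * F (p * (s * k)) else 0) else 0)"
      by (subst sum.swap, intro sum.cong refl) (simp only: mult.commute)
  qed
  finally have I2: "I2 = J b" .
  \<comment> \<open>\<open>b\<close> agrees with the mean of the characters at primes but not at
    general integers, so the replacement is made only in \<open>J1\<close>, where f is evaluated at
    primes alone.\<close>
  have J1b: "J1 b = (J1 chi0 + J1 chi4) / 2"
  proof -
    have "J1 b = (\<Sum>p=1..X. \<Sum>s=1..X. ((if p * s \<le> X \<and> large_prime p then short s * chi0 p * F (p * s) else 0)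
       + (if p * s \<le> X \<and> large_prime p then short s * chi4 p * F (p * s) else 0)) / 2)"
      unfolding J1_def by (intro sum.cong refl) (auto simp: large_prime_def b_prime_eq_characters algebra_simps)
    thus ?thesis unfolding J1_def by (simp only: sum.distrib sum_divide_distrib[symmetric])
  qed
  define U where "U = 193 * T^3 * Lg\<^sup>2 * N * Om + 2 * BT + z"
  have "norm (J1 chi0) \<le> U" unfolding U_def
    by (rule norm_J1_le) (auto simp: chi0_def)
  moreover have "norm (J1 chi4) \<le> U" unfolding U_def
    by (rule norm_J1_le[OF _ _ _ chi4_mult]) (auto simp: chi4_def)
  ultimately have "norm (J1 chi0 + J1 chi4) \<le> U + U" by (meson add_mono norm_triangle_ineq order_trans)
  hence J1: "norm (J1 b) \<le> U" unfolding J1b by (simp add: norm_divide)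
  have Jb: "norm (J b - J1 b) \<le> BT" by (rule norm_J_diff_J1) (auto simp: norm_b_le b_1)
  have "(\<Sum>n=1..X. b n * F n) = (\<Sum>n=1..X. short n * F n) + I1 + (J b - J1 b) + J1 b" unfolding S I2 by simp
  also have "norm \<dots> \<le> norm (\<Sum>n=1..X. short n * F n) + norm I1 + norm (J b - J1 b) + norm (J1 b)"
    by (meson add_mono norm_triangle_ineq order_refl order_trans)
  also have "\<dots> \<le> z + BT + BT + U" using I1 Jb J1 norm_sum_short_le by linarith
  \<comment> \<open>In units of \<open>E\<close> the total is 2 + 4 * 510 + 193 = 2235.\<close>
  also have "\<dots> \<le> 2300 * T^3 * Lg^3 * N * Om"
  proof -
    define E where "E = T^3 * Lg^3 * N * Om"
    have NO: "N * Om \<ge> 0" using N uvw_pos by simp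
    have "T\<^sup>2 * Lg^3 * (N * Om) \<le> T^3 * Lg^3 * (N * Om)"
      using T Lg NO by (intro mult_right_mono power_increasing) auto
    hence 1: "BT \<le> 510 * E" unfolding BT_def E_def by (simp add: mult_ac)
    have "T^3 * Lg\<^sup>2 * (N * Om) \<le> T^3 * Lg^3 * (N * Om)"
      using T Lg NO by (intro mult_right_mono mult_left_mono power_increasing) auto
    hence 2: "193 * T^3 * Lg\<^sup>2 * N * Om \<le> 193 * E" unfolding E_def by (simp add: mult_ac)
    have "1 * 1 * (N * Om) \<le> T^3 * Lg^3 * (N * Om)"
      using T Lg NO by (intro mult_right_mono mult_mono one_le_power) auto
    hence 3: "z \<le> E" using z(3) unfolding E_def by (simp add: mult_ac)
    have "0 \<le> E" using 3 z(1) by linarith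
    hence "z + BT + BT + U \<le> 2300 * E" unfolding U_def using 1 2 3 by linarith
    thus ?thesis by (simp add: E_def mult_ac)
  qed
  finally show ?thesis .
qed

end

section \<open>Choice of parameters and the trivial range of q\<close>

theorem theorem1p1:
  fixes \<epsilon> :: real
  assumes "\<epsilon> > 0"
  shows "\<exists>C>0. \<forall>(\<alpha>::real) (a::int) (q::int) (N::real).
           q \<ge> 1 \<longrightarrow> coprime a q \<longrightarrow>
           \<bar>\<alpha> - real_of_int a / real_of_int q\<bar> < 1 / (real_of_int q)\<^sup>2 \<longrightarrow> N \<ge> 2 \<longrightarrow>
           norm (S \<alpha> N) / (N / sqrt (ln N))
             \<le> C * (N powr \<epsilon> * (real_of_int q powr (- 1/4)
                 + N powr (- 1/2) * real_of_int q powr (1/4) + N powr (- 1/8)))"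
proof -
  \<comment> \<open>T is of order N^(2 \<delta>) and \<open>Lg\<close> is at most of order
    N^\<delta>. The bound contains T^3 and four factors \<open>Lg\<close>, the fourth coming from
    the square root of ln N, so the exponents add up to 10 \<delta>.\<close>
  define \<delta> where "\<delta> = \<epsilon> / 10"
  have \<delta>: "\<delta> > 0" "10 * \<delta> = \<epsilon>" using assms by (auto simp: \<delta>_def)
  obtain C1 where C1: "C1 \<ge> 1" "\<And>n::nat. n \<ge> 1 \<Longrightarrow> real (card {d. d dvd n}) \<le> C1 * real n powr \<delta>"
    using divisor_bound[OF \<delta>(1)] by blast
  define C2 where "C2 = 1 + 1 / \<delta>"
  have C2: "C2 \<ge> 1" using \<delta> by (simp add: C2_def)
  define D where "D = C1 * 128 powr \<delta>"
  have "1 * 1 \<le> C1 * 128 powr \<delta>" using C1 \<delta> by (intro mult_mono ge_one_powr_ge_zero) auto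
  hence D: "D \<ge> 1" by (simp add: D_def)
  define C where "C = 2300 * D^3 * C2^4"
  have C: "C2 \<le> C" "C > 0"
  proof -
    have "1 * 1 * C2 ^ 1 \<le> 2300 * D^3 * C2^4"
      using C2 D by (intro mult_mono power_increasing one_le_power) auto
    thus "C2 \<le> C" by (simp add: C_def)
    thus "C > 0" using C2 by linarith
  qed
  show ?thesis
  proof (intro exI[of _ C] conjI allI impI)
    show "C > 0" by (rule C)
    fix \<alpha> N :: real and a q :: int
    assume q: "q \<ge> 1" and cop: "coprime a q" and ap: "\<bar>\<alpha> - real_of_int a / real_of_int q\<bar> < 1 / (real_of_int q)\<^sup>2"
      and N: "N \<ge> 2"
    define \<Omega> where "\<Omega> = real_of_int q powr (- 1/4) + N powr (- 1/2) * real_of_int q powr (1/4) + N powr (- 1/8)"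
    have \<Omega>0: "\<Omega> \<ge> 0" by (simp add: \<Omega>_def)
    have ln_le: "1 + ln N \<le> C2 * N powr \<delta>"
    proof -
      have "ln N \<le> N powr \<delta> / \<delta>" using N \<delta> by (intro ln_powr_bound) auto
      moreover have "1 \<le> N powr \<delta>" using N \<delta> by (intro ge_one_powr_ge_zero) auto
      ultimately show ?thesis by (simp add: C2_def algebra_simps)
    qed
    have lnN: "0 < ln N" using N by simp
    have sq: "sqrt (ln N) \<le> 1 + ln N"
      using lnN by (intro real_le_lsqrt) (auto simp: power2_eq_square algebra_simps)
    have set: "{n. 1 \<le> n \<and> real n \<le> N} = {1..nat \<lfloor>N\<rfloor>}" using N by (auto simp: le_nat_floor_iff)
    have eq: "norm (S \<alpha> N) / (N / sqrt (ln N)) = norm (S \<alpha> N) / N * sqrt (ln N)" by simp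
    have goal: "norm (S \<alpha> N) / (N / sqrt (ln N)) \<le> C * (N powr \<epsilon> * \<Omega>)"
    proof (cases "real_of_int q \<le> N\<^sup>2")
      case True
      define T where "T = D * N powr (2 * \<delta>)"
      interpret quadratic_phase \<alpha> N T a q
      proof
        have "1 * 1 \<le> D * N powr (2 * \<delta>)" using D N \<delta> by (intro mult_mono ge_one_powr_ge_zero) auto
        thus "1 \<le> T" by (simp add: T_def)
        fix n :: nat assume n: "n \<ge> 1" "real n \<le> 128 * N\<^sup>2"
        have "real (card {d. d dvd n}) \<le> C1 * real n powr \<delta>" by (rule C1(2)[OF n(1)])
        also have "\<dots> \<le> C1 * (128 * N\<^sup>2) powr \<delta>" using n C1 \<delta> by (intro mult_left_mono powr_mono2) auto
        also have "(128 * N\<^sup>2) powr \<delta> = 128 powr \<delta> * (N powr 2) powr \<delta>"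
          using N by (simp add: powr_mult)
        also have "(N powr 2) powr \<delta> = N powr (2 * \<delta>)" by (rule powr_powr)
        finally show "real (card {d. d dvd n}) \<le> T" by (simp add: T_def D_def mult_ac)
      qed (use q cop ap N True in auto)
      have Om: "Om = \<Omega>" by (simp add: Om_def u_def v_def w_def \<Omega>_def)
      have "S \<alpha> N = (\<Sum>n=1..X. b n * F n)" unfolding S_def set X_def F_def ..
      hence "norm (S \<alpha> N) \<le> 2300 * T^3 * Lg^3 * N * \<Omega>" using norm_sum_b_le Om by simp
      hence "norm (S \<alpha> N) / N \<le> 2300 * T^3 * Lg^3 * \<Omega>" using N by (simp add: divide_le_eq mult_ac)
      hence "norm (S \<alpha> N) / N * sqrt (ln N) \<le> (2300 * T^3 * Lg^3 * \<Omega>) * Lg"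
        using sq lnN N T Lg \<Omega>0 by (intro mult_mono) (auto simp: Lg_def)
      also have "\<dots> = 2300 * T^3 * Lg^4 * \<Omega>" by (simp add: power_eq_if)
      also have "\<dots> \<le> 2300 * T^3 * (C2 * N powr \<delta>)^4 * \<Omega>"
        using T ln_le \<Omega>0 lnN by (intro mult_right_mono mult_left_mono power_mono) (auto simp: Lg_def)
      also have "\<dots> = C * ((N powr (2*\<delta>))^3 * (N powr \<delta>)^4 * \<Omega>)"
        by (simp add: T_def C_def power_mult_distrib mult_ac)
      also have "(N powr (2*\<delta>))^3 * (N powr \<delta>)^4 = N powr (10 * \<delta>)"
        using N by (simp add: powr_power flip: powr_add)
      finally show ?thesis unfolding eq \<delta>(2) .
    next
      \<comment> \<open>If q > N^2, then N^(-1/2) q^(1/4) >= 1, and the trivial bound N for the sum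
        suffices.\<close>
      case False
      have "norm (S \<alpha> N) \<le> (\<Sum>n\<in>{1..nat \<lfloor>N\<rfloor>}. 1)" unfolding S_def set
        by (rule sum_norm_le) (simp add: norm_mult norm_b_le)
      also have "\<dots> \<le> N" using N by simp
      finally have "norm (S \<alpha> N) / N * sqrt (ln N) \<le> 1 * (1 + ln N)"
        using N sq lnN by (intro mult_mono) auto
      also have "\<dots> \<le> C2 * N powr \<delta>" using ln_le by simp
      also have "\<dots> \<le> C * N powr \<epsilon>"
        using C C2 N \<delta> by (intro mult_mono powr_mono) (auto simp: \<delta>_def)
      also have "\<dots> \<le> C * N powr \<epsilon> * \<Omega>"
      proof -
        have "(N powr 2) powr (1/4) \<le> real_of_int q powr (1/4)" using False N by (intro powr_mono2) auto
        hence "N powr (1/2) \<le> real_of_int q powr (1/4)" by (simp add: powr_powr)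
        hence "N powr (-1/2) * N powr (1/2) \<le> N powr (-1/2) * real_of_int q powr (1/4)" by (intro mult_left_mono) auto
        moreover have "N powr (-1/2) * N powr (1/2) = 1" using N by (simp flip: powr_add)
        ultimately have "1 \<le> N powr (-1/2) * real_of_int q powr (1/4)" by simp
        hence "1 \<le> \<Omega>" unfolding \<Omega>_def using powr_ge_zero[of "real_of_int q" "-1/4"] powr_ge_zero[of N "-1/8"] by linarith
        thus ?thesis using C mult_left_mono[of 1 \<Omega> "C * N powr \<epsilon>"] by simp
      qed
      finally show ?thesis unfolding eq by (simp add: mult.assoc)
    qed
    show "norm (S \<alpha> N) / (N / sqrt (ln N))
             \<le> C * (N powr \<epsilon> * (real_of_int q powr (- 1/4)
                 + N powr (- 1/2) * real_of_int q powr (1/4) + N powr (- 1/8)))"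
      using goal unfolding \<Omega>_def .
  qed
qed

end
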